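(* Let $s\in(0,1)$ and $\beta>0$, and let $\mathbb{P}_{N,\beta}$ be the circular Riesz gas defined in the context. Let $\varepsilon\in(0,1)$ and $\delta=\frac{\varepsilon}{4(s+2)}$. There exist constants $C(\beta)>0$ and $c(\beta)>0$ (depending only on $s,\varepsilon,\beta$, locally uniform in $\beta$, and independent of $N,i,k$) such that for every $N$, every $i\in\{1,\ldots,N\}$ and every integer $1\leq k\leq \frac{N}{2}$, $$\mathbb{P}_{N,\beta}\bigl(|N(x_{i+k}-x_i)-k|\leq k^{\frac{s}{2}+\varepsilon}\bigr)\geq 1-C(\beta)e^{-c(\beta)k^{\delta}}.$$ Similarly, for every $\varepsilon\in(0,1)$, setting $\delta=\frac{\varepsilon}{2(s+2)}$, there exist constants $C(\beta)>0$, $c(\beta)>0$ (locally uniform in $\beta$, independent of $N,a,\ell_N$) such that for all $a\in\mathbb{T}$ and all $\ell_N\in(0,\frac14)$, $$\mathbb{P}_{N,\beta}\Bigl(\Bigl|\sum_{i=1}^N \mathds{1}_{(a-\ell_N,a+\ell_N)}(x_i)-2N\ell_N\Bigr|\leq (N\ell_N)^{\frac{s}{2}+\varepsilon}\Bigr)\geq 1-C(\beta)e^{-c(\beta)(N\ell_N)^{\delta}}.$$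
   Context: Fix $s\in(0,1)$ and let $\mathbb{T}=\mathbb{R}/\mathbb{Z}$. For $x\in\mathbb{T}\setminus\{0\}$, identified with its representative in $(0,1)$, let $g(x)=\zeta(s,x)+\zeta(s,1-x)=\lim_{n\to\infty}\bigl(\sum_{k=-n}^n|k+x|^{-s}-\frac{2}{1-s}n^{1-s}\bigr)$, where $\zeta(s,a)$ is the Hurwitz zeta function; $g$ is the fundamental solution of the fractional Laplace equation $(-\Delta)^{\frac{1-s}{2}}g=c_s(\delta_0-1)$ on $\mathbb{T}$. Let $D_N=\{X_N=(x_1,\ldots,x_N)\in\mathbb{T}^N: x_2-x_1<\cdots<x_N-x_1\}$, where differences in $\mathbb{T}$ are compared through their representatives in $[0,1)$ (configurations ordered counterclockwise). Let $\mathcal{H}_N(X_N)=N^{-s}\sum_{i\neq j}g(x_i-x_j)$ and, for $\beta>0$, $d\mathbb{P}_{N,\beta}=Z_{N,\beta}^{-1}e^{-\beta\mathcal{H}_N(X_N)}\mathds{1}_{D_N}(X_N)\,dX_N$ with $Z_{N,\beta}$ the normalizing constant. Indices are understood modulo $N$, and for $1\le k\le N-1$, $x_{i+k}-x_i$ denotes the representative in $[0,1)$ of the difference in $\mathbb{T}$ (the length of the counterclockwise arc from $x_i$ to $x_{i+k}$). "Locally uniform in $\beta$" means the constants stay bounded (and bounded away from $0$) when $\beta$ ranges over compact subsets of $(0,\infty)$. *)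

theory Defs
  imports "HOL-Analysis.Analysis" "HOL-Probability.Probability"
begin

text \<open>Points of the torus R/Z are represented by reals in [0,1).
  Configurations are functions x :: nat => real with x i in [0,1) for i < N
  (0-based indices; the paper's x_{i+1} is our x i), extensional outside {..<N}.\<close>

text \<open>Representative in [0,1) of the torus difference x - y
  (length of the counterclockwise arc from y to x).\<close>
definition tdiff :: "real \<Rightarrow> real \<Rightarrow> real" where
  "tdiff x y = frac (x - y)"

text \<open>g(x) = zeta(s,x) + zeta(s,1-x), via the limit given in the paper.\<close>
definition riesz_g :: "real \<Rightarrow> real \<Rightarrow> real" where
  "riesz_g s x = lim (\<lambda>n::nat. (\<Sum>k\<in>{- int n..int n}. \<bar>real_of_int k + x\<bar> powr (- s))
                          - 2 / (1 - s) * real n powr (1 - s))"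

definition riesz_H :: "real \<Rightarrow> nat \<Rightarrow> (nat \<Rightarrow> real) \<Rightarrow> real" where
  "riesz_H s N x = real N powr (- s) *
     (\<Sum>i<N. \<Sum>j<N. if i \<noteq> j then riesz_g s (tdiff (x i) (x j)) else 0)"

definition D_set :: "nat \<Rightarrow> (nat \<Rightarrow> real) set" where
  "D_set N = {x \<in> PiE {..<N} (\<lambda>_. {0..<1}).
      \<forall>j. 1 \<le> j \<longrightarrow> j + 1 < N \<longrightarrow> tdiff (x j) (x 0) < tdiff (x (j + 1)) (x 0)}"

definition gibbs_weight :: "real \<Rightarrow> real \<Rightarrow> nat \<Rightarrow> (nat \<Rightarrow> real) \<Rightarrow> real" where
  "gibbs_weight s \<beta> N x = indicator (D_set N) x * exp (- \<beta> * riesz_H s N x)"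

definition riesz_prob :: "real \<Rightarrow> real \<Rightarrow> nat \<Rightarrow> (nat \<Rightarrow> real) set \<Rightarrow> real" where
  "riesz_prob s \<beta> N A =
     enn2real ((\<integral>\<^sup>+ x. ennreal (indicator A x * gibbs_weight s \<beta> N x) \<partial>(PiM {..<N} (\<lambda>_. lborel)))
             / (\<integral>\<^sup>+ x. ennreal (gibbs_weight s \<beta> N x) \<partial>(PiM {..<N} (\<lambda>_. lborel))))"

definition loc_unif :: "(real \<Rightarrow> real) \<Rightarrow> bool" where
  "loc_unif C \<longleftrightarrow> (\<forall>\<beta>>0. C \<beta> > 0) \<and>
     (\<forall>K. compact K \<and> K \<subseteq> {0<..} \<longrightarrow> (\<exists>M>0. \<forall>\<beta>\<in>K. C \<beta> \<le> M \<and> 1 / M \<le> C \<beta>))"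

definition in_arc :: "real \<Rightarrow> real \<Rightarrow> real \<Rightarrow> bool" where
  "in_arc a l y \<longleftrightarrow> (\<exists>m::int. \<bar>y - a - real_of_int m\<bar> < l)"

end

theory Submission
  imports Defs "HOL-Real_Asymp.Real_Asymp"
begin

text \<open>
  Write the gas in coordinates \<open>(c, z)\<close>, where \<open>c\<close> is the first point and \<open>z j\<close> the length of the arc from
  the first to the \<open>j\<close>-th point. Then \<open>c\<close> is uniform and independent of \<open>z\<close>, whose density is log-concave
  because \<open>g\<close> is convex on \<open>(0, 1)\<close>; by cyclic invariance \<open>N z k\<close> has mean \<open>k\<close>.

  By the Prekopa--Leindler inequality tails of \<open>N z k\<close> are log-concave, so that \<open>N z k\<close> has moments of order
  \<open>s + 2\<close> bounded by \<open>k powr (s + 2)\<close>. A long gap is a weighted sum of all the gaps \<open>z j - z i\<close>, \<open>i < j \<le> k\<close>, and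
  the second derivative of the energy in the direction of each of them is at least its length to
  the power \<open>- s - 2\<close>. By Cauchy--Schwarz the convexity defect of the energy between two
  configurations controls the squared difference of \<open>N z k\<close> divided by a random variable with expectation
  \<open>O (k powr s)\<close>. A second use of Prekopa--Leindler turns this into fluctuations of order \<open>k powr (s / 2)\<close>, and
  log-concavity upgrades them to exponential tails, which beats the claimed rate.

  For the number of points in an arc, number the points from the first one after the left end of the
  arc. A wrong count forces a deviating gap there; the base point is size-biased by the length of
  the arc preceding it, which has bounded moments.
\<close>

text \<open>The obstacle is that the curvature of the interaction decays like the power
  \<open>- s - 2\<close> of the distance, and gaps measured in units of \<open>1 / N\<close> are
  unbounded in \<open>N\<close>: no deterministic convexity constant gives the right order. The
  curvature is therefore kept at its random value. It enters the exponential moments as a penalty,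
  \<open>roughness\<close>, which splits into a term for each of two configurations; this is what
  allows Prekopa--Leindler to be applied to a product of two exponentials. The exponent
  \<open>s\<close> is the growth of an effective resistance: if the pair \<open>i < j\<close> is a
  resistor of strength \<open>(j - i) powr (s + 2)\<close>, a unit current can be sent from 0 to
  \<open>k\<close> with dissipation of order \<open>k powr s\<close>. Convexity is used only as a
  defect at midpoints. Such an inequality holds for each partial sum of \<open>g\<close> and
  survives the limit, so \<open>g\<close> is never differentiated. Midpoints also suffice for the
  tails: a log-concave tail that halves over one window halves over each further window of the same
  width, so a crude bound at a single scale becomes exponential decay.\<close>

section \<open>The Prekopa--Leindler inequality at midpoints\<close>

lemma emeasure_lborel_half_vimage:
  fixes A :: "real set"
  assumes [measurable]: "A \<in> sets borel"
  shows "emeasure lborel A = 2 * emeasure lborel {x. 2 * x - b \<in> A}"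
proof -
  have "emeasure lborel A = (\<integral>\<^sup>+ x. indicator A x \<partial>lborel)" by simp
  also have "\<dots> = ennreal \<bar>2\<bar> * (\<integral>\<^sup>+ x. indicator A (- b + 2 * x) \<partial>lborel)"
    by (rule nn_integral_real_affine) auto
  also have "(\<integral>\<^sup>+ x. indicator A (- b + 2 * x) \<partial>lborel)
      = (\<integral>\<^sup>+ x. indicator {x. 2 * x - b \<in> A} x \<partial>lborel)"
    by (intro nn_integral_cong) (auto simp: indicator_def algebra_simps)
  also have "\<dots> = emeasure lborel {x. 2 * x - b \<in> A}"
    by (rule nn_integral_indicator) measurable
  finally show ?thesis by simp
qed

text \<open>For \<open>a\<close> near the supremum of \<open>A\<close> and \<open>b\<close> near the
  infimum of \<open>B\<close>, the sets \<open>(A + b) / 2\<close> and \<open>(a + B) / 2\<close>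
  lie in \<open>H\<close> and have half the measure of \<open>A\<close> and \<open>B\<close>. The
  first ends at \<open>(Sup A + b) / 2\<close> and the second begins at
  \<open>(a + Inf B) / 2\<close>, so they overlap in length at most \<open>e / 2\<close>.\<close>

lemma brunn_minkowski_midpoint_bounded:
  fixes A B H :: "real set"
  assumes [measurable]: "A \<in> sets borel" "B \<in> sets borel" "H \<in> sets borel"
    and ne: "A \<noteq> {}" "B \<noteq> {}" and bd: "bdd_above A" "bdd_below B"
    and mid: "\<And>a b. a \<in> A \<Longrightarrow> b \<in> B \<Longrightarrow> (a + b) / 2 \<in> H"
  shows "emeasure lborel A + emeasure lborel B \<le> 2 * emeasure lborel H"
proof (rule ennreal_le_epsilon)
  fix e :: real assume e: "e > 0"
  obtain a where a: "a \<in> A" "a > Sup A - e / 2"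
    using less_cSup_iff[OF ne(1) bd(1), of "Sup A - e / 2"] e by auto
  obtain b where b: "b \<in> B" "b < Inf B + e / 2"
    using cInf_less_iff[OF ne(2) bd(2), of "Inf B + e / 2"] e by auto
  define H1 where "H1 = {x. 2 * x - b \<in> A}"
  define H2 where "H2 = {x. 2 * x - a \<in> B}"
  have [measurable]: "H1 \<in> sets borel" "H2 \<in> sets borel" unfolding H1_def H2_def by measurable
  have sub: "H1 \<union> H2 \<subseteq> H"
  proof
    fix x assume "x \<in> H1 \<union> H2"
    then show "x \<in> H"
      using mid[of "2 * x - b" b] mid[of a "2 * x - a"] a b by (auto simp: H1_def H2_def)
  qed
  have int: "H1 \<inter> H2 \<subseteq> {(a + Inf B) / 2 .. (Sup A + b) / 2}"
    using cSup_upper[OF _ bd(1)] cInf_lower[OF _ bd(2)] by (fastforce simp: H1_def H2_def)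
  have "emeasure lborel (H1 \<inter> H2) \<le> ennreal ((Sup A + b) / 2 - (a + Inf B) / 2)"
    using emeasure_mono[OF int, of lborel]
    by (cases "(a + Inf B) / 2 \<le> (Sup A + b) / 2") auto
  also have "\<dots> \<le> ennreal (e / 2)" using a b by (intro ennreal_leI) (simp add: field_simps)
  finally have i: "emeasure lborel (H1 \<inter> H2) \<le> ennreal (e / 2)" .
  have "emeasure lborel A + emeasure lborel B = 2 * (emeasure lborel H1 + emeasure lborel H2)"
    using emeasure_lborel_half_vimage[of A b] emeasure_lborel_half_vimage[of B a]
    by (simp add: H1_def H2_def distrib_left)
  also have "emeasure lborel H1 + emeasure lborel H2
      = emeasure lborel (H1 \<union> H2) + emeasure lborel (H1 \<inter> H2)"
    by (rule emeasure_Un_Int) auto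
  also have "\<dots> \<le> emeasure lborel H + ennreal (e / 2)"
    using i emeasure_mono[OF sub, of lborel] by (intro add_mono) auto
  finally have "emeasure lborel A + emeasure lborel B \<le> 2 * (emeasure lborel H + ennreal (e / 2))"
    by (simp add: mult_left_mono)
  also have "\<dots> = 2 * emeasure lborel H + ennreal e"
    using e ennreal_mult[of 2 "e / 2"] by (simp add: distrib_left)
  finally show "emeasure lborel A + emeasure lborel B \<le> 2 * emeasure lborel H + ennreal e" .
qed

text \<open>Exhaustion by the windows \<open>[- n, n]\<close>; from \<open>n0\<close> on both
  truncated sets are nonempty, as the bounded case demands.\<close>

lemma brunn_minkowski_midpoint:
  fixes A B H :: "real set"
  assumes [measurable]: "A \<in> sets borel" "B \<in> sets borel" "H \<in> sets borel"
    and ne: "A \<noteq> {}" "B \<noteq> {}"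
    and mid: "\<And>a b. a \<in> A \<Longrightarrow> b \<in> B \<Longrightarrow> (a + b) / 2 \<in> H"
  shows "emeasure lborel A + emeasure lborel B \<le> 2 * emeasure lborel H"
proof -
  obtain a b where ab: "a \<in> A" "b \<in> B" using ne by auto
  have lim: "(\<lambda>n. emeasure lborel (E \<inter> {- real n..real n})) \<longlonglongrightarrow> emeasure lborel E"
    if [measurable]: "E \<in> sets borel" for E :: "real set"
  proof -
    have "(\<Union>n. E \<inter> {- real n..real n}) = E"
    proof safe
      fix x assume "x \<in> E"
      then show "x \<in> (\<Union>n. E \<inter> {- real n..real n})"
        using real_arch_simple[of "\<bar>x\<bar>"] by (metis (no_types) IntI UN_I UNIV_I abs_le_D1 abs_le_D2 atLeastAtMost_iff minus_le_iff)
    qed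
    moreover have "incseq (\<lambda>n. E \<inter> {- real n..real n})" by (auto simp: incseq_def)
    ultimately show ?thesis
      using Lim_emeasure_incseq[of "\<lambda>n. E \<inter> {- real n..real n}" lborel]
      by (simp add: image_subset_iff)
  qed
  obtain n0 where n0: "max \<bar>a\<bar> \<bar>b\<bar> \<le> real n0" using real_arch_simple by blast
  show ?thesis
  proof (rule tendsto_upperbound)
    show "(\<lambda>n. emeasure lborel (A \<inter> {- real n..real n}) + emeasure lborel (B \<inter> {- real n..real n}))
        \<longlonglongrightarrow> emeasure lborel A + emeasure lborel B"
      by (intro tendsto_add lim) auto
    show "\<forall>\<^sub>F n in sequentially. emeasure lborel (A \<inter> {- real n..real n})
        + emeasure lborel (B \<inter> {- real n..real n}) \<le> 2 * emeasure lborel H"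
    proof (rule eventually_sequentiallyI[of n0])
      fix n assume "n0 \<le> n"
      then have "a \<in> {- real n..real n}" "b \<in> {- real n..real n}" using n0 by auto
      then show "emeasure lborel (A \<inter> {- real n..real n})
          + emeasure lborel (B \<inter> {- real n..real n}) \<le> 2 * emeasure lborel H"
        using ab mid by (intro brunn_minkowski_midpoint_bounded) auto
    qed
  qed auto
qed

lemma ennreal_mult_le_square_of_add_le:
  fixes u v w :: ennreal
  assumes "u + v \<le> 2 * w"
  shows "u * v \<le> w\<^sup>2"
proof (cases "w = \<top>")
  case False
  then have "u \<noteq> \<top>" "v \<noteq> \<top>"
    using assms by (auto simp: top_unique ennreal_mult_eq_top_iff)
  then obtain a b c where abc: "u = ennreal a" "v = ennreal b" "w = ennreal c" "a \<ge> 0" "b \<ge> 0" "c \<ge> 0"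
    using False by (metis ennreal_cases)
  have "ennreal (a + b) \<le> ennreal (2 * c)" using assms abc by (simp add: ennreal_mult')
  then have "a + b \<le> 2 * c" using abc by (subst (asm) ennreal_le_iff) auto
  then have "(a + b)\<^sup>2 \<le> (2 * c)\<^sup>2" using abc by (intro power_mono) auto
  moreover have "4 * (a * b) \<le> (a + b)\<^sup>2" using zero_le_power2[of "a - b"] by (simp add: power2_eq_square algebra_simps)
  ultimately have "a * b \<le> c\<^sup>2" by (simp add: power2_eq_square)
  then show ?thesis using abc by (simp add: ennreal_mult' [symmetric] ennreal_power ennreal_leI)
qed (simp add: power2_eq_square)

lemma nn_integral_level_unit:
  fixes u :: ennreal
  shows "(\<integral>\<^sup>+ t. indicator {0<..<1} t * indicator {t. ennreal t < u} t \<partial>lborel) = min u 1"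
proof (cases "u \<ge> 1")
  case True
  then have "(\<integral>\<^sup>+ t. indicator {0<..<1} t * indicator {t. ennreal t < u} t \<partial>lborel)
      = (\<integral>\<^sup>+ t. indicator {0<..<1::real} t \<partial>lborel)"
    by (intro nn_integral_cong) (auto simp: indicator_def ennreal_less_one_iff intro!: less_le_trans[OF _ True])
  with True show ?thesis by (simp add: min_def)
next
  case False
  then obtain r where r: "u = ennreal r" "0 \<le> r" "r < 1"
    by (cases u) (auto simp: not_le)
  have "(\<integral>\<^sup>+ t. indicator {0<..<1} t * indicator {t. ennreal t < u} t \<partial>lborel)
      = (\<integral>\<^sup>+ t. indicator {0<..<r} t \<partial>lborel)"
    using r by (intro nn_integral_cong) (auto simp: indicator_def ennreal_less_iff)
  with r show ?thesis by (simp add: min_def)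
qed

text \<open>Levels stop at 1. Functions with supremum 1 lose nothing by the cut-off, and of
  \<open>h\<close> only the part below 1 enters the comparison.\<close>

lemma nn_integral_min_one_layer_cake:
  fixes f :: "real \<Rightarrow> ennreal"
  assumes [measurable]: "f \<in> borel_measurable lborel"
  shows "(\<integral>\<^sup>+ x. min (f x) 1 \<partial>lborel)
    = (\<integral>\<^sup>+ t. indicator {0<..<1} t * emeasure lborel {x. ennreal t < f x} \<partial>lborel)"
proof -
  have "(\<integral>\<^sup>+ x. min (f x) 1 \<partial>lborel)
      = (\<integral>\<^sup>+ x. (\<integral>\<^sup>+ t. indicator {0<..<1} t * indicator {t. ennreal t < f x} t \<partial>lborel) \<partial>lborel)"
    by (simp add: nn_integral_level_unit)
  also have "\<dots> = (\<integral>\<^sup>+ x. (\<integral>\<^sup>+ t. indicator {0<..<1} t * indicator {p. ennreal (snd p) < f (fst p)} (x, t) \<partial>lborel) \<partial>lborel)"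
    by (intro nn_integral_cong) (auto simp: indicator_def)
  also have "\<dots> = (\<integral>\<^sup>+ t. (\<integral>\<^sup>+ x. indicator {0<..<1} t * indicator {p. ennreal (snd p) < f (fst p)} (x, t) \<partial>lborel) \<partial>lborel)"
    by (rule pair_sigma_finite.Fubini'[symmetric]) (unfold_locales, measurable)
  also have "\<dots> = (\<integral>\<^sup>+ t. indicator {0<..<1} t * (\<integral>\<^sup>+ x. indicator {x. ennreal t < f x} x \<partial>lborel) \<partial>lborel)"
    by (intro nn_integral_cong) (simp add: indicator_def)
  also have "\<dots> = (\<integral>\<^sup>+ t. indicator {0<..<1} t * emeasure lborel {x. ennreal t < f x} \<partial>lborel)"
    by (intro nn_integral_cong arg_cong2[where f="(*)"] refl nn_integral_indicator) measurable
  finally show ?thesis .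
qed

text \<open>Midpoints of points where \<open>f\<close> and \<open>g\<close> exceed \<open>t\<close>
  are points where \<open>h\<close> exceeds \<open>t\<close>, so Brunn--Minkowski applies level by
  level. The common supremum 1 makes both superlevel sets nonempty for every \<open>t\<close> below
  1.\<close>

lemma prekopa_leindler_real_normalized:
  fixes f g h :: "real \<Rightarrow> ennreal"
  assumes [measurable]: "f \<in> borel_measurable lborel" "g \<in> borel_measurable lborel" "h \<in> borel_measurable lborel"
    and sup: "(SUP x. f x) = 1" "(SUP x. g x) = 1"
    and mid: "\<And>x y. f x * g y \<le> (h ((x + y) / 2))\<^sup>2"
  shows "(integral\<^sup>N lborel f) + (integral\<^sup>N lborel g) \<le> 2 * (integral\<^sup>N lborel h)"
proof -
  have le1: "f x \<le> 1" "g x \<le> 1" for x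
    using SUP_upper[of x UNIV f] SUP_upper[of x UNIV g] sup by auto
  have bm: "emeasure lborel {x. ennreal t < f x} + emeasure lborel {x. ennreal t < g x}
      \<le> 2 * emeasure lborel {x. ennreal t < h x}" if t: "t \<in> {0<..<1}" for t
  proof (rule brunn_minkowski_midpoint)
    have "ennreal t < 1" using t by (simp add: ennreal_less_one_iff)
    then show "{x. ennreal t < f x} \<noteq> {}" "{x. ennreal t < g x} \<noteq> {}"
      using sup less_SUP_iff[of "ennreal t" f UNIV] less_SUP_iff[of "ennreal t" g UNIV] by auto
    fix a b assume "a \<in> {x. ennreal t < f x}" "b \<in> {x. ennreal t < g x}"
    moreover
    obtain p q where pq: "f a = ennreal p" "g b = ennreal q" "0 \<le> p" "0 \<le> q"
      by (metis le1 ennreal_cases ennreal_one_neq_top top_unique)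
    ultimately have "t * t < p * q" using t
      by (intro mult_strict_mono) (auto simp: ennreal_less_iff)
    then have "ennreal t * ennreal t < f a * g b" using t pq
      by (simp add: ennreal_mult'[symmetric] ennreal_less_iff)
    also have "\<dots> \<le> (h ((a + b) / 2))\<^sup>2" by (rule mid)
    finally show "(a + b) / 2 \<in> {x. ennreal t < h x}"
      by (auto simp: power2_eq_square not_le[symmetric] intro: mult_mono)
  qed measurable
  have "(integral\<^sup>N lborel f) + (integral\<^sup>N lborel g)
      = (\<integral>\<^sup>+ x. min (f x) 1 \<partial>lborel) + (\<integral>\<^sup>+ x. min (g x) 1 \<partial>lborel)"
    using le1 by (simp add: min_absorb1)
  also have "\<dots> = (\<integral>\<^sup>+ t. indicator {0<..<1} t * emeasure lborel {x. ennreal t < f x}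
        + indicator {0<..<1} t * emeasure lborel {x. ennreal t < g x} \<partial>lborel)"
    by (subst nn_integral_add) (auto simp: nn_integral_min_one_layer_cake)
  also have "\<dots> \<le> (\<integral>\<^sup>+ t. 2 * (indicator {0<..<1} t * emeasure lborel {x. ennreal t < h x}) \<partial>lborel)"
    using bm by (intro nn_integral_mono) (auto simp: indicator_def)
  also have "\<dots> = 2 * (\<integral>\<^sup>+ x. min (h x) 1 \<partial>lborel)"
    by (subst nn_integral_cmult) (auto simp: nn_integral_min_one_layer_cake)
  also have "\<dots> \<le> 2 * (integral\<^sup>N lborel h)"
    by (intro mult_left_mono nn_integral_mono) auto
  finally show ?thesis .
qed

text \<open>Dividing \<open>f\<close> and \<open>g\<close> by their suprema \<open>a\<close> and
  \<open>b\<close>, and \<open>h\<close> by \<open>sqrt (a * b)\<close>, preserves the midpoint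
  hypothesis. AM--GM then turns the additive bound into the product form, in which the scaling
  factors cancel. A zero supremum cannot be normalized and is treated separately.\<close>

lemma prekopa_leindler_real_bounded:
  fixes f g h :: "real \<Rightarrow> ennreal"
  assumes [measurable]: "f \<in> borel_measurable lborel" "g \<in> borel_measurable lborel" "h \<in> borel_measurable lborel"
    and bd: "(SUP x. f x) < \<top>" "(SUP x. g x) < \<top>"
    and mid: "\<And>x y. f x * g y \<le> (h ((x + y) / 2))\<^sup>2"
  shows "(integral\<^sup>N lborel f) * (integral\<^sup>N lborel g) \<le> (integral\<^sup>N lborel h)\<^sup>2"
proof (cases "(SUP x. f x) = 0 \<or> (SUP x. g x) = 0")
  case True
  then have "(\<forall>x. f x = 0) \<or> (\<forall>x. g x = 0)"
    by (auto simp: SUP_eq_iff bot_ennreal[symmetric] SUP_bot_conv)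
  then have "f = (\<lambda>_. 0) \<or> g = (\<lambda>_. 0)" by auto
  then show ?thesis by auto
next
  case False
  obtain a b where ab: "(SUP x. f x) = ennreal a" "a > 0" "(SUP x. g x) = ennreal b" "b > 0"
    using False bd by (cases "SUP x. f x"; cases "SUP x. g x") (auto simp: less_le)
  define r where "r = sqrt (a * b)"
  have r: "r > 0" "r * r = a * b" using ab by (auto simp: r_def)
  have ia: "ennreal (1 / a) * ennreal (1 / b) = (ennreal (1 / r))\<^sup>2"
    using ab r by (simp add: power2_eq_square ennreal_mult'[symmetric])
  have "(\<integral>\<^sup>+ x. ennreal (1/a) * f x \<partial>lborel) + (\<integral>\<^sup>+ x. ennreal (1/b) * g x \<partial>lborel)
      \<le> 2 * (\<integral>\<^sup>+ x. ennreal (1/r) * h x \<partial>lborel)"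
  proof (rule prekopa_leindler_real_normalized)
    have "(SUP x. ennreal (1/a) * f x) = ennreal (1/a) * ennreal a"
      by (simp add: SUP_mult_left_ennreal[symmetric] ab(1))
    then show "(SUP x. ennreal (1/a) * f x) = 1" using ab by (simp add: ennreal_mult'[symmetric])
    have "(SUP x. ennreal (1/b) * g x) = ennreal (1/b) * ennreal b"
      by (simp add: SUP_mult_left_ennreal[symmetric] ab(3))
    then show "(SUP x. ennreal (1/b) * g x) = 1" using ab by (simp add: ennreal_mult'[symmetric])
    fix x y
    have "ennreal (1/a) * f x * (ennreal (1/b) * g y) = (ennreal (1 / r))\<^sup>2 * (f x * g y)"
      unfolding ia[symmetric] by (simp add: mult_ac)
    also have "\<dots> \<le> (ennreal (1 / r))\<^sup>2 * (h ((x + y) / 2))\<^sup>2" by (intro mult_left_mono mid) auto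
    finally show "ennreal (1/a) * f x * (ennreal (1/b) * g y) \<le> (ennreal (1/r) * h ((x + y) / 2))\<^sup>2"
      by (simp add: power_mult_distrib)
  qed measurable
  then have "ennreal (1/a) * (integral\<^sup>N lborel f) + ennreal (1/b) * (integral\<^sup>N lborel g)
      \<le> 2 * (ennreal (1/r) * (integral\<^sup>N lborel h))"
    by (simp add: nn_integral_cmult)
  from ennreal_mult_le_square_of_add_le[OF this]
  have "(ennreal (1 / r))\<^sup>2 * ((integral\<^sup>N lborel f) * (integral\<^sup>N lborel g))
      \<le> (ennreal (1 / r))\<^sup>2 * (integral\<^sup>N lborel h)\<^sup>2"
    unfolding ia[symmetric] by (simp add: power_mult_distrib ia mult_ac)
  then show ?thesis
    using r by (subst (asm) ennreal_mult_le_mult_iff) (auto simp: ennreal_power)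
qed

text \<open>Truncation at heights \<open>n\<close> and \<open>m\<close> preserves the hypothesis and
  makes the suprema finite; the bound is independent of both heights, so monotone convergence
  concludes.\<close>

lemma prekopa_leindler_real:
  fixes f g h :: "real \<Rightarrow> ennreal"
  assumes [measurable]: "f \<in> borel_measurable lborel" "g \<in> borel_measurable lborel" "h \<in> borel_measurable lborel"
    and mid: "\<And>x y. f x * g y \<le> (h ((x + y) / 2))\<^sup>2"
  shows "(integral\<^sup>N lborel f) * (integral\<^sup>N lborel g) \<le> (integral\<^sup>N lborel h)\<^sup>2"
proof -
  have supmin: "(SUP n. min u (of_nat n)) = u" for u :: ennreal
  proof -
    have "(SUP n. inf u (of_nat n)) = inf u (SUP n. of_nat n)" by (rule inf_SUP[symmetric])
    then show ?thesis by (simp add: inf_min ennreal_SUP_of_nat_eq_top)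
  qed
  have lim: "(integral\<^sup>N lborel k) = (SUP n. \<integral>\<^sup>+ x. min (k x) (of_nat n) \<partial>lborel)"
    if [measurable]: "k \<in> borel_measurable lborel" for k :: "real \<Rightarrow> ennreal"
  proof -
    have "(integral\<^sup>N lborel k) = (\<integral>\<^sup>+ x. (SUP n. min (k x) (of_nat n)) \<partial>lborel)" by (simp add: supmin)
    also have "\<dots> = (SUP n. \<integral>\<^sup>+ x. min (k x) (of_nat n) \<partial>lborel)"
      by (rule nn_integral_monotone_convergence_SUP)
        (auto simp: incseq_def le_fun_def min.coboundedI2)
    finally show ?thesis .
  qed
  have fin: "(SUP x. min (k x) (of_nat n)) < \<top>" for k :: "real \<Rightarrow> ennreal" and n
    by (rule le_less_trans[of _ "of_nat n"]) (auto intro: SUP_least simp: of_nat_less_top)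
  have "(\<integral>\<^sup>+ x. min (f x) (of_nat n) \<partial>lborel) * (\<integral>\<^sup>+ x. min (g x) (of_nat m) \<partial>lborel)
      \<le> (integral\<^sup>N lborel h)\<^sup>2" for n m
  proof (rule prekopa_leindler_real_bounded)
    fix x y
    have "min (f x) (of_nat n) * min (g y) (of_nat m) \<le> f x * g y" by (intro mult_mono) auto
    then show "min (f x) (of_nat n) * min (g y) (of_nat m) \<le> (h ((x + y) / 2))\<^sup>2"
      using mid order_trans by blast
  qed (auto simp: fin)
  then show ?thesis
    unfolding lim[of f, OF assms(1)] lim[of g, OF assms(2)] SUP_mult_left_ennreal SUP_mult_right_ennreal
    by (intro SUP_least) auto
qed

text \<open>Tensorisation: integrating out all coordinates but one leaves three functions of a real
  variable, and the induction hypothesis is exactly the midpoint hypothesis for these.\<close>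

theorem prekopa_leindler_midpoint:
  fixes f g h :: "('i \<Rightarrow> real) \<Rightarrow> ennreal"
  assumes "finite I"
    and "f \<in> borel_measurable (PiM I (\<lambda>_. lborel))" "g \<in> borel_measurable (PiM I (\<lambda>_. lborel))"
      "h \<in> borel_measurable (PiM I (\<lambda>_. lborel))"
    and "\<And>x y. x \<in> extensional I \<Longrightarrow> y \<in> extensional I \<Longrightarrow> f x * g y \<le> (h (\<lambda>i\<in>I. (x i + y i) / 2))\<^sup>2"
  shows "(integral\<^sup>N (PiM I (\<lambda>_. lborel)) f) * (integral\<^sup>N (PiM I (\<lambda>_. lborel)) g)
    \<le> (integral\<^sup>N (PiM I (\<lambda>_. lborel)) h)\<^sup>2"
  using assms
proof (induction I arbitrary: f g h rule: finite_induct)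
  case empty
  have "f (\<lambda>_. undefined) * g (\<lambda>_. undefined) \<le> (h (\<lambda>_. undefined))\<^sup>2"
    using empty.prems(4)[of "\<lambda>_. undefined" "\<lambda>_. undefined"] by (simp add: extensional_def restrict_def)
  then show ?case by (simp add: product_sigma_finite.nn_integral_empty[OF product_sigma_finite.intro] sigma_finite_lborel)
next
  case (insert i I)
  interpret product_sigma_finite "\<lambda>_::'i. lborel :: real measure" ..
  interpret I: finite_product_sigma_finite "\<lambda>_::'i. lborel :: real measure" I
    by standard (rule insert.hyps)
  note [measurable] = insert.prems(1-3)
  note rev = product_nn_integral_insert_rev[OF insert.hyps]
  have "(\<integral>\<^sup>+ y. (\<integral>\<^sup>+ x. f (x(i := y)) \<partial>PiM I (\<lambda>_. lborel)) \<partial>lborel)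
      * (\<integral>\<^sup>+ y. (\<integral>\<^sup>+ x. g (x(i := y)) \<partial>PiM I (\<lambda>_. lborel)) \<partial>lborel)
      \<le> (\<integral>\<^sup>+ y. (\<integral>\<^sup>+ x. h (x(i := y)) \<partial>PiM I (\<lambda>_. lborel)) \<partial>lborel)\<^sup>2"
  proof (rule prekopa_leindler_real)
    fix y1 y2
    show "(\<integral>\<^sup>+ x. f (x(i := y1)) \<partial>PiM I (\<lambda>_. lborel)) * (\<integral>\<^sup>+ x. g (x(i := y2)) \<partial>PiM I (\<lambda>_. lborel))
        \<le> (\<integral>\<^sup>+ x. h (x(i := (y1 + y2) / 2)) \<partial>PiM I (\<lambda>_. lborel))\<^sup>2"
    proof (rule insert.IH)
      fix x y :: "'i \<Rightarrow> real" assume xy: "x \<in> extensional I" "y \<in> extensional I"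
      have e: "(\<lambda>j\<in>insert i I. ((x(i := y1)) j + (y(i := y2)) j) / 2)
          = (\<lambda>j\<in>I. (x j + y j) / 2)(i := (y1 + y2) / 2)"
        using insert.hyps by (auto simp: fun_eq_iff)
      have "x(i := y1) \<in> extensional (insert i I)" "y(i := y2) \<in> extensional (insert i I)"
        using xy by (auto simp: extensional_def)
      from insert.prems(4)[OF this, unfolded e]
      show "f (x(i := y1)) * g (y(i := y2)) \<le> (h ((\<lambda>j\<in>I. (x j + y j) / 2)(i := (y1 + y2) / 2)))\<^sup>2" .
    qed measurable
  qed measurable
  then show ?case by (simp add: rev)
qed

section \<open>Convexity and convergence of the interaction\<close>

text \<open>The subtracted parabola carries the least second derivative of
  \<open>t powr (- s)\<close> on the interval, the one at \<open>b\<close>. As the remainder is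
  convex, the midpoint defect of the power is at least that of the parabola.\<close>

lemma powr_neg_second_derivative_convex:
  fixes s b :: real
  assumes s: "0 < s"
  shows "convex_on {0<..b} (\<lambda>t. t powr (- s) - s * (s + 1) * b powr (- s - 2) * t\<^sup>2 / 2)"
proof (rule f''_ge0_imp_convex)
  let ?c = "s * (s + 1) * b powr (- s - 2)"
  show "((\<lambda>t. t powr (- s) - ?c * t\<^sup>2 / 2) has_real_derivative (- s * t powr (- s - 1) - ?c * t)) (at t)"
    if "t \<in> {0<..b}" for t
    using that by (auto intro!: derivative_eq_intros)
  show "((\<lambda>t. - s * t powr (- s - 1) - ?c * t) has_real_derivative (s * (s + 1) * t powr (- s - 2) - ?c)) (at t)"
    if "t \<in> {0<..b}" for t
    using that by (auto intro!: derivative_eq_intros simp: algebra_simps)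
  show "0 \<le> s * (s + 1) * t powr (- s - 2) - ?c" if "t \<in> {0<..b}" for t
  proof -
    have "b powr (- s - 2) \<le> t powr (- s - 2)" using that s by (intro powr_mono2') auto
    then show ?thesis using s by (simp add: mult_left_mono)
  qed
qed auto

lemma convex_on_midpoint:
  fixes f :: "real \<Rightarrow> real"
  assumes "convex_on A f" "x \<in> A" "y \<in> A"
  shows "2 * f ((x + y) / 2) \<le> f x + f y"
  using convex_onD[OF assms(1), of "1/2" x y] assms(2,3) by (simp add: field_simps)

text \<open>With \<open>b = max x y\<close> the parabola has midpoint defect exactly
  \<open>c * (x - y)\<^sup>2 / 4\<close>. The curvature at the longer of the two lengths is the one
  that survives, which is why a maximum appears in all later bounds.\<close>

lemma powr_neg_midpoint_gap:
  fixes s x y :: real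
  assumes s: "0 < s" and "0 < x" "0 < y"
  shows "s * (s + 1) / 4 * (x - y)\<^sup>2 / max x y powr (s + 2)
    \<le> x powr (- s) + y powr (- s) - 2 * ((x + y) / 2) powr (- s)"
proof -
  define m where "m = max x y"
  define p where "p = (x + y) / 2"
  define d where "d = (x - y)\<^sup>2"
  define c where "c = s * (s + 1) * m powr (- s - 2)"
  have "m powr (- s - 2) = 1 / m powr (s + 2)"
    using powr_minus_divide[of m "s + 2"] by (simp add: algebra_simps)
  then have e: "s * (s + 1) / 4 * d / m powr (s + 2) = c * d / 4"
    by (simp add: c_def)
   have "c * x\<^sup>2 / 2 + c * y\<^sup>2 / 2 - 2 * (c * p\<^sup>2 / 2) = c * d / 4"
    by (simp add: p_def d_def power2_eq_square field_simps)
  moreover have "2 * (p powr (- s) - c * p\<^sup>2 / 2)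
      \<le> (x powr (- s) - c * x\<^sup>2 / 2) + (y powr (- s) - c * y\<^sup>2 / 2)"
    unfolding c_def p_def using assms
    by (intro convex_on_midpoint[OF powr_neg_second_derivative_convex[OF s, of m]]) (auto simp: m_def)
  ultimately have "c * d / 4 \<le> x powr (- s) + y powr (- s) - 2 * p powr (- s)"
    by (simp add: field_simps)
  then show ?thesis unfolding m_def[symmetric] p_def[symmetric] d_def[symmetric] e .
qed

lemma powr_neg_midpoint_convex:
  fixes s x y :: real
  assumes s: "0 < s" and "0 < x" "0 < y"
  shows "2 * ((x + y) / 2) powr (- s) \<le> x powr (- s) + y powr (- s)"
  using powr_neg_midpoint_gap[OF assms] s zero_le_power2[of "x - y"]
  by (smt (verit) divide_nonneg_nonneg mult_nonneg_nonneg powr_ge_zero)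

lemma powr_shift_diff_tendsto_0:
  fixes s x :: real
  assumes "0 < s" "s < 1" "0 < x"
  shows "(\<lambda>n. (real n + x) powr (1 - s) - real n powr (1 - s)) \<longlonglongrightarrow> 0"
  using assms by real_asymp

text \<open>Comparison of a decreasing sum with its integral, followed by replacing
  \<open>(n + x) powr (1 - s)\<close> by \<open>n powr (1 - s)\<close>; the difference vanishes in
  the limit because \<open>1 - s\<close> is below 1.\<close>

lemma hurwitz_partial_sums_convergent:
  fixes s x :: real
  assumes s: "0 < s" "s < 1" and x: "0 < x"
  shows "convergent (\<lambda>n. (\<Sum>k\<le>n. (real k + x) powr (- s)) - 1 / (1 - s) * real n powr (1 - s))"
proof -
  interpret antimono_fun_sum_integral_diff "\<lambda>t. (t + x) powr (- s)"
    using s x by unfold_locales (auto intro!: powr_mono2' continuous_intros)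
  have int: "integral {0..real n} (\<lambda>t. (t + x) powr (- s)) = ((real n + x) powr (1 - s) - x powr (1 - s)) / (1 - s)" for n
  proof -
    have "((\<lambda>t. (t + x) powr (- s)) has_integral ((real n + x) powr (1 - s) / (1 - s) - (0 + x) powr (1 - s) / (1 - s))) {0..real n}"
    proof (rule fundamental_theorem_of_calculus)
      fix t assume "t \<in> {0..real n}"
      then show "((\<lambda>t. (t + x) powr (1 - s) / (1 - s)) has_vector_derivative (t + x) powr (- s)) (at t within {0..real n})"
        using s x by (auto intro!: derivative_eq_intros simp: has_real_derivative_iff_has_vector_derivative[symmetric])
    qed simp
    then show ?thesis by (simp add: integral_unique diff_divide_distrib)
  qed
  have "convergent (\<lambda>n. sum_integral_diff_series n + (1 / (1 - s) * ((real n + x) powr (1 - s) - real n powr (1 - s)) - x powr (1 - s) / (1 - s)))"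
    by (intro convergent_add sum_integral_diff_series_convergent convergent_diff convergent_mult
        convergent_const convergentI[OF powr_shift_diff_tendsto_0[OF s x]])
  then show ?thesis
    by (rule back_subst[where P=convergent])
      (auto simp: sum_integral_diff_series_def int fun_eq_iff diff_divide_distrib algebra_simps)
qed

definition riesz_partial :: "real \<Rightarrow> real \<Rightarrow> nat \<Rightarrow> real" where
  "riesz_partial s x n = (\<Sum>k\<in>{- int n..int n}. \<bar>real_of_int k + x\<bar> powr (- s)) - 2 / (1 - s) * real n powr (1 - s)"

text \<open>The symmetric sum has one more term on the nonnegative side, with shift
  \<open>x\<close>, than on the negative side, with shift \<open>1 - x\<close>. At
  \<open>Suc n\<close> both one-sided sums include their last index, and the mismatch is a
  difference of powers that tends to 0.\<close>

lemma riesz_partial_Suc: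
  fixes s x :: real
  assumes x: "0 < x" "x < 1"
  shows "riesz_partial s x (Suc n) = ((\<Sum>k\<le>Suc n. (real k + x) powr (- s)) - 1 / (1 - s) * real (Suc n) powr (1 - s))
    + ((\<Sum>k\<le>n. (real k + (1 - x)) powr (- s)) - 1 / (1 - s) * real n powr (1 - s))
    - 1 / (1 - s) * (real (Suc n) powr (1 - s) - real n powr (1 - s))"
proof -
  have "(\<Sum>k\<in>{- int m..int m}. \<bar>real_of_int k + x\<bar> powr (- s))
    = (\<Sum>k\<le>m. (real k + x) powr (- s)) + (\<Sum>k<m. (real k + (1 - x)) powr (- s))" for m
  proof (induction m)
    case 0
    show ?case using x by simp
  next
    case (Suc m)
    have "{- int (Suc m)..int (Suc m)} = insert (int (Suc m)) (insert (- int (Suc m)) {- int m..int m})"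
      by auto
    moreover have "\<bar>real_of_int (- int (Suc m)) + x\<bar> = real m + (1 - x)" using x by simp
    ultimately show ?case using Suc x by (simp add: algebra_simps)
  qed
  then show ?thesis
    by (simp only: riesz_partial_def lessThan_Suc_atMost) (simp add: algebra_simps diff_divide_distrib add_divide_distrib)
qed

text \<open>\<open>riesz_g\<close> is defined by \<open>lim\<close>, which carries no information
  about a divergent sequence, so convergence has to be known before inequalities can pass to the
  limit.\<close>

lemma riesz_partial_tendsto:
  fixes s x :: real
  assumes s: "0 < s" "s < 1" and x: "0 < x" "x < 1"
  shows "riesz_partial s x \<longlonglongrightarrow> riesz_g s x"
proof -
  have "(\<lambda>n. real (Suc n) powr (1 - s) - real n powr (1 - s)) \<longlonglongrightarrow> 0"
    using powr_shift_diff_tendsto_0[OF s, of 1] by (simp add: add_ac)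
  then have c: "convergent (\<lambda>n. 1 / (1 - s) * (real (Suc n) powr (1 - s) - real n powr (1 - s)))"
    by (intro convergent_mult convergent_const) (rule convergentI)
  have h1: "convergent (\<lambda>n. (\<Sum>k\<le>Suc n. (real k + x) powr (- s)) - 1 / (1 - s) * real (Suc n) powr (1 - s))"
    using hurwitz_partial_sums_convergent[OF s x(1)] by (subst convergent_Suc_iff)
  have h2: "convergent (\<lambda>n. (\<Sum>k\<le>n. (real k + (1 - x)) powr (- s)) - 1 / (1 - s) * real n powr (1 - s))"
    using hurwitz_partial_sums_convergent[OF s, of "1 - x"] x by simp
  have "convergent (\<lambda>n. riesz_partial s x (Suc n))"
    unfolding riesz_partial_Suc[OF x]
    by (rule convergent_diff[OF convergent_add[OF h1 h2] c])
  then have "convergent (riesz_partial s x)" by (simp only: convergent_Suc_iff)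
  then have "riesz_partial s x \<longlonglongrightarrow> lim (riesz_partial s x)" by (simp add: convergent_LIMSEQ_iff)
  moreover have "lim (riesz_partial s x) = riesz_g s x"
    by (simp add: riesz_g_def riesz_partial_def[abs_def])
  ultimately show ?thesis by simp
qed

lemma riesz_g_midpoint_gap:
  fixes s x y :: real
  assumes s: "0 < s" "s < 1" and x: "0 < x" "x < 1" and y: "0 < y" "y < 1"
  shows "s * (s + 1) / 4 * (x - y)\<^sup>2 / max x y powr (s + 2)
    \<le> riesz_g s x + riesz_g s y - 2 * riesz_g s ((x + y) / 2)"
proof (rule tendsto_lowerbound)
  have m: "0 < (x + y) / 2" "(x + y) / 2 < 1" using x y by auto
  show "(\<lambda>n. riesz_partial s x n + riesz_partial s y n - 2 * riesz_partial s ((x + y) / 2) n)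
      \<longlonglongrightarrow> riesz_g s x + riesz_g s y - 2 * riesz_g s ((x + y) / 2)"
    by (intro tendsto_intros riesz_partial_tendsto s x y m)
  show "\<forall>\<^sub>F n in sequentially. s * (s + 1) / 4 * (x - y)\<^sup>2 / max x y powr (s + 2)
      \<le> riesz_partial s x n + riesz_partial s y n - 2 * riesz_partial s ((x + y) / 2) n"
  proof (rule always_eventually, rule allI)
    fix n
    \<comment> \<open>The centring terms cancel in the combination 1 + 1 - 2, and only second
      differences of the summands remain. The term \<open>k = 0\<close> carries the quantitative
      gap; all others are nonnegative.\<close>
    let ?t = "\<lambda>k. \<bar>real_of_int k + x\<bar> powr (- s) + \<bar>real_of_int k + y\<bar> powr (- s)
        - 2 * \<bar>real_of_int k + (x + y) / 2\<bar> powr (- s)"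
    have nonneg: "0 \<le> ?t k" for k
    proof (cases "k \<ge> 0")
      case True
      have e: "(real_of_int k + x + (real_of_int k + y)) / 2 = real_of_int k + (x + y) / 2" by simp
      from True show ?thesis
        using powr_neg_midpoint_convex[OF s(1), of "real_of_int k + x" "real_of_int k + y", unfolded e] x y m
        by simp
    next
      case False
      then have "real_of_int k \<le> -1" by linarith
      then have a: "0 < - real_of_int k - x" "0 < - real_of_int k - y" "0 < - real_of_int k - (x + y) / 2"
        using x y m by auto
      have e: "(- real_of_int k - x + (- real_of_int k - y)) / 2 = - real_of_int k - (x + y) / 2"
        by (simp add: field_simps)
      have "\<bar>real_of_int k + x\<bar> = - real_of_int k - x" "\<bar>real_of_int k + y\<bar> = - real_of_int k - y"
        "\<bar>real_of_int k + (x + y) / 2\<bar> = - real_of_int k - (x + y) / 2" using a by linarith+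
      then show ?thesis using powr_neg_midpoint_convex[OF s(1) a(1,2), unfolded e] by simp
    qed
    have "s * (s + 1) / 4 * (x - y)\<^sup>2 / max x y powr (s + 2) \<le> ?t 0"
      using powr_neg_midpoint_gap[OF s(1) x(1) y(1)] x y m by simp
    also have "?t 0 \<le> (\<Sum>k\<in>{- int n..int n}. ?t k)"
      by (rule member_le_sum) (use nonneg in auto)
    also have "\<dots> = riesz_partial s x n + riesz_partial s y n - 2 * riesz_partial s ((x + y) / 2) n"
      by (simp add: riesz_partial_def sum.distrib sum_subtractf sum_distrib_left algebra_simps)
    finally show "s * (s + 1) / 4 * (x - y)\<^sup>2 / max x y powr (s + 2)
      \<le> riesz_partial s x n + riesz_partial s y n - 2 * riesz_partial s ((x + y) / 2) n" .
  qed
qed simp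

text \<open>The two ordered terms of a pair of points see complementary arcs; their sum is the
  interaction of the unordered pair.\<close>

definition riesz_pair :: "real \<Rightarrow> real \<Rightarrow> real" where
  "riesz_pair s x = riesz_g s x + riesz_g s (1 - x)"

lemma riesz_pair_midpoint_gap:
  fixes s x y :: real
  assumes s: "0 < s" "s < 1" and x: "0 < x" "x < 1" and y: "0 < y" "y < 1"
  shows "s * (s + 1) / 4 * (x - y)\<^sup>2 / max x y powr (s + 2)
    \<le> riesz_pair s x + riesz_pair s y - 2 * riesz_pair s ((x + y) / 2)"
proof -
  have "0 \<le> s * (s + 1) / 4 * (1 - x - (1 - y))\<^sup>2 / max (1 - x) (1 - y) powr (s + 2)"
    using s by simp
  also have "\<dots> \<le> riesz_g s (1 - x) + riesz_g s (1 - y) - 2 * riesz_g s ((1 - x + (1 - y)) / 2)"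
    using x y by (intro riesz_g_midpoint_gap s) auto
  also have "(1 - x + (1 - y)) / 2 = 1 - (x + y) / 2" by (simp add: field_simps)
  finally show ?thesis
    using riesz_g_midpoint_gap[OF s x y] by (simp add: riesz_pair_def)
qed

text \<open>Midpoint convexity of \<open>riesz_g\<close> at \<open>x\<close> and
  \<open>1 - x\<close>. It bounds the energy below, hence the Gibbs weight above.\<close>

lemma riesz_pair_lower_bound:
  fixes s x :: real
  assumes s: "0 < s" "s < 1" and x: "0 < x" "x < 1"
  shows "riesz_pair s (1 / 2) \<le> riesz_pair s x"
proof -
  have "0 \<le> s * (s + 1) / 4 * (x - (1 - x))\<^sup>2 / max x (1 - x) powr (s + 2)" using s by simp
  also have "\<dots> \<le> riesz_g s x + riesz_g s (1 - x) - 2 * riesz_g s ((x + (1 - x)) / 2)"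
    using x by (intro riesz_g_midpoint_gap s) auto
  finally show ?thesis by (simp add: riesz_pair_def)
qed

lemma riesz_g_measurable [measurable]: "riesz_g s \<in> borel_measurable borel"
  unfolding riesz_g_def by (intro borel_measurable_lim_metric) measurable

lemma frac_measurable [measurable]: "(frac :: real \<Rightarrow> real) \<in> borel_measurable borel"
  unfolding frac_def by measurable

lemma frac_frac_diff: "frac (frac a - frac b) = frac (a - b :: real)"
  by (metis diff_conv_add_uminus frac_diff)

lemma frac_frac_diff_left: "frac (frac a - b) = frac (a - b :: real)"
  by (metis frac_diff frac_frac)

lemma tdiff_measurable [measurable (raw)]:
  assumes [measurable]: "f \<in> borel_measurable M" "g \<in> borel_measurable M"
  shows "(\<lambda>x. tdiff (f x) (g x)) \<in> borel_measurable M"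
  unfolding tdiff_def by measurable

subsection \<open>The uniform measure on the circle\<close>

definition circle_measure :: "real measure" where
  "circle_measure = density lborel (indicator {0..<1})"

lemma sets_circle_measure [simp, measurable_cong]: "sets circle_measure = sets borel"
  by (simp add: circle_measure_def)

lemma space_circle_measure [simp]: "space circle_measure = UNIV"
  by (simp add: circle_measure_def)

lemma prob_space_circle_measure: "prob_space circle_measure"
  by (rule prob_spaceI) (simp add: circle_measure_def emeasure_density)

lemma AE_circle_measure: "AE t in circle_measure. t \<in> {0..<1}"
  unfolding circle_measure_def by (subst AE_density) (auto simp: indicator_def)

lemma nn_integral_circle_measure:
  assumes [measurable]: "f \<in> borel_measurable borel"
  shows "(\<integral>\<^sup>+ t. f t \<partial>circle_measure) = (\<integral>\<^sup>+ t. f t * indicator {0..<1} t \<partial>lborel)"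
  unfolding circle_measure_def by (subst nn_integral_density) (auto simp: mult.commute)

text \<open>With \<open>r = frac c\<close>, the rotation carries \<open>[0, 1 - r)\<close> onto
  \<open>[r, 1)\<close> and \<open>[1 - r, 1)\<close> onto \<open>[0, r)\<close>; on each piece it
  is a translation.\<close>

lemma nn_integral_circle_rotate:
  fixes f :: "real \<Rightarrow> ennreal"
  assumes [measurable]: "f \<in> borel_measurable borel"
  shows "(\<integral>\<^sup>+ t. f (frac (c + t)) \<partial>circle_measure) = (\<integral>\<^sup>+ t. f t \<partial>circle_measure)"
proof -
  define r where "r = frac c"
  have r: "0 \<le> r" "r < 1" by (auto simp: r_def frac_lt_1)
  have fr: "frac (c + t) = (if t < 1 - r then r + t else r - 1 + t)" if "t \<in> {0..<1}" for t
  proof -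
    have "frac t = t" using that by simp
    then show ?thesis by (auto simp: frac_add r_def[symmetric])
  qed
  have shift: "(\<integral>\<^sup>+ t. g t \<partial>lborel) = (\<integral>\<^sup>+ t. g (a + t) \<partial>lborel)"
    if [measurable]: "g \<in> borel_measurable borel" for g :: "real \<Rightarrow> ennreal" and a
    using nn_integral_real_affine[of g 1 a] that by simp
  have "(\<integral>\<^sup>+ t. f t \<partial>circle_measure)
      = (\<integral>\<^sup>+ t. f t * indicator {r..<1} t + f t * indicator {0..<r} t \<partial>lborel)"
    using r by (subst nn_integral_circle_measure) (auto intro!: nn_integral_cong simp: indicator_def)
  also have "\<dots> = (\<integral>\<^sup>+ t. f t * indicator {r..<1} t \<partial>lborel) + (\<integral>\<^sup>+ t. f t * indicator {0..<r} t \<partial>lborel)"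
    by (rule nn_integral_add) auto
  also have "(\<integral>\<^sup>+ t. f t * indicator {r..<1} t \<partial>lborel) = (\<integral>\<^sup>+ t. f (r + t) * indicator {r..<1} (r + t) \<partial>lborel)"
    by (rule shift) measurable
  also have "(\<integral>\<^sup>+ t. f t * indicator {0..<r} t \<partial>lborel) = (\<integral>\<^sup>+ t. f (r - 1 + t) * indicator {0..<r} (r - 1 + t) \<partial>lborel)"
    by (rule shift) measurable
  also have "(\<integral>\<^sup>+ t. f (r + t) * indicator {r..<1} (r + t) \<partial>lborel)
      + (\<integral>\<^sup>+ t. f (r - 1 + t) * indicator {0..<r} (r - 1 + t) \<partial>lborel)
      = (\<integral>\<^sup>+ t. f (r + t) * indicator {r..<1} (r + t) + f (r - 1 + t) * indicator {0..<r} (r - 1 + t) \<partial>lborel)"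
    by (rule nn_integral_add[symmetric]) auto
  also have "\<dots> = (\<integral>\<^sup>+ t. f (frac (c + t)) * indicator {0..<1} t \<partial>lborel)"
    using r by (intro nn_integral_cong) (auto simp: indicator_def fr)
  also have "\<dots> = (\<integral>\<^sup>+ t. f (frac (c + t)) \<partial>circle_measure)"
    by (subst nn_integral_circle_measure) auto
  finally show ?thesis by simp
qed

lemma distr_circle_rotate:
  "distr circle_measure circle_measure (\<lambda>t. frac (c + t)) = circle_measure"
proof (rule measure_eqI)
  fix A assume "A \<in> sets (distr circle_measure circle_measure (\<lambda>t. frac (c + t)))"
  then have [measurable]: "A \<in> sets borel" by simp
  have "emeasure (distr circle_measure circle_measure (\<lambda>t. frac (c + t))) A
      = (\<integral>\<^sup>+ t. indicator A t \<partial>distr circle_measure circle_measure (\<lambda>t. frac (c + t)))" by simp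
  also have "\<dots> = (\<integral>\<^sup>+ t. indicator A (frac (c + t)) \<partial>circle_measure)"
    by (subst nn_integral_distr) auto
  also have "\<dots> = emeasure circle_measure A"
    by (subst nn_integral_circle_rotate) auto
  finally show "emeasure (distr circle_measure circle_measure (\<lambda>t. frac (c + t))) A = emeasure circle_measure A" .
qed simp

lemma product_prob_space_circle: "product_prob_space (\<lambda>_. circle_measure)"
  by (intro product_prob_spaceI prob_space_circle_measure)

lemma sets_PiM_circle [measurable_cong]: "sets (PiM I (\<lambda>_. circle_measure)) = sets (PiM I (\<lambda>_. borel))"
  by (rule sets_PiM_cong) auto

text \<open>Connects Lebesgue measure on the unit box, which underlies \<open>riesz_prob\<close>,
  with a product of probability measures, on which rotations and permutations of the coordinates
  act.\<close>

lemma PiM_circle_eq_density: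
  assumes fin: "finite I"
  shows "PiM I (\<lambda>_. circle_measure) = density (PiM I (\<lambda>_. lborel)) (indicator (PiE I (\<lambda>_. {0..<1})))"
proof -
  interpret L: product_sigma_finite "\<lambda>_. lborel :: real measure" ..
  interpret C: product_prob_space "\<lambda>_. circle_measure" by (rule product_prob_space_circle)
  have "density (PiM I (\<lambda>_. lborel)) (indicator (PiE I (\<lambda>_. {0..<1}))) = PiM I (\<lambda>_. circle_measure)"
  proof (rule C.PiM_eqI[OF fin])
    show "sets (density (PiM I (\<lambda>_. lborel)) (indicator (PiE I (\<lambda>_. {0..<1})))) = sets (PiM I (\<lambda>_. circle_measure))"
      by (simp cong: sets_PiM_cong)
    fix A :: "'a \<Rightarrow> real set" assume A: "\<And>i. i \<in> I \<Longrightarrow> A i \<in> sets circle_measure"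
    have box: "PiE I B \<in> sets (PiM I (\<lambda>_. lborel))" if "\<And>i. i \<in> I \<Longrightarrow> B i \<in> sets borel" for B :: "'a \<Rightarrow> real set"
      using that fin by (intro sets_PiM_I_finite) auto
    have "emeasure (density (PiM I (\<lambda>_. lborel)) (indicator (PiE I (\<lambda>_. {0..<1})))) (PiE I A)
        = (\<integral>\<^sup>+ x. indicator (PiE I (\<lambda>_. {0..<1})) x * indicator (PiE I A) x \<partial>PiM I (\<lambda>_. lborel))"
      using A by (intro emeasure_density) (auto intro!: box borel_measurable_indicator)
    also have "\<dots> = (\<integral>\<^sup>+ x. indicator (PiE I (\<lambda>i. A i \<inter> {0..<1})) x \<partial>PiM I (\<lambda>_. lborel))"
      by (intro nn_integral_cong) (auto simp: indicator_def PiE_iff)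
    also have "\<dots> = emeasure (PiM I (\<lambda>_. lborel)) (PiE I (\<lambda>i. A i \<inter> {0..<1}))"
      using A by (intro nn_integral_indicator box) auto
    also have "\<dots> = (\<Prod>i\<in>I. emeasure lborel (A i \<inter> {0..<1}))"
      using A fin by (intro L.emeasure_PiM) auto
    also have "\<dots> = (\<Prod>i\<in>I. emeasure circle_measure (A i))"
    proof (rule prod.cong[OF refl])
      fix i assume "i \<in> I"
      then have [measurable]: "A i \<in> sets borel" using A by simp
      show "emeasure lborel (A i \<inter> {0..<1}) = emeasure circle_measure (A i)"
        unfolding circle_measure_def
        by (subst emeasure_density) (auto simp: indicator_inter_arith[symmetric] Int_commute)
    qed
    finally show "emeasure (density (PiM I (\<lambda>_. lborel)) (indicator (PiE I (\<lambda>_. {0..<1})))) (PiE I A)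
        = (\<Prod>i\<in>I. emeasure circle_measure (A i))" .
  qed
  then show ?thesis by simp
qed

lemma nn_integral_PiM_circle:
  fixes f :: "('i \<Rightarrow> real) \<Rightarrow> ennreal"
  assumes fin: "finite I" and [measurable]: "f \<in> borel_measurable (PiM I (\<lambda>_. borel))"
  shows "(\<integral>\<^sup>+ x. f x \<partial>PiM I (\<lambda>_. circle_measure))
    = (\<integral>\<^sup>+ x. f x * indicator (PiE I (\<lambda>_. {0..<1})) x \<partial>PiM I (\<lambda>_. lborel))"
proof -
  have [measurable]: "PiE I (\<lambda>_. {0..<1::real}) \<in> sets (PiM I (\<lambda>_. lborel))"
    using fin by (intro sets_PiM_I_finite) auto
  have [measurable]: "f \<in> borel_measurable (PiM I (\<lambda>_. lborel))"
    using assms(2) by (simp cong: measurable_cong_sets sets_PiM_cong)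
  show ?thesis
    unfolding PiM_circle_eq_density[OF fin] by (subst nn_integral_density) (auto simp: mult.commute)
qed

lemma nn_integral_PiM_circle_rotate:
  fixes f :: "('i \<Rightarrow> real) \<Rightarrow> ennreal"
  assumes fin: "finite I" and [measurable]: "f \<in> borel_measurable (PiM I (\<lambda>_. borel))"
  shows "(\<integral>\<^sup>+ x. f x \<partial>PiM I (\<lambda>_. circle_measure))
    = (\<integral>\<^sup>+ x. f (\<lambda>i\<in>I. frac (c + x i)) \<partial>PiM I (\<lambda>_. circle_measure))"
proof -
  have "distr (PiM I (\<lambda>_. circle_measure)) (PiM I (\<lambda>_. circle_measure)) (compose I (\<lambda>t. frac (c + t)))
      = PiM I (\<lambda>_. circle_measure)"
    using distr_PiM_finite_prob_space'[OF fin, of "\<lambda>_. circle_measure" "\<lambda>_. circle_measure" "\<lambda>t. frac (c + t)"]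
    by (simp add: prob_space_circle_measure distr_circle_rotate)
  then have "(\<integral>\<^sup>+ x. f x \<partial>PiM I (\<lambda>_. circle_measure))
      = (\<integral>\<^sup>+ x. f x \<partial>distr (PiM I (\<lambda>_. circle_measure)) (PiM I (\<lambda>_. circle_measure)) (compose I (\<lambda>t. frac (c + t))))"
    by simp
  also have "\<dots> = (\<integral>\<^sup>+ x. f (\<lambda>i\<in>I. frac (c + x i)) \<partial>PiM I (\<lambda>_. circle_measure))"
    unfolding compose_def by (rule nn_integral_distr) measurable
  finally show ?thesis .
qed

subsection \<open>The gap coordinates\<close>

text \<open>The measurability rules below are stated for the index set \<open>{1..<N}\<close>, which the simplifier
  would otherwise turn into \<open>{Suc 0..<N}\<close>.\<close>

declare One_nat_def [simp del]

lemma sets_PiM_lborel [measurable_cong]: "sets (PiM I (\<lambda>_. lborel :: real measure)) = sets (PiM I (\<lambda>_. borel))"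
  by (rule sets_PiM_cong) auto

lemma sum_off_diagonal_pairs:
  fixes a :: "nat \<Rightarrow> nat \<Rightarrow> real"
  shows "(\<Sum>i<n. \<Sum>j<n. if i \<noteq> j then a i j else 0) = (\<Sum>j<n. \<Sum>i<j. a j i + a i j)"
proof (induction n)
  case (Suc n)
  have "(\<Sum>i<Suc n. \<Sum>j<Suc n. if i \<noteq> j then a i j else 0)
      = (\<Sum>i<n. (\<Sum>j<n. if i \<noteq> j then a i j else 0) + a i n) + (\<Sum>j<n. a n j)"
    by (simp add: sum.distrib)
  also have "\<dots> = (\<Sum>j<n. \<Sum>i<j. a j i + a i j) + (\<Sum>i<n. a n i + a i n)"
    by (simp add: sum.distrib Suc)
  finally show ?case by simp
qed simp

locale riesz_gas =
  fixes s \<beta> :: real and N :: nat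
  assumes s_pos: "0 < s" and s_less_1: "s < 1" and beta_pos: "0 < \<beta>" and N_ge_2: "2 \<le> N"
begin

abbreviation confs :: "(nat \<Rightarrow> real) measure" where "confs \<equiv> PiM {..<N} (\<lambda>_. borel)"
abbreviation gaps :: "(nat \<Rightarrow> real) measure" where "gaps \<equiv> PiM {1..<N} (\<lambda>_. borel)"
abbreviation gw :: "(nat \<Rightarrow> real) \<Rightarrow> real" where "gw \<equiv> gibbs_weight s \<beta> N"
abbreviation torus :: "(nat \<Rightarrow> real) measure" where "torus \<equiv> PiM {..<N} (\<lambda>_. circle_measure)"
abbreviation gap_vol :: "(nat \<Rightarrow> real) measure" where "gap_vol \<equiv> PiM {1..<N} (\<lambda>_. lborel)"

text \<open>The domain in gap coordinates, cut out by strict linear inequalities. It excludes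
  \<open>z 1 = 0\<close>, which \<open>D_set\<close> admits as coincidence of the first two points;
  the difference is a null set.\<close>

definition chamber :: "(nat \<Rightarrow> real) set" where
  "chamber = {z. 0 < z 1 \<and> (\<forall>j\<in>{1..<N - 1}. z j < z (j + 1)) \<and> z (N - 1) < 1}"

text \<open>Points of the gap space have no meaningful value at index 0; \<open>z(0 := 0)\<close>
  places the base point at the origin before the energy is taken.\<close>

definition weight :: "(nat \<Rightarrow> real) \<Rightarrow> real" where
  "weight z = indicator chamber z * exp (- \<beta> * riesz_H s N (z(0 := 0)))"

definition config :: "real \<Rightarrow> (nat \<Rightarrow> real) \<Rightarrow> nat \<Rightarrow> real" where
  "config c z = (\<lambda>j\<in>{..<N}. frac (c + (z(0 := 0)) j))"

lemma chamber_less: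
  assumes z: "z \<in> chamber" and ij: "i < j" "j < N"
  shows "(z(0 := 0)) i < (z(0 := 0)) j"
  using ij
proof (induction j)
  case (Suc j)
  have step: "(z(0 := 0)) j < (z(0 := 0)) (Suc j)"
  proof (cases "j = 0")
    case False
    then have "j \<in> {1..<N - 1}" using Suc.prems by auto
    then have "z j < z (j + 1)" using z unfolding chamber_def by blast
    then show ?thesis using False by (simp add: Suc_eq_plus1)
  qed (use z in \<open>simp add: chamber_def One_nat_def\<close>)
  show ?case
  proof (cases "i = j")
    case False
    then have "(z(0 := 0)) i < (z(0 := 0)) j" using Suc by auto
    with step show ?thesis by linarith
  qed (use step in simp)
qed simp

lemma chamber_le_last:
  assumes z: "z \<in> chamber" and "j < N"
  shows "(z(0 := 0)) j < 1"
proof -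
  have "j = N - 1 \<or> j < N - 1" using assms(2) by auto
  then have "(z(0 := 0)) j \<le> (z(0 := 0)) (N - 1)"
    using chamber_less[OF z, of j "N - 1"] N_ge_2 by (auto simp del: fun_upd_apply)
  moreover have "(z(0 := 0)) (N - 1) < 1" using z N_ge_2 by (auto simp: chamber_def)
  ultimately show ?thesis by linarith
qed

lemma chamber_nonneg:
  assumes z: "z \<in> chamber" and "j < N"
  shows "0 \<le> (z(0 := 0)) j"
  using chamber_less[OF z, of 0 j] assms(2) by (cases "j = 0") auto

lemma chamber_gap:
  assumes z: "z \<in> chamber" and "i < j" "j < N"
  shows "0 < (z(0 := 0)) j - (z(0 := 0)) i" "(z(0 := 0)) j - (z(0 := 0)) i < 1"
  using chamber_less[OF assms] chamber_le_last[OF z assms(3)] chamber_nonneg[OF z, of i] assms by auto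

lemma chamber_midpoint:
  assumes "x \<in> chamber" "y \<in> chamber"
  shows "(\<lambda>i\<in>{1..<N}. (x i + y i) / 2) \<in> chamber"
proof -
  have "(x j + y j) / 2 < (x (j + 1) + y (j + 1)) / 2" if "j \<in> {1..<N - 1}" for j
    using assms that by (intro divide_strict_right_mono add_strict_mono) (auto simp: chamber_def)
  moreover have "j \<in> {1..<N}" "j + 1 \<in> {1..<N}" if "j \<in> {1..<N - 1}" for j using that by auto
  moreover have "1 \<in> {1..<N}" "N - 1 \<in> {1..<N}" using N_ge_2 by auto
  moreover have "0 < x 1 + y 1" "x (N - 1) + y (N - 1) < 2" using assms by (auto simp: chamber_def)
  ultimately show ?thesis unfolding chamber_def by (auto simp: divide_strict_right_mono)
qed

lemma riesz_H_chamber: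
  assumes z: "z \<in> chamber"
  shows "riesz_H s N (z(0 := 0)) = real N powr (- s) *
    (\<Sum>j<N. \<Sum>i<j. riesz_pair s ((z(0 := 0)) j - (z(0 := 0)) i))"
proof -
  let ?y = "z(0 := 0)"
  have "riesz_g s (tdiff (?y j) (?y i)) + riesz_g s (tdiff (?y i) (?y j)) = riesz_pair s (?y j - ?y i)"
    if "i < j" "j < N" for i j
  proof -
    note g = chamber_gap[OF z that]
    have "tdiff (?y j) (?y i) = ?y j - ?y i" using g by (simp add: tdiff_def frac_eq)
    moreover have "tdiff (?y i) (?y j) = 1 - (?y j - ?y i)"
      using g by (simp add: tdiff_def frac_unique_iff)
    ultimately show ?thesis by (simp add: riesz_pair_def)
  qed
  then show ?thesis
    unfolding riesz_H_def sum_off_diagonal_pairs by (auto intro!: sum.cong)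
qed

lemma riesz_H_measurable [measurable]: "riesz_H s N \<in> borel_measurable confs"
  unfolding riesz_H_def by measurable

lemma upd_zero_measurable [measurable]: "(\<lambda>z. z(0 := 0)) \<in> measurable gaps confs"
proof (rule measurable_fun_upd)
  show "{..<N} = {1..<N} \<union> {0}" using N_ge_2 by auto
qed auto

lemma upd_component_measurable [measurable]:
  "j < N \<Longrightarrow> (\<lambda>z. (z(0 := 0)) j) \<in> borel_measurable gaps"
  by (rule measurable_compose[OF upd_zero_measurable measurable_component_singleton]) auto

lemma chamber_measurable [measurable]: "Measurable.pred gaps (\<lambda>z. z \<in> chamber)"
proof -
  have [measurable]: "j \<in> {1..<N} \<Longrightarrow> (\<lambda>z. z j) \<in> borel_measurable gaps" for j
    by (rule measurable_component_singleton)
  have c[measurable]: "(\<lambda>z. z 1) \<in> borel_measurable gaps"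
    "(\<lambda>z. z (N - 1)) \<in> borel_measurable gaps"
    using N_ge_2 by (auto intro!: measurable_component_singleton)
  show ?thesis unfolding chamber_def by measurable auto
qed

lemma weight_measurable [measurable]: "weight \<in> borel_measurable gaps"
  unfolding weight_def by measurable

lemma config_measurable [measurable]:
  "(\<lambda>(c, z). config c z) \<in> measurable (borel \<Otimes>\<^sub>M gaps) confs"
proof -
  have [measurable]: "j < N \<Longrightarrow> (\<lambda>p. ((snd p)(0 := 0)) j) \<in> borel_measurable (borel \<Otimes>\<^sub>M gaps)" for j
    by (rule measurable_compose[OF measurable_snd upd_component_measurable])
  show ?thesis unfolding config_def split_beta' by measurable
qed

lemma config_measurable' [measurable (raw)]:
  assumes [measurable]: "f \<in> borel_measurable M" "g \<in> measurable M gaps"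
  shows "(\<lambda>x. config (f x) (g x)) \<in> measurable M confs"
  using measurable_compose[OF measurable_Pair[OF assms] config_measurable] by simp

lemma D_set_measurable [measurable]: "D_set N \<in> sets confs"
proof -
  have eq: "D_set N = {x \<in> space confs. (\<forall>j\<in>{..<N}. 0 \<le> x j \<and> x j < 1) \<and>
      (\<forall>j\<in>{1..<N - 1}. tdiff (x j) (x 0) < tdiff (x (j + 1)) (x 0))}"
    by (auto simp: D_set_def space_PiM PiE_iff extensional_def)
  have [measurable]: "j < N \<Longrightarrow> (\<lambda>z. z j) \<in> borel_measurable confs" for j
    by (rule measurable_component_singleton) auto
  have "0 < N" using N_ge_2 by auto
  then show ?thesis unfolding eq by measurable auto
qed

lemma gibbs_weight_measurable [measurable]: "gw \<in> borel_measurable confs"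
  unfolding gibbs_weight_def by measurable

lemma weight_nonneg: "0 \<le> weight z" by (simp add: weight_def)

text \<open>Each pair interaction is least when the arc is half of the circle, so the energy is at
  least its formal value with all arcs equal to \<open>1 / 2\<close>.\<close>

lemma weight_bounded: "\<exists>B. \<forall>z. weight z \<le> B"
proof -
  define h where "h = real N powr (- s) * (\<Sum>j<N. \<Sum>i<j. riesz_pair s (1 / 2))"
  have "weight z \<le> exp (- \<beta> * h)" for z
  proof (cases "z \<in> chamber")
    case True
    have "h \<le> riesz_H s N (z(0 := 0))"
      unfolding riesz_H_chamber[OF True] h_def
      using chamber_gap[OF True] by (intro mult_left_mono sum_mono riesz_pair_lower_bound s_pos s_less_1) auto
    then show ?thesis using beta_pos True by (simp add: weight_def)
  qed (simp add: weight_def)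
  then show ?thesis by blast
qed

lemma chamber_in_box: "z \<in> chamber \<Longrightarrow> z \<in> extensional {1..<N} \<Longrightarrow> z \<in> PiE {1..<N} (\<lambda>_. {0..<1})"
proof -
  assume z: "z \<in> chamber" "z \<in> extensional {1..<N}"
  have "z i \<in> {0..<1}" if "i \<in> {1..<N}" for i
    using chamber_nonneg[OF z(1), of i] chamber_le_last[OF z(1), of i] that by simp
  with z(2) show "z \<in> PiE {1..<N} (\<lambda>_. {0..<1})" by (auto simp: PiE_iff)
qed

definition part_fun :: ennreal where
  "part_fun = (\<integral>\<^sup>+ z. ennreal (weight z) \<partial>gap_vol)"

lemma part_fun_finite: "part_fun < \<top>"
proof -
  interpret product_sigma_finite "\<lambda>_::nat. lborel :: real measure" ..
  obtain B where B: "\<And>z. weight z \<le> B" using weight_bounded by blast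
  have box[measurable]: "PiE {1..<N} (\<lambda>_. {0..<1::real}) \<in> sets gap_vol"
    by (intro sets_PiM_I_finite) auto
  have "part_fun \<le> (\<integral>\<^sup>+ z. ennreal B * indicator (PiE {1..<N} (\<lambda>_. {0..<1::real})) z \<partial>gap_vol)"
    unfolding part_fun_def
  proof (rule nn_integral_mono)
    fix z :: "nat \<Rightarrow> real" assume "z \<in> space gap_vol"
    then have "z \<in> extensional {1..<N}" by (auto simp: space_PiM PiE_iff)
    then show "ennreal (weight z) \<le> ennreal B * indicator (PiE {1..<N} (\<lambda>_. {0..<1})) z"
      using chamber_in_box[of z] B[of z] by (cases "z \<in> chamber") (auto simp: weight_def intro: ennreal_leI)
  qed
  also have "\<dots> = ennreal B * emeasure gap_vol (PiE {1..<N} (\<lambda>_. {0..<1::real}))"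
    by (subst nn_integral_cmult_indicator) auto
  also have "\<dots> = ennreal B" by (subst emeasure_PiM) auto
  also have "\<dots> < \<top>" by simp
  finally show ?thesis .
qed

lemma part_fun_pos: "0 < part_fun"
proof (rule ccontr)
  interpret product_sigma_finite "\<lambda>_::nat. lborel :: real measure" ..
  let ?M = "gap_vol"
  \<comment> \<open>Consecutive disjoint cells of length \<open>1 / N\<close>: one point in each
    cell is automatically ordered, and the box has positive volume.\<close>
  let ?B = "PiE {1..<N} (\<lambda>j. {real j / N<..<(real j + 1) / N})"
  assume "\<not> 0 < part_fun"
  then have "AE z in ?M. ennreal (weight z) = 0"
    unfolding part_fun_def by (subst (asm) not_gr_zero) (subst (asm) nn_integral_0_iff_AE, auto)
  then have "AE z in ?M. z \<notin> ?B"
  proof (rule AE_mp, intro AE_I2 impI notI)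
    fix z assume w: "ennreal (weight z) = 0" and z: "z \<in> ?B"
    have zj: "real j / N < z j" "z j < (real j + 1) / N" if "1 \<le> j" "j < N" for j
      using z that by (auto simp: PiE_iff)
    have "z \<in> chamber"
      unfolding chamber_def
    proof (intro CollectI conjI ballI)
      have "0 < real 1 / N" using N_ge_2 by simp
      then show "0 < z 1" using zj(1)[of 1] N_ge_2 by linarith
      show "z j < z (j + 1)" if "j \<in> {1..<N - 1}" for j
        using zj(2)[of j] zj(1)[of "j + 1"] that by (auto simp: less_diff_conv)
      have "z (N - 1) < (real (N - 1) + 1) / N" using zj(2)[of "N - 1"] N_ge_2 by simp
      also have "\<dots> = 1" using N_ge_2 by (simp add: of_nat_diff)
      finally show "z (N - 1) < 1" .
    qed
    then show False using w by (simp add: weight_def)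
  qed
  moreover have B: "?B \<in> sets ?M" by (intro sets_PiM_I_finite) auto
  ultimately have "emeasure ?M ?B = 0"
    using AE_iff_measurable[of ?B ?M "\<lambda>z. z \<notin> ?B"] sets.sets_into_space[OF B] by auto
  moreover have "emeasure ?M ?B = (\<Prod>j\<in>{1..<N}. ennreal (1 / N))"
    by (subst emeasure_PiM) (auto intro!: prod.cong simp: divide_right_mono diff_divide_distrib[symmetric])
  ultimately show False using N_ge_2 by (simp add: prod_ennreal)
qed

lemma riesz_H_config: "riesz_H s N (config c z) = riesz_H s N (z(0 := 0))"
  unfolding riesz_H_def config_def tdiff_def
  by (intro arg_cong2[where f="(*)"] refl sum.cong if_cong arg_cong[where f="riesz_g s"]) (simp_all only: restrict_apply lessThan_iff if_True frac_frac_diff add_diff_cancel_left)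

lemma tdiff_config:
  assumes "i < N" "j < N"
  shows "tdiff (config c z j) (config c z i) = frac ((z(0 := 0)) j - (z(0 := 0)) i)"
  using assms by (simp only: config_def tdiff_def restrict_apply lessThan_iff if_True frac_frac_diff add_diff_cancel_left)

lemma gibbs_weight_config:
  assumes z: "z \<in> PiE {1..<N} (\<lambda>_. {0..<1})" and "z 1 \<noteq> 0"
  shows "gw (config c z) = weight z"
proof -
  have z01: "0 \<le> z j" "z j < 1" if "1 \<le> j" "j < N" for j using z that by (auto simp: PiE_iff)
  have td: "tdiff (config c z j) (config c z 0) = z j" if "1 \<le> j" "j < N" for j
    using z01[OF that] that N_ge_2 tdiff_config[of 0 j c z] by (simp add: frac_eq)
  have "config c z \<in> D_set N \<longleftrightarrow> z \<in> chamber"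
  proof -
    have "config c z \<in> PiE {..<N} (\<lambda>_. {0..<1})" by (auto simp: config_def frac_lt_1)
    then have "config c z \<in> D_set N \<longleftrightarrow> (\<forall>j. 1 \<le> j \<longrightarrow> j + 1 < N \<longrightarrow> z j < z (j + 1))"
      by (auto simp: D_set_def td)
    also have "\<dots> \<longleftrightarrow> z \<in> chamber"
      using z01[of 1] z01[of "N - 1"] assms(2) N_ge_2 by (auto simp: chamber_def)
    finally show ?thesis .
  qed
  then show ?thesis by (simp add: gibbs_weight_def weight_def riesz_H_config indicator_def)
qed

lemma AE_first_nonzero: "AE z in gap_vol. z 1 \<noteq> (0::real)"
proof (rule AE_I)
  interpret product_sigma_finite "\<lambda>_::nat. lborel :: real measure" ..
  let ?A = "PiE {1..<N} (\<lambda>j. if j = 1 then {0} else UNIV :: real set)"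
  show "{z \<in> space gap_vol. \<not> z 1 \<noteq> (0::real)} \<subseteq> ?A"
    by (auto simp: space_PiM PiE_iff extensional_def)
  show "?A \<in> sets gap_vol" by (intro sets_PiM_I_finite) auto
  have "emeasure gap_vol ?A = (\<Prod>j\<in>{1..<N}. emeasure lborel (if j = 1 then {0} else UNIV :: real set))"
    by (rule emeasure_PiM) auto
  also have "\<dots> = 0" using N_ge_2 by (intro prod_zero bexI[of _ 1]) auto
  finally show "emeasure gap_vol ?A = 0" .
qed

text \<open>For a fixed first point \<open>c\<close>, the others are rotated by \<open>c\<close>.
  The product measure is invariant under this, and order and energy depend on differences only, so
  \<open>c\<close> disappears from the weight. This is the independence of \<open>c\<close> and
  \<open>z\<close>.\<close>

lemma nn_integral_gibbs_weight:
  fixes F :: "(nat \<Rightarrow> real) \<Rightarrow> ennreal"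
  assumes [measurable]: "F \<in> borel_measurable confs"
  shows "(\<integral>\<^sup>+ x. F x * ennreal (gw x) \<partial>torus)
    = (\<integral>\<^sup>+ c. (\<integral>\<^sup>+ z. F (config c z) * ennreal (weight z) \<partial>gap_vol) \<partial>circle_measure)"
proof -
  interpret C: product_prob_space "\<lambda>_. circle_measure" by (rule product_prob_space_circle)
  define \<Phi> where "\<Phi> x = F x * ennreal (gw x)" for x
  have \<Phi>[measurable]: "\<Phi> \<in> borel_measurable confs" unfolding \<Phi>_def by measurable
  have N: "{..<N} = insert 0 {1..<N}" "{..<N} = {1..<N} \<union> {0}" using N_ge_2 by auto
  have \<Phi>'[measurable]: "\<Phi> \<in> borel_measurable (PiM (insert 0 {1..<N}) (\<lambda>_. circle_measure))"
    unfolding N(1)[symmetric] by measurable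
  have upd[measurable]: "(\<lambda>x. x(0 := c)) \<in> measurable gaps confs" for c
    by (rule measurable_fun_upd[OF N(2)]) auto
  have "(\<integral>\<^sup>+ x. \<Phi> x \<partial>torus)
      = (\<integral>\<^sup>+ c. (\<integral>\<^sup>+ x. \<Phi> (x(0 := c)) \<partial>PiM {1..<N} (\<lambda>_. circle_measure)) \<partial>circle_measure)"
    unfolding N(1) by (rule C.product_nn_integral_insert_rev) (auto simp: \<Phi>')
  also have "\<dots> = (\<integral>\<^sup>+ c. (\<integral>\<^sup>+ z. F (config c z) * ennreal (weight z) \<partial>gap_vol) \<partial>circle_measure)"
  proof (rule nn_integral_cong_AE, use AE_circle_measure in eventually_elim)
    fix c :: real assume c: "c \<in> {0..<1}"
    have cf: "(\<lambda>i\<in>{1..<N}. frac (c + x i))(0 := c) = config c x" for x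
      using c N_ge_2 by (auto simp: config_def fun_eq_iff)
    have "(\<integral>\<^sup>+ x. \<Phi> (x(0 := c)) \<partial>PiM {1..<N} (\<lambda>_. circle_measure))
        = (\<integral>\<^sup>+ x. \<Phi> (config c x) \<partial>PiM {1..<N} (\<lambda>_. circle_measure))"
      by (subst nn_integral_PiM_circle_rotate[where c=c]) (auto simp: cf)
    also have "\<dots> = (\<integral>\<^sup>+ x. \<Phi> (config c x) * indicator (PiE {1..<N} (\<lambda>_. {0..<1})) x \<partial>gap_vol)"
      by (rule nn_integral_PiM_circle) auto
    also have "\<dots> = (\<integral>\<^sup>+ z. F (config c z) * ennreal (weight z) \<partial>gap_vol)"
    proof (rule nn_integral_cong_AE, use AE_first_nonzero AE_space in eventually_elim)
      fix z :: "nat \<Rightarrow> real" assume z: "z 1 \<noteq> 0" "z \<in> space gap_vol"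
      then have "z \<in> extensional {1..<N}" by (auto simp: space_PiM PiE_iff)
      then show "\<Phi> (config c z) * indicator (PiE {1..<N} (\<lambda>_. {0..<1})) z = F (config c z) * ennreal (weight z)"
        using chamber_in_box[of z] gibbs_weight_config[of z c, OF _ z(1)]
        by (cases "z \<in> PiE {1..<N} (\<lambda>_. {0..<1})"; cases "z \<in> chamber") (simp_all add: \<Phi>_def weight_def)
    qed
    finally show "(\<integral>\<^sup>+ x. \<Phi> (x(0 := c)) \<partial>PiM {1..<N} (\<lambda>_. circle_measure))
      = (\<integral>\<^sup>+ z. F (config c z) * ennreal (weight z) \<partial>gap_vol)" .
  qed
  finally show ?thesis unfolding \<Phi>_def .
qed

end

subsection \<open>Gibbs measure and cyclic invariance\<close>

context riesz_gas
begin

text \<open>The constant is the one of the gap law: the first point integrates to 1.\<close>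

definition gibbs :: "(nat \<Rightarrow> real) measure" where
  "gibbs = density torus (\<lambda>x. ennreal (gw x) / part_fun)"

definition gap_law :: "(nat \<Rightarrow> real) measure" where
  "gap_law = density gap_vol (\<lambda>z. ennreal (weight z) / part_fun)"

lemma sets_gibbs [simp, measurable_cong]: "sets gibbs = sets confs"
  by (simp add: gibbs_def sets_PiM_circle)

lemma sets_gap_law [simp, measurable_cong]: "sets gap_law = sets gaps"
  by (simp add: gap_law_def sets_PiM_lborel)

lemma space_gibbs: "space gibbs = extensional {..<N}"
  by (simp add: gibbs_def space_PiM PiE_UNIV_domain PiE_def)

lemma nn_integral_gap_law:
  assumes [measurable]: "F \<in> borel_measurable gaps"
  shows "(\<integral>\<^sup>+ z. F z \<partial>gap_law) = (\<integral>\<^sup>+ z. F z * ennreal (weight z) \<partial>gap_vol) / part_fun"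
proof -
  have "(\<integral>\<^sup>+ z. F z \<partial>gap_law) = (\<integral>\<^sup>+ z. ennreal (weight z) / part_fun * F z \<partial>gap_vol)"
    unfolding gap_law_def by (rule nn_integral_density) measurable
  also have "\<dots> = (\<integral>\<^sup>+ z. F z * ennreal (weight z) / part_fun \<partial>gap_vol)"
    by (intro nn_integral_cong) (simp add: divide_ennreal_def mult_ac)
  also have "\<dots> = (\<integral>\<^sup>+ z. F z * ennreal (weight z) \<partial>gap_vol) / part_fun"
    by (rule nn_integral_divide) measurable
  finally show ?thesis .
qed

lemma nn_integral_gibbs_density:
  assumes [measurable]: "F \<in> borel_measurable confs"
  shows "(\<integral>\<^sup>+ x. F x \<partial>gibbs)
    = (\<integral>\<^sup>+ x. F x * ennreal (gw x) \<partial>torus) / part_fun"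
proof -
  have "(\<integral>\<^sup>+ x. F x \<partial>gibbs) = (\<integral>\<^sup>+ x. ennreal (gw x) / part_fun * F x \<partial>torus)"
    unfolding gibbs_def by (rule nn_integral_density) measurable
  also have "\<dots> = (\<integral>\<^sup>+ x. F x * ennreal (gw x) / part_fun \<partial>torus)"
    by (intro nn_integral_cong) (simp add: divide_ennreal_def mult_ac)
  also have "\<dots> = (\<integral>\<^sup>+ x. F x * ennreal (gw x) \<partial>torus) / part_fun"
    by (rule nn_integral_divide) measurable
  finally show ?thesis .
qed

lemma nn_integral_gibbs:
  assumes [measurable]: "F \<in> borel_measurable confs"
  shows "(\<integral>\<^sup>+ x. F x \<partial>gibbs) = (\<integral>\<^sup>+ c. (\<integral>\<^sup>+ z. F (config c z) \<partial>gap_law) \<partial>circle_measure)"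
proof -
  interpret product_sigma_finite "\<lambda>_::nat. lborel :: real measure" ..
  interpret L: finite_product_sigma_finite "\<lambda>_::nat. lborel :: real measure" "{1..<N}" by standard simp
  have "(\<integral>\<^sup>+ x. F x \<partial>gibbs)
      = (\<integral>\<^sup>+ c. (\<integral>\<^sup>+ z. F (config c z) * ennreal (weight z) \<partial>gap_vol) \<partial>circle_measure) / part_fun"
    by (simp add: nn_integral_gibbs_density nn_integral_gibbs_weight)
  also have "\<dots> = (\<integral>\<^sup>+ c. (\<integral>\<^sup>+ z. F (config c z) * ennreal (weight z) \<partial>gap_vol) / part_fun \<partial>circle_measure)"
    by (rule nn_integral_divide[symmetric]) measurable
  also have "\<dots> = (\<integral>\<^sup>+ c. (\<integral>\<^sup>+ z. F (config c z) \<partial>gap_law) \<partial>circle_measure)"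
    by (intro nn_integral_cong nn_integral_gap_law[symmetric]) measurable
  finally show ?thesis .
qed

lemma prob_space_gap_law: "prob_space gap_law"
proof (rule prob_spaceI)
  have "emeasure gap_law (space gap_law) = (\<integral>\<^sup>+ z. 1 \<partial>gap_law)" by simp
  also have "\<dots> = part_fun / part_fun" by (subst nn_integral_gap_law) (auto simp: part_fun_def)
  also have "\<dots> = 1" using part_fun_pos part_fun_finite by (intro ennreal_divide_self) auto
  finally show "emeasure gap_law (space gap_law) = 1" .
qed

sublocale Q: prob_space gap_law by (rule prob_space_gap_law)

lemma prob_space_gibbs: "prob_space gibbs"
proof (rule prob_spaceI)
  interpret U: prob_space circle_measure by (rule prob_space_circle_measure)
  have "emeasure gibbs (space gibbs) = (\<integral>\<^sup>+ x. 1 \<partial>gibbs)" by simp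
  also have "\<dots> = 1" by (subst nn_integral_gibbs) (auto simp: Q.emeasure_space_1 U.emeasure_space_1[simplified])
  finally show "emeasure gibbs (space gibbs) = 1" .
qed

sublocale P: prob_space gibbs by (rule prob_space_gibbs)

lemma AE_gap_law: "AE z in gap_law. z \<in> chamber"
  unfolding gap_law_def by (subst AE_density) (auto simp: weight_def indicator_def)

lemma nn_integral_gibbs_weight_lborel:
  assumes [measurable]: "F \<in> borel_measurable confs"
  shows "(\<integral>\<^sup>+ x. F x * ennreal (gw x) \<partial>PiM {..<N} (\<lambda>_. lborel))
    = (\<integral>\<^sup>+ x. F x * ennreal (gw x) \<partial>torus)"
  by (subst nn_integral_PiM_circle)
    (auto intro!: nn_integral_cong simp: gibbs_weight_def indicator_def D_set_def)

text \<open>Events are given as sets of arbitrary functions, while the product space consists of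
  extensional ones; measurability is therefore asked of the trace of \<open>A\<close> on the
  space.\<close>

lemma riesz_prob_eq:
  assumes A: "{x \<in> space confs. x \<in> A} \<in> sets confs"
  shows "riesz_prob s \<beta> N A = \<P>(x in gibbs. x \<in> A)"
proof -
  interpret U: prob_space circle_measure by (rule prob_space_circle_measure)
  let ?B = "{x \<in> space confs. x \<in> A}"
  note A[measurable]
  have "(\<integral>\<^sup>+ x. ennreal (indicator A x * gw x) \<partial>PiM {..<N} (\<lambda>_. lborel))
      = (\<integral>\<^sup>+ x. indicator ?B x * ennreal (gw x) \<partial>PiM {..<N} (\<lambda>_. lborel))"
    by (intro nn_integral_cong) (auto simp: indicator_def space_PiM)
  also have "\<dots> = (\<integral>\<^sup>+ x. indicator ?B x * ennreal (gw x) \<partial>torus)"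
    by (rule nn_integral_gibbs_weight_lborel) measurable
  finally have num: "(\<integral>\<^sup>+ x. ennreal (indicator A x * gw x) \<partial>PiM {..<N} (\<lambda>_. lborel))
      = (\<integral>\<^sup>+ x. indicator ?B x * ennreal (gw x) \<partial>torus)" .
  have "(\<integral>\<^sup>+ x. ennreal (gw x) \<partial>PiM {..<N} (\<lambda>_. lborel)) = part_fun"
    using nn_integral_gibbs_weight_lborel[of "\<lambda>_. 1"] nn_integral_gibbs_weight[of "\<lambda>_. 1"]
    by (simp add: part_fun_def[symmetric] U.emeasure_space_1[simplified])
  moreover have "emeasure gibbs ?B
      = (\<integral>\<^sup>+ x. indicator ?B x * ennreal (gw x) \<partial>torus) / part_fun"
    using nn_integral_gibbs_density[of "indicator ?B"] A by simp
  ultimately have "riesz_prob s \<beta> N A = enn2real (emeasure gibbs ?B)"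
    unfolding riesz_prob_def num by simp
  then show ?thesis by (simp add: measure_def space_gibbs space_PiM PiE_def)
qed

lemma AE_gibbsI:
  assumes [measurable]: "Measurable.pred confs R"
    and R: "\<And>c z. 0 \<le> c \<Longrightarrow> c < 1 \<Longrightarrow> z \<in> chamber \<Longrightarrow> R (config c z)"
  shows "AE x in gibbs. R x"
proof -
  have "(\<integral>\<^sup>+ x. indicator {x. \<not> R x} x \<partial>gibbs)
      = (\<integral>\<^sup>+ c. (\<integral>\<^sup>+ z. indicator {x. \<not> R x} (config c z) \<partial>gap_law) \<partial>circle_measure)"
    by (rule nn_integral_gibbs) measurable
  also have "\<dots> = (\<integral>\<^sup>+ c. 0 \<partial>circle_measure)"
  proof (rule nn_integral_cong_AE, use AE_circle_measure in eventually_elim)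
    fix c :: real assume "c \<in> {0..<1}"
    then have "(\<integral>\<^sup>+ z. indicator {x. \<not> R x} (config c z) \<partial>gap_law) = (\<integral>\<^sup>+ z. 0 \<partial>gap_law)"
      using R by (intro nn_integral_cong_AE) (use AE_gap_law in \<open>eventually_elim, auto simp: indicator_def\<close>)
    then show "(\<integral>\<^sup>+ z. indicator {x. \<not> R x} (config c z) \<partial>gap_law) = 0" by simp
  qed
  finally have "(\<integral>\<^sup>+ x. indicator {x. \<not> R x} x \<partial>gibbs) = 0" by simp
  then have "AE x in gibbs. indicator {x. \<not> R x} x = (0 :: ennreal)"
    by (subst (asm) nn_integral_0_iff_AE) auto
  then show ?thesis by eventually_elim (auto simp: indicator_def split: if_splits)
qed

definition shift :: "nat \<Rightarrow> (nat \<Rightarrow> real) \<Rightarrow> nat \<Rightarrow> real" where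
  "shift i x = (\<lambda>j\<in>{..<N}. x ((i + j) mod N))"

lemma shift_measurable [measurable]: "shift i \<in> measurable confs confs"
proof -
  have [measurable]: "(\<lambda>x. x ((i + j) mod N)) \<in> borel_measurable confs" for j
    using N_ge_2 by (intro measurable_component_singleton) auto
  show ?thesis unfolding shift_def by measurable
qed

lemma bij_betw_rotate: "bij_betw (\<lambda>j. (i + j) mod N) {..<N} {..<N}"
proof -
  have "inj_on (\<lambda>j. (i + j) mod N) {..<N}"
  proof (rule linorder_inj_onI')
    fix a b assume ab: "a \<in> {..<N}" "b \<in> {..<N}" "a < b"
    have "\<not> N dvd (i + b) - (i + a)" using ab by (auto dest: dvd_imp_le)
    then show "(i + a) mod N \<noteq> (i + b) mod N"
      using mod_eq_dvd_iff_nat[of "i + a" "i + b" N] ab by auto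
  qed
  moreover have "(\<lambda>j. (i + j) mod N) ` {..<N} \<subseteq> {..<N}" using N_ge_2 by auto
  ultimately show ?thesis by (simp add: bij_betw_def endo_inj_surj)
qed

lemma riesz_H_shift: "riesz_H s N (shift i x) = riesz_H s N x"
proof -
  let ?r = "\<lambda>j. (i + j) mod N"
  let ?t = "\<lambda>a b. if a \<noteq> b then riesz_g s (tdiff (x a) (x b)) else 0"
  note r = bij_betw_rotate[of i]
  have "(\<Sum>a<N. \<Sum>b<N. ?t (?r a) (?r b)) = (\<Sum>a<N. \<Sum>b<N. ?t (?r a) b)"
    by (intro sum.cong refl sum.reindex_bij_betw[OF r])
  also have "\<dots> = (\<Sum>a<N. \<Sum>b<N. ?t a b)"
    by (rule sum.reindex_bij_betw[OF r])
  finally have "(\<Sum>a<N. \<Sum>b<N. ?t (?r a) (?r b)) = (\<Sum>a<N. \<Sum>b<N. ?t a b)" .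
  moreover have "(\<Sum>a<N. \<Sum>b<N. if a \<noteq> b then riesz_g s (tdiff (shift i x a) (shift i x b)) else 0)
      = (\<Sum>a<N. \<Sum>b<N. ?t (?r a) (?r b))"
    using inj_on_eq_iff[OF bij_betw_imp_inj_on[OF r]] by (intro sum.cong refl) (auto simp: shift_def)
  ultimately show ?thesis by (simp add: riesz_H_def)
qed

text \<open>Seen from \<open>x 1\<close>, the old base point comes last: its arc has length
  \<open>1 - y 1\<close>, which exceeds every \<open>y (j + 1) - y 1\<close>. If
  \<open>x 1 = x 0\<close>, this arc would have length 0 instead of 1.\<close>

lemma shift_D_set:
  assumes x: "x \<in> D_set N" and ne: "x 1 \<noteq> x 0"
  shows "shift 1 x \<in> D_set N"
proof -
  have x01: "0 \<le> x j" "x j < 1" if "j < N" for j using x that by (auto simp: D_set_def PiE_iff)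
  define y where "y j = tdiff (x j) (x 0)" for j
  have y0: "y 0 = 0" by (simp add: y_def tdiff_def)
  have y01: "0 \<le> y j" "y j < 1" for j by (auto simp: y_def tdiff_def frac_lt_1)
  have y1: "0 < y 1"
  proof -
    have "x 1 - x 0 \<notin> \<int>"
    proof
      assume "x 1 - x 0 \<in> \<int>"
      then obtain m :: int where "x 1 - x 0 = m" by (auto elim: Ints_cases)
      moreover have "\<bar>x 1 - x 0\<bar> < 1" using x01[of 0] x01[of 1] N_ge_2 by auto
      ultimately have "x 1 - x 0 = 0" by simp
      with ne show False by simp
    qed
    then show ?thesis by (simp add: y_def tdiff_def)
  qed
  have ymono: "y j < y (j + 1)" if "1 \<le> j" "j + 1 < N" for j using x that by (auto simp: D_set_def y_def)
  have y1le: "y 1 \<le> y j" if "1 \<le> j" "j < N" for j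
    using that
  proof (induction j rule: dec_induct)
    case (step n)
    then show ?case using ymono[of n] by (simp add: Suc_eq_plus1)
  qed simp
  have td: "tdiff (x a) (x b) = frac (y a - y b)" for a b
    by (simp add: y_def tdiff_def frac_frac_diff)
  have gap: "tdiff (shift 1 x j) (shift 1 x 0) = (if j = N - 1 then 1 - y 1 else y (j + 1) - y 1)"
    if j: "1 \<le> j" "j < N" for j
  proof (cases "j = N - 1")
    case True
    then have "(1 + j) mod N = 0" using N_ge_2 by simp
    then show ?thesis
      using True j N_ge_2 y0 y1 y01[of 1] by (simp add: shift_def td frac_unique_iff)
  next
    case False
    then show ?thesis
      using j N_ge_2 y1le[of "j + 1"] y1 y01[of "j + 1"] by (simp add: shift_def td frac_eq add.commute)
  qed
  have "shift 1 x \<in> PiE {..<N} (\<lambda>_. {0..<1})" using x01 N_ge_2 by (auto simp: shift_def)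
  moreover have "tdiff (shift 1 x j) (shift 1 x 0) < tdiff (shift 1 x (j + 1)) (shift 1 x 0)"
    if j: "1 \<le> j" "j + 1 < N" for j
    using j y01[of "j + 1"] ymono[of "j + 1"] by (auto simp: gap)
  ultimately show ?thesis by (auto simp: D_set_def)
qed

lemma AE_gibbs_first_distinct: "AE x in gibbs. x 1 \<noteq> x 0"
proof (rule AE_gibbsI)
  have [measurable]: "(\<lambda>x. x 0) \<in> borel_measurable confs"
    "(\<lambda>x. x 1) \<in> borel_measurable confs"
    using N_ge_2 by (auto intro!: measurable_component_singleton)
  show "Measurable.pred confs (\<lambda>x. x 1 \<noteq> (x 0 :: real))" unfolding neq_iff by measurable
  fix c :: real and z assume "z \<in> chamber"
  then have "0 < frac ((z(0 := 0)) 1 - (z(0 := 0)) 0)"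
    using chamber_gap[of z 0 1] N_ge_2 by (simp add: frac_eq)
  then show "config c z 1 \<noteq> config c z 0"
    using tdiff_config[of 0 1 c z] N_ge_2 by (auto simp: tdiff_def)
qed

text \<open>\<open>shift_D_set\<close> says that the domain is mapped into itself up to a null set,
  which makes the density at \<open>x\<close> at most the density at \<open>shift 1 x\<close>. The
  uniform product measure is invariant under renumbering.\<close>

lemma emeasure_gibbs_shift_le:
  assumes [measurable]: "A \<in> sets confs"
  shows "emeasure (distr gibbs gibbs (shift 1)) A \<le> emeasure gibbs A"
proof -
  let ?\<Omega> = "torus"
  let ?d = "\<lambda>x. ennreal (gw x) / part_fun"
  have inv: "distr ?\<Omega> ?\<Omega> (shift 1) = ?\<Omega>"
    using distr_PiM_reindex[of "{..<N}" "\<lambda>_. circle_measure" "\<lambda>j. (1 + j) mod N" "{..<N}"]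
      bij_betw_rotate[of 1] prob_space_circle_measure
    by (auto simp: shift_def[abs_def] bij_betw_def)
  have "AE x in ?\<Omega>. 0 < ?d x \<longrightarrow> x 1 \<noteq> x 0"
    using AE_gibbs_first_distinct unfolding gibbs_def by (subst (asm) AE_density) auto
  then have le: "AE x in ?\<Omega>. ?d x \<le> ?d (shift 1 x)"
  proof eventually_elim
    case (elim x)
    show ?case
    proof (cases "0 < ?d x")
      case True
      then have "x \<in> D_set N" by (rule contrapos_pp) (simp add: gibbs_weight_def)
      with elim True have "shift 1 x \<in> D_set N" by (intro shift_D_set) auto
      then show ?thesis using \<open>x \<in> D_set N\<close> by (simp add: gibbs_weight_def riesz_H_shift)
    qed (use not_gr_zero in force)
  qed
  have "emeasure (distr gibbs gibbs (shift 1)) A = (\<integral>\<^sup>+ x. indicator A x \<partial>distr gibbs gibbs (shift 1))" by simp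
  also have "\<dots> = (\<integral>\<^sup>+ x. indicator A (shift 1 x) \<partial>gibbs)"
    by (rule nn_integral_distr) measurable
  also have "\<dots> = (\<integral>\<^sup>+ x. ?d x * indicator A (shift 1 x) \<partial>?\<Omega>)"
    unfolding gibbs_def by (rule nn_integral_density) measurable
  also have "\<dots> \<le> (\<integral>\<^sup>+ x. ?d (shift 1 x) * indicator A (shift 1 x) \<partial>?\<Omega>)"
    by (rule nn_integral_mono_AE, use le in eventually_elim) (auto intro: mult_right_mono)
  also have "\<dots> = (\<integral>\<^sup>+ x. ?d x * indicator A x \<partial>distr ?\<Omega> ?\<Omega> (shift 1))"
    by (rule nn_integral_distr[symmetric]) measurable
  also have "\<dots> = (\<integral>\<^sup>+ x. indicator A x \<partial>gibbs)"
    unfolding inv gibbs_def by (rule nn_integral_density[symmetric]) measurable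
  finally show ?thesis by simp
qed

text \<open>A probability measure that lies below another on every event equals it: apply the
  inequality to the complement as well.\<close>

lemma distr_gibbs_shift_one: "distr gibbs gibbs (shift 1) = gibbs"
proof (rule measure_eqI)
  interpret D: prob_space "distr gibbs gibbs (shift 1)" by (rule P.prob_space_distr) measurable
  fix A assume "A \<in> sets (distr gibbs gibbs (shift 1))"
  then have A: "A \<in> sets confs" by simp
  have le: "measure (distr gibbs gibbs (shift 1)) B \<le> measure gibbs B" if "B \<in> sets confs" for B
    using emeasure_gibbs_shift_le[OF that] by (simp add: D.emeasure_eq_measure P.emeasure_eq_measure)
  have "space gibbs - A \<in> sets gibbs" using A by (intro sets.compl_sets) simp
  then have "measure (distr gibbs gibbs (shift 1)) (space gibbs - A) \<le> measure gibbs (space gibbs - A)"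
    by (intro le) simp
  then have "measure gibbs A \<le> measure (distr gibbs gibbs (shift 1)) A"
    using D.prob_compl[of A] P.prob_compl[of A] A by simp
  with le[OF A] show "emeasure (distr gibbs gibbs (shift 1)) A = emeasure gibbs A"
    by (simp add: D.emeasure_eq_measure P.emeasure_eq_measure)
qed simp

lemma nn_integral_gibbs_shift:
  assumes [measurable]: "F \<in> borel_measurable confs"
  shows "(\<integral>\<^sup>+ x. F (shift i x) \<partial>gibbs) = (\<integral>\<^sup>+ x. F x \<partial>gibbs)"
proof (induction i)
  case 0
  have "shift 0 x = x" if "x \<in> space gibbs" for x
    using that by (auto simp: shift_def space_gibbs extensional_def fun_eq_iff)
  then show ?case by (auto intro!: nn_integral_cong)
next
  case (Suc i)
  have "shift (Suc i) x = shift i (shift 1 x)" for x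
    using N_ge_2 by (auto simp: shift_def fun_eq_iff mod_add_right_eq Suc_eq_plus1 add_ac)
  then have "(\<integral>\<^sup>+ x. F (shift (Suc i) x) \<partial>gibbs) = (\<integral>\<^sup>+ x. F (shift i x) \<partial>distr gibbs gibbs (shift 1))"
    by (subst nn_integral_distr) auto
  then show ?case using Suc by (simp add: distr_gibbs_shift_one)
qed

lemma nn_integral_gibbs_arc:
  assumes [measurable]: "G \<in> borel_measurable borel" and i: "i < N" and k: "1 \<le> k" "k < N"
  shows "(\<integral>\<^sup>+ x. G (tdiff (x ((i + k) mod N)) (x i)) \<partial>gibbs) = (\<integral>\<^sup>+ z. G (z k) \<partial>gap_law)"
proof -
  interpret U: prob_space circle_measure by (rule prob_space_circle_measure)
  have [measurable]: "(\<lambda>x. x j) \<in> borel_measurable confs" if "j < N" for j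
    using that by (intro measurable_component_singleton) auto
  have "0 < N" using N_ge_2 by simp
  then have F[measurable]: "(\<lambda>x. G (tdiff (x k) (x 0))) \<in> borel_measurable confs"
    using k by measurable
  have "(\<integral>\<^sup>+ x. G (tdiff (x ((i + k) mod N)) (x i)) \<partial>gibbs) = (\<integral>\<^sup>+ x. G (tdiff (shift i x k) (shift i x 0)) \<partial>gibbs)"
    using i k \<open>0 < N\<close> by (simp add: shift_def)
  also have "\<dots> = (\<integral>\<^sup>+ x. G (tdiff (x k) (x 0)) \<partial>gibbs)"
    by (rule nn_integral_gibbs_shift) measurable
  also have "\<dots> = (\<integral>\<^sup>+ c. (\<integral>\<^sup>+ z. G (tdiff (config c z k) (config c z 0)) \<partial>gap_law) \<partial>circle_measure)"
    by (rule nn_integral_gibbs) measurable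
  also have "\<dots> = (\<integral>\<^sup>+ c. (\<integral>\<^sup>+ z. G (z k) \<partial>gap_law) \<partial>circle_measure)"
  proof (rule nn_integral_cong, rule nn_integral_cong_AE, use AE_gap_law in eventually_elim)
    fix c z assume z: "z \<in> chamber"
    show "G (tdiff (config c z k) (config c z 0)) = G (z k)"
      using chamber_nonneg[OF z, of k] chamber_le_last[OF z, of k] k \<open>0 < N\<close>
      by (simp add: tdiff_config frac_eq)
  qed
  finally show ?thesis by (simp add: U.emeasure_space_1[simplified])
qed

text \<open>Cyclic invariance in gap coordinates. The \<open>frac\<close> lets the arc run past the
  base point, which is how the closing gap is reached.\<close>

lemma nn_integral_gap_law_arc:
  assumes [measurable]: "G \<in> borel_measurable borel" and i: "i < N" and k: "1 \<le> k" "k < N"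
  shows "(\<integral>\<^sup>+ z. G (frac ((z(0 := 0)) ((i + k) mod N) - (z(0 := 0)) i)) \<partial>gap_law) = (\<integral>\<^sup>+ z. G (z k) \<partial>gap_law)"
proof -
  interpret U: prob_space circle_measure by (rule prob_space_circle_measure)
  have [measurable]: "(\<lambda>x. x j) \<in> borel_measurable confs" if "j < N" for j
    using that by (intro measurable_component_singleton) auto
  have m: "(i + k) mod N < N" using N_ge_2 by simp
  have [measurable]: "(\<lambda>x. G (tdiff (x ((i + k) mod N)) (x i))) \<in> borel_measurable confs"
    using m i by measurable
  have "(\<integral>\<^sup>+ z. G (z k) \<partial>gap_law) = (\<integral>\<^sup>+ x. G (tdiff (x ((i + k) mod N)) (x i)) \<partial>gibbs)"
    by (rule nn_integral_gibbs_arc[symmetric]) (use assms in auto)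
  also have "\<dots> = (\<integral>\<^sup>+ c. (\<integral>\<^sup>+ z. G (tdiff (config c z ((i + k) mod N)) (config c z i)) \<partial>gap_law) \<partial>circle_measure)"
    by (rule nn_integral_gibbs) measurable
  also have "\<dots> = (\<integral>\<^sup>+ z. G (frac ((z(0 := 0)) ((i + k) mod N) - (z(0 := 0)) i)) \<partial>gap_law)"
    using tdiff_config[OF i m] by (simp add: U.emeasure_space_1[simplified] del: fun_upd_apply)
  finally show ?thesis by simp
qed

end

subsection \<open>Mean gaps\<close>

context riesz_gas
begin

definition pos :: "(nat \<Rightarrow> real) \<Rightarrow> nat \<Rightarrow> real" where
  "pos z = z(0 := 0)"

lemma pos_0 [simp]: "pos z 0 = 0" by (simp add: pos_def)

lemma pos_pos: "1 \<le> j \<Longrightarrow> pos z j = z j" by (simp add: pos_def)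

lemmas pos_less = chamber_less[folded pos_def]
lemmas pos_less_1 = chamber_le_last[folded pos_def]
lemmas pos_nonneg = chamber_nonneg[folded pos_def]
lemmas pos_gap = chamber_gap[folded pos_def]
lemmas riesz_H_pos = riesz_H_chamber[folded pos_def]
lemmas nn_integral_arc = nn_integral_gap_law_arc[folded pos_def]

lemma weight_pos: "z \<in> chamber \<Longrightarrow> weight z = exp (- \<beta> * riesz_H s N (pos z))"
  by (simp add: weight_def pos_def)

lemma pos_measurable [measurable]: "j < N \<Longrightarrow> (\<lambda>z. pos z j) \<in> borel_measurable gap_law"
  using upd_component_measurable[folded pos_def] by (simp cong: measurable_cong_sets)

lemma expectation_gap_shift:
  fixes G :: "real \<Rightarrow> real"
  assumes G: "G \<in> borel_measurable borel" "\<And>t. 0 \<le> G t" and ij: "i < j" "j < N"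
  shows "(\<integral>z. G (pos z j - pos z i) \<partial>gap_law) = (\<integral>z. G (pos z (j - i)) \<partial>gap_law)"
proof -
  note [measurable] = G(1)
  have m: "i < N" "j - i < N" "(i + (j - i)) mod N = j" "1 \<le> j - i" "j - i \<noteq> 0" using ij by auto
  have "(\<integral>\<^sup>+ z. ennreal (G (pos z j - pos z i)) \<partial>gap_law)
      = (\<integral>\<^sup>+ z. ennreal (G (frac (pos z ((i + (j - i)) mod N) - pos z i))) \<partial>gap_law)"
    unfolding m(3)
  proof (rule nn_integral_cong_AE, use AE_gap_law in eventually_elim)
    fix z assume "z \<in> chamber"
    from pos_gap[OF this ij] have "frac (pos z j - pos z i) = pos z j - pos z i"
      unfolding frac_eq by simp
    then show "ennreal (G (pos z j - pos z i)) = ennreal (G (frac (pos z j - pos z i)))" by (simp only:)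
  qed
  also have "\<dots> = (\<integral>\<^sup>+ z. ennreal (G (pos z (j - i))) \<partial>gap_law)"
    using nn_integral_arc[of "\<lambda>t. ennreal (G t)" i "j - i"] m by (simp add: pos_pos)
  finally show ?thesis
    using m ij G by (subst (1 2) integral_eq_nn_integral) auto
qed

text \<open>The arc from point \<open>N - 1\<close> through the base point to point \<open>k\<close>
  consists of \<open>k + 1\<close> gaps; for \<open>k = 0\<close> it is the closing gap.\<close>

lemma nn_integral_arc_across_0:
  fixes G :: "real \<Rightarrow> ennreal"
  assumes [measurable]: "G \<in> borel_measurable borel" and k: "k + 1 < N"
  shows "(\<integral>\<^sup>+ z. G (pos z k + (1 - pos z (N - 1))) \<partial>gap_law) = (\<integral>\<^sup>+ z. G (pos z (k + 1)) \<partial>gap_law)"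
proof -
  have m: "N - 1 < N" "(N - 1 + (k + 1)) mod N = k" "k < N - 1" using k by auto
  have fr: "frac (pos z k - pos z (N - 1)) = pos z k + (1 - pos z (N - 1))" if "z \<in> chamber" for z
    using pos_gap[OF that m(3,1)] by (simp add: frac_unique_iff)
  have "(\<integral>\<^sup>+ z. G (pos z k + (1 - pos z (N - 1))) \<partial>gap_law)
      = (\<integral>\<^sup>+ z. G (frac (pos z ((N - 1 + (k + 1)) mod N) - pos z (N - 1))) \<partial>gap_law)"
    unfolding m(2) by (rule nn_integral_cong_AE, use AE_gap_law in eventually_elim) (simp only: fr)
  also have "\<dots> = (\<integral>\<^sup>+ z. G (pos z (k + 1)) \<partial>gap_law)"
    using nn_integral_arc[of G "N - 1" "k + 1"] m k by (simp add: pos_pos)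
  finally show ?thesis .
qed

lemma expectation_last_gap:
  "(\<integral>z. 1 - pos z (N - 1) \<partial>gap_law) = (\<integral>z. pos z 1 \<partial>gap_law)"
proof -
  have m: "N - 1 < N" "1 < N" using N_ge_2 by auto
  have "(\<integral>\<^sup>+ z. ennreal (1 - pos z (N - 1)) \<partial>gap_law) = (\<integral>\<^sup>+ z. ennreal (pos z 1) \<partial>gap_law)"
    using nn_integral_arc_across_0[of ennreal 0] m by simp
  moreover have "AE z in gap_law. 0 \<le> 1 - pos z (N - 1)" "AE z in gap_law. 0 \<le> pos z 1"
    using AE_gap_law by (eventually_elim, use pos_less_1[OF _ m(1)] pos_nonneg[OF _ m(2)] in force)+
  ultimately show ?thesis
    using m by (subst (1 2) integral_eq_nn_integral) auto
qed

lemma pos_bounds_AE: "j < N \<Longrightarrow> AE z in gap_law. 0 \<le> pos z j \<and> pos z j < 1"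
  using AE_gap_law by eventually_elim (use pos_nonneg pos_less_1 in blast)

lemma pos_integrable: "j < N \<Longrightarrow> integrable gap_law (\<lambda>z. pos z j)"
proof -
  assume j: "j < N"
  show ?thesis
  proof (rule Q.integrable_const_bound[of _ 1])
    show "AE z in gap_law. norm (pos z j) \<le> 1" using pos_bounds_AE[OF j] by eventually_elim auto
  qed (use j in measurable)
qed

text \<open>All \<open>N\<close> gaps have the same mean \<open>m\<close> and together fill the
  circle. The closing gap turns this into \<open>m = 1 - (N - 1) * m\<close>.\<close>

theorem expectation_pos:
  assumes "j < N"
  shows "(\<integral>z. pos z j \<partial>gap_law) = real j / real N"
proof -
  define m where "m = (\<integral>z. pos z 1 \<partial>gap_law)"
  have lin: "(\<integral>z. pos z j \<partial>gap_law) = real j * m" if "j < N" for j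
    using that
  proof (induction j)
    case (Suc j)
    have j: "j < Suc j" "Suc j < N" "j < N" using Suc.prems by auto
    \<comment> \<open>The absolute value makes the test function nonnegative on all reals, as
      \<open>expectation_gap_shift\<close> demands; almost surely it changes nothing.\<close>
    have "(\<integral>z. \<bar>pos z (Suc j) - pos z j\<bar> \<partial>gap_law) = (\<integral>z. \<bar>pos z (Suc j - j)\<bar> \<partial>gap_law)"
      by (rule expectation_gap_shift) (use j in auto)
    also have "\<dots> = (\<integral>z. pos z 1 \<partial>gap_law)"
    proof (rule integral_cong_AE)
      show "AE z in gap_law. \<bar>pos z (Suc j - j)\<bar> = pos z 1"
        using pos_bounds_AE[of 1] N_ge_2 by (auto simp: Suc_eq_plus1)
    qed (use j N_ge_2 in \<open>auto simp: Suc_eq_plus1\<close>)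
    finally have "m = (\<integral>z. \<bar>pos z (Suc j) - pos z j\<bar> \<partial>gap_law)" by (simp only: m_def)
    also have "\<dots> = (\<integral>z. pos z (Suc j) - pos z j \<partial>gap_law)"
    proof (rule integral_cong_AE)
      show "AE z in gap_law. \<bar>pos z (Suc j) - pos z j\<bar> = pos z (Suc j) - pos z j"
        using AE_gap_law
      proof eventually_elim
        case (elim z)
        show ?case using pos_less[OF elim j(1,2)] by linarith
      qed
    qed (use j in auto)
    also have "\<dots> = (\<integral>z. pos z (Suc j) \<partial>gap_law) - (\<integral>z. pos z j \<partial>gap_law)"
      using j by (intro Bochner_Integration.integral_diff pos_integrable)
    finally show ?case using Suc.IH[OF j(3)] by (simp only: of_nat_Suc) (simp add: algebra_simps)
  qed simp
  have "m = 1 - real (N - 1) * m"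
  proof -
    have "m = (\<integral>z. 1 - pos z (N - 1) \<partial>gap_law)" using expectation_last_gap by (simp only: m_def)
    also have "\<dots> = (\<integral>z. 1 \<partial>gap_law) - (\<integral>z. pos z (N - 1) \<partial>gap_law)"
      using N_ge_2 by (intro Bochner_Integration.integral_diff pos_integrable) auto
    also have "(\<integral>z. 1 \<partial>gap_law) = (1 :: real)" by (simp add: Q.prob_space)
    finally show ?thesis using lin[of "N - 1"] N_ge_2 by simp
  qed
  then have "m = 1 / real N" using N_ge_2 by (simp add: field_simps of_nat_diff)
  then show ?thesis using lin[OF assms] by simp
qed

subsection \<open>Log-concavity of the gap law\<close>

definition mid_gaps :: "(nat \<Rightarrow> real) \<Rightarrow> (nat \<Rightarrow> real) \<Rightarrow> nat \<Rightarrow> real" where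
  "mid_gaps x y = (\<lambda>i\<in>{1..<N}. (x i + y i) / 2)"

lemma pos_midpoint: "j < N \<Longrightarrow> pos (mid_gaps x y) j = (pos x j + pos y j) / 2"
  by (simp add: mid_gaps_def pos_def)

lemma midpoint_chamber: "x \<in> chamber \<Longrightarrow> y \<in> chamber \<Longrightarrow> mid_gaps x y \<in> chamber"
  unfolding mid_gaps_def by (rule chamber_midpoint)

text \<open>The weight is absorbed into the three functions. It vanishes off the chamber, so only
  configurations in the chamber have to be compared, and both sides carry the same power of
  \<open>part_fun\<close>.\<close>

theorem gap_law_prekopa:
  assumes [measurable]: "f \<in> borel_measurable gaps" "g \<in> borel_measurable gaps"
      "h \<in> borel_measurable gaps"
    and le: "\<And>x y. x \<in> chamber \<Longrightarrow> y \<in> chamber \<Longrightarrow>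
      f x * g y * ennreal (weight x * weight y) \<le> (h (mid_gaps x y))\<^sup>2 * ennreal ((weight (mid_gaps x y))\<^sup>2)"
  shows "(integral\<^sup>N gap_law f) * (integral\<^sup>N gap_law g) \<le> (integral\<^sup>N gap_law h)\<^sup>2"
proof -
  let ?M = "gap_vol"
  have "(\<integral>\<^sup>+ z. f z * ennreal (weight z) \<partial>?M) * (\<integral>\<^sup>+ z. g z * ennreal (weight z) \<partial>?M)
      \<le> (\<integral>\<^sup>+ z. h z * ennreal (weight z) \<partial>?M)\<^sup>2"
  proof (rule prekopa_leindler_midpoint)
    fix x y :: "nat \<Rightarrow> real"
    have "f x * ennreal (weight x) * (g y * ennreal (weight y)) = f x * g y * ennreal (weight x * weight y)"
      by (simp add: ennreal_mult weight_nonneg mult_ac)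
    also have "\<dots> \<le> (h (mid_gaps x y))\<^sup>2 * ennreal ((weight (mid_gaps x y))\<^sup>2)"
      using le[of x y] by (cases "x \<in> chamber"; cases "y \<in> chamber") (simp_all add: weight_def)
    finally show "f x * ennreal (weight x) * (g y * ennreal (weight y))
        \<le> (h (\<lambda>i\<in>{1..<N}. (x i + y i) / 2) * ennreal (weight (\<lambda>i\<in>{1..<N}. (x i + y i) / 2)))\<^sup>2"
      by (simp add: power_mult_distrib ennreal_power weight_nonneg mid_gaps_def)
  qed (simp, measurable)
  then have "(\<integral>\<^sup>+ z. f z * ennreal (weight z) \<partial>?M) * (\<integral>\<^sup>+ z. g z * ennreal (weight z) \<partial>?M) * (inverse part_fun)\<^sup>2
      \<le> (\<integral>\<^sup>+ z. h z * ennreal (weight z) \<partial>?M)\<^sup>2 * (inverse part_fun)\<^sup>2"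
    by (rule mult_right_mono) simp
  then show ?thesis
    by (simp add: nn_integral_gap_law divide_ennreal_def power2_eq_square mult_ac)
qed

abbreviation gap_cost :: "(nat \<Rightarrow> real) \<Rightarrow> (nat \<Rightarrow> real) \<Rightarrow> nat \<Rightarrow> nat \<Rightarrow> real" where
  "gap_cost x y j i \<equiv> s * (s + 1) / 4 * ((pos x j - pos x i) - (pos y j - pos y i))\<^sup>2
    / max (pos x j - pos x i) (pos y j - pos y i) powr (s + 2)"

text \<open>Positions are affine in \<open>z\<close>: every gap of the midpoint configuration is the
  midpoint of the two gaps, so the defects of the pairs add up.\<close>

theorem energy_midpoint_gap:
  assumes x: "x \<in> chamber" and y: "y \<in> chamber"
  shows "real N powr (- s) * (\<Sum>j<N. \<Sum>i<j. gap_cost x y j i)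
    \<le> riesz_H s N (pos x) + riesz_H s N (pos y) - 2 * riesz_H s N (pos (mid_gaps x y))"
proof -
  let ?m = "mid_gaps x y"
  have mid: "pos ?m j - pos ?m i = ((pos x j - pos x i) + (pos y j - pos y i)) / 2" if "i < j" "j < N" for i j
  proof -
    have "i < N" using that by simp
    then show ?thesis by (simp only: pos_midpoint[OF that(2)] pos_midpoint) argo
  qed
  have "(\<Sum>j<N. \<Sum>i<j. gap_cost x y j i)
    \<le> (\<Sum>j<N. \<Sum>i<j. riesz_pair s (pos x j - pos x i) + riesz_pair s (pos y j - pos y i)
        - 2 * riesz_pair s (pos ?m j - pos ?m i))"
  proof (intro sum_mono)
    fix j i assume "j \<in> {..<N}" "i \<in> {..<j}"
    then have ij: "i < j" "j < N" by auto
    show "gap_cost x y j i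
      \<le> riesz_pair s (pos x j - pos x i) + riesz_pair s (pos y j - pos y i) - 2 * riesz_pair s (pos ?m j - pos ?m i)"
      unfolding mid[OF ij]
      by (rule riesz_pair_midpoint_gap[OF s_pos s_less_1 pos_gap[OF x ij] pos_gap[OF y ij]])
  qed
  then have "real N powr (- s) * (\<Sum>j<N. \<Sum>i<j. gap_cost x y j i)
    \<le> real N powr (- s) * (\<Sum>j<N. \<Sum>i<j. riesz_pair s (pos x j - pos x i) + riesz_pair s (pos y j - pos y i)
        - 2 * riesz_pair s (pos ?m j - pos ?m i))"
    by (rule mult_left_mono) simp
  also have "\<dots> = riesz_H s N (pos x) + riesz_H s N (pos y) - 2 * riesz_H s N (pos ?m)"
    unfolding riesz_H_pos[OF x] riesz_H_pos[OF y] riesz_H_pos[OF midpoint_chamber[OF x y]]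
    by (simp only: sum.distrib sum_subtractf sum_distrib_left[symmetric] algebra_simps)
  finally show ?thesis .
qed

lemma energy_midpoint_convex:
  assumes x: "x \<in> chamber" and y: "y \<in> chamber"
  shows "0 \<le> riesz_H s N (pos x) + riesz_H s N (pos y) - 2 * riesz_H s N (pos (mid_gaps x y))"
  by (rule order_trans[OF _ energy_midpoint_gap[OF x y]])
    (use s_pos in \<open>intro mult_nonneg_nonneg sum_nonneg divide_nonneg_nonneg; simp\<close>)

lemma weight_log_concave:
  assumes x: "x \<in> chamber" and y: "y \<in> chamber"
  shows "weight x * weight y \<le> (weight (mid_gaps x y))\<^sup>2"
proof -
  have "\<beta> * (2 * riesz_H s N (pos (mid_gaps x y)))
      \<le> \<beta> * (riesz_H s N (pos x) + riesz_H s N (pos y))"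
    using energy_midpoint_convex[OF x y] beta_pos by (intro mult_left_mono) auto
  then show ?thesis
    using x y midpoint_chamber[OF x y]
    by (simp add: weight_pos exp_add[symmetric] power2_eq_square algebra_simps)
qed

end

subsection \<open>Log-concave tails\<close>

text \<open>Log-concavity makes the ratio of consecutive terms nonincreasing, so an initial ratio of
  at most 1/2 persists. Once a term vanishes, monotonicity replaces the quotient.\<close>

lemma log_concave_seq_decay:
  fixes a :: "nat \<Rightarrow> real"
  assumes nonneg: "\<And>n. 0 \<le> a n" and anti: "\<And>n. a (Suc n) \<le> a n"
    and lc: "\<And>n. a (Suc (Suc n)) * a n \<le> (a (Suc n))\<^sup>2" and half: "a 1 \<le> a 0 / 2"
  shows "a n \<le> a 0 / 2 ^ n"
proof -
  have step: "a (Suc n) \<le> a n / 2" for n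
  proof (induction n)
    case (Suc n)
    show ?case
    proof (cases "a n = 0")
      case True
      then show ?thesis using anti[of n] anti[of "Suc n"] nonneg[of "Suc n"] nonneg[of "Suc (Suc n)"] by simp
    next
      case False
      then have pos: "0 < a n" using nonneg[of n] by simp
      have "a (Suc (Suc n)) * a n \<le> a (Suc n) * (a n / 2)"
        using lc[of n] mult_left_mono[OF Suc nonneg[of "Suc n"]] by (simp add: power2_eq_square)
      then have "a (Suc (Suc n)) * a n \<le> a (Suc n) / 2 * a n" by simp
      then show ?thesis using pos by (simp only: mult_le_cancel_right_pos)
    qed
  qed (use half in \<open>simp add: One_nat_def\<close>)
  show ?thesis
  proof (induction n)
    case (Suc n)
    have "a (Suc n) \<le> a n / 2" by (rule step)
    also have "\<dots> \<le> (a 0 / 2 ^ n) / 2" using Suc by (rule divide_right_mono) simp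
    finally show ?case by (simp add: mult.commute)
  qed simp
qed

lemma sum_square_over_power2: "(\<Sum>n=1..L. (real n)\<^sup>2 / 2 ^ n) = 6 - ((real L)\<^sup>2 + 4 * real L + 6) / 2 ^ L"
  by (induction L) (simp_all add: field_simps power2_eq_square)

text \<open>A layer-cake bound in integer steps that converts tails into moments. Cubes occur
  because \<open>s + 2\<close> is below 3; the factor 7 lets \<open>7 * (m + 1)\<^sup>2\<close>
  dominate the increment \<open>3 * m\<^sup>2 + 9 * m + 7\<close>, with equality at
  \<open>m = 0\<close>.\<close>

lemma powr_le_cubic_layers:
  fixes y p :: real
  assumes "0 \<le> y" "y \<le> real L" "0 \<le> p" "p \<le> 3"
  shows "y powr p \<le> 1 + (\<Sum>n=1..L. 7 * (real n)\<^sup>2 * (if real n \<le> y then 1 else 0))"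
proof -
  define m where "m = nat \<lfloor>y\<rfloor>"
  have m: "real m \<le> y" "y < real m + 1" using assms(1) by (simp_all add: m_def)
  have mL: "m \<le> L" using m(1) assms(2) by linarith
  have cube: "(real m + 1) ^ 3 \<le> 1 + (\<Sum>n=1..m. 7 * (real n)\<^sup>2)" for m :: nat
  proof (induction m)
    case (Suc m)
    have "(real (Suc m) + 1) ^ 3 = (real m + 1) ^ 3 + (3 * (real m)\<^sup>2 + 9 * real m + 7)"
      by (simp add: power2_eq_square power3_eq_cube algebra_simps)
    also have "\<dots> \<le> (real m + 1) ^ 3 + 7 * (real (Suc m))\<^sup>2"
      by (simp add: power2_eq_square algebra_simps)
    finally show ?case using Suc by simp
  qed simp
  have "y powr p \<le> (real m + 1) powr p" using m assms by (intro powr_mono2) auto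
  also have "\<dots> \<le> (real m + 1) powr 3" using assms by (intro powr_mono) auto
  also have "\<dots> = (real m + 1) ^ 3" using powr_realpow[of "real m + 1" 3] by simp
  also have "\<dots> \<le> 1 + (\<Sum>n=1..m. 7 * (real n)\<^sup>2)" by (rule cube)
  also have "(\<Sum>n=1..m. 7 * (real n)\<^sup>2) = (\<Sum>n=1..m. 7 * (real n)\<^sup>2 * (if real n \<le> y then 1 else 0))"
  proof (intro sum.cong refl)
    fix n assume "n \<in> {1..m}"
    then have "real n \<le> y" using m(1) by simp
    then show "7 * (real n)\<^sup>2 = 7 * (real n)\<^sup>2 * (if real n \<le> y then 1 else 0)" by simp
  qed
  also have "\<dots> \<le> (\<Sum>n=1..L. 7 * (real n)\<^sup>2 * (if real n \<le> y then 1 else 0))"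
    using mL by (intro sum_mono2) auto
  finally show ?thesis by simp
qed

context riesz_gas
begin

lemmas [simp del] = sets_gap_law sets_gibbs

lemma prob_midpoint_log_concave:
  assumes [measurable]: "Measurable.pred gap_law A" "Measurable.pred gap_law B" "Measurable.pred gap_law C"
    and mid: "\<And>x y. x \<in> chamber \<Longrightarrow> y \<in> chamber \<Longrightarrow> A x \<Longrightarrow> B y \<Longrightarrow> C (mid_gaps x y)"
  shows "\<P>(z in gap_law. A z) * \<P>(z in gap_law. B z)
    \<le> (\<P>(z in gap_law. C z))\<^sup>2"
proof -
  have [measurable]: "Measurable.pred gaps A" "Measurable.pred gaps B"
    "Measurable.pred gaps C"
    using assms(1-3) by (simp_all cong: measurable_cong_sets)
  have ind: "(\<integral>\<^sup>+ z. indicator {z. P z} z \<partial>gap_law) = ennreal (\<P>(z in gap_law. P z))"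
    if [measurable]: "Measurable.pred gap_law P" for P
  proof -
    have "(\<integral>\<^sup>+ z. indicator {z. P z} z \<partial>gap_law) = (\<integral>\<^sup>+ z. indicator {z \<in> space gap_law. P z} z \<partial>gap_law)"
      by (intro nn_integral_cong) (auto simp: indicator_def)
    then show ?thesis by (simp add: Q.emeasure_eq_measure)
  qed
  have "(\<integral>\<^sup>+ z. indicator {z. A z} z \<partial>gap_law) * (\<integral>\<^sup>+ z. indicator {z. B z} z \<partial>gap_law)
      \<le> (\<integral>\<^sup>+ z. indicator {z. C z} z \<partial>gap_law)\<^sup>2"
  proof (rule gap_law_prekopa)
    fix x y assume xy: "x \<in> chamber" "y \<in> chamber"
    show "indicator {z. A z} x * indicator {z. B z} y * ennreal (weight x * weight y)
      \<le> (indicator {z. C z} (mid_gaps x y))\<^sup>2 * ennreal ((weight (mid_gaps x y))\<^sup>2)"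
      using mid[OF xy] weight_log_concave[OF xy] by (auto simp: indicator_def intro: ennreal_leI)
  qed measurable
  then have "ennreal (\<P>(z in gap_law. A z) * \<P>(z in gap_law. B z))
      \<le> ennreal ((\<P>(z in gap_law. C z))\<^sup>2)"
    by (simp add: ind ennreal_mult ennreal_power)
  then show ?thesis by (subst (asm) ennreal_le_iff) auto
qed

text \<open>Midpoints of configurations at levels \<open>n\<close> and \<open>n + 2\<close> are at
  level \<open>n + 1\<close>, so the tail probabilities are a log-concave sequence. The real factor
  \<sigma> covers both signs and any scaling.\<close>

lemma linear_tail_decay:
  assumes k: "k < N" and h: "0 \<le> h"
    and half: "\<P>(z in gap_law. t + h \<le> \<sigma> * pos z k)
      \<le> \<P>(z in gap_law. t \<le> \<sigma> * pos z k) / 2"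
  shows "\<P>(z in gap_law. t + real n * h \<le> \<sigma> * pos z k) \<le> 1 / 2 ^ n"
proof -
  note [measurable] = pos_measurable[OF k]
  define a where "a n = \<P>(z in gap_law. t + real n * h \<le> \<sigma> * pos z k)" for n
  have "a n \<le> a 0 / 2 ^ n"
  proof (rule log_concave_seq_decay)
    fix n
    show "0 \<le> a n" by (simp add: a_def)
    show "a (Suc n) \<le> a n" unfolding a_def
      using h by (intro Q.finite_measure_mono) (auto simp: algebra_simps)
    show "a (Suc (Suc n)) * a n \<le> (a (Suc n))\<^sup>2" unfolding a_def
    proof (rule prob_midpoint_log_concave)
      fix x y assume "t + real (Suc (Suc n)) * h \<le> \<sigma> * pos x k" "t + real n * h \<le> \<sigma> * pos y k"
      then show "t + real (Suc n) * h \<le> \<sigma> * pos (mid_gaps x y) k"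
        using k by (simp add: pos_midpoint algebra_simps)
    qed measurable
    show "a 1 \<le> a 0 / 2" using half by (simp add: a_def)
  qed
  also have "\<dots> \<le> 1 / 2 ^ n" by (intro divide_right_mono) (auto simp: a_def)
  finally show ?thesis by (simp add: a_def)
qed

text \<open>Markov's inequality at twice the mean gives the initial halving, counted from level 0,
  which has probability 1.\<close>

lemma gap_tail:
  assumes k: "1 \<le> k" "k < N"
  shows "\<P>(z in gap_law. real n * (2 * real k) \<le> real N * pos z k) \<le> 1 / 2 ^ n"
proof -
  note [measurable] = pos_measurable[OF k(2)]
  have N0: "0 < N" using N_ge_2 by simp
  have "\<P>(z in gap_law. 2 * real k \<le> real N * pos z k)
      \<le> (\<integral>z. real N * pos z k \<partial>gap_law) / (2 * real k)"
  proof (rule integral_Markov_inequality_measure[where A="{}"])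
    show "AE z in gap_law. 0 \<le> real N * pos z k" using pos_bounds_AE[OF k(2)] by eventually_elim simp
  qed (use k in \<open>auto intro!: pos_integrable\<close>)
  also have "\<dots> = 1 / 2" using expectation_pos[OF k(2)] k N0 by simp
  finally have "\<P>(z in gap_law. 0 + 2 * real k \<le> real N * pos z k)
      \<le> \<P>(z in gap_law. 0 \<le> real N * pos z k) / 2"
  proof -
    assume "\<P>(z in gap_law. 2 * real k \<le> real N * pos z k) \<le> 1 / 2"
    moreover have "\<P>(z in gap_law. 0 \<le> real N * pos z k) = 1"
      using pos_bounds_AE[OF k(2)] by (subst Q.prob_Collect_eq_1) (auto elim: eventually_mono)
    ultimately show ?thesis by simp
  qed
  from linear_tail_decay[OF k(2) _ this, of n] show ?thesis by simp
qed

theorem gap_moment: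
  assumes k: "1 \<le> k" "k < N"
  shows "(\<integral>z. (real N * pos z k) powr (s + 2) \<partial>gap_law) \<le> 344 * real k powr (s + 2)"
proof -
  note [measurable] = pos_measurable[OF k(2)]
  \<comment> \<open>Scaled so that the tail at \<open>n\<close> is at most \<open>1 / 2 ^ n\<close>.
    The crude bound \<open>Y \<le> N\<close> reduces the layers to a finite sum.\<close>
  define Y where "Y z = real N * pos z k / (2 * real k)" for z
  have [measurable]: "Y \<in> borel_measurable gap_law" unfolding Y_def by measurable
  have Ybd: "AE z in gap_law. 0 \<le> Y z \<and> Y z \<le> real N"
    using pos_bounds_AE[OF k(2)]
  proof eventually_elim
    case (elim z)
    have "real N * pos z k \<le> real N * 1" using elim by (intro mult_left_mono) auto
    moreover have "real N * 1 \<le> real N * (2 * real k)" using k by (intro mult_left_mono) auto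
    ultimately show ?case using elim k by (simp add: Y_def divide_le_eq)
  qed
  let ?g = "\<lambda>z. 1 + (\<Sum>n=1..N. 7 * (real n)\<^sup>2 * indicator {z \<in> space gap_law. real n \<le> Y z} z)"
  have int_ind: "integrable gap_law (indicator {z \<in> space gap_law. real n \<le> Y z} :: _ \<Rightarrow> real)" for n
    by (rule integrable_real_indicator) (auto simp: Q.emeasure_eq_measure)
  have "(\<integral>z. Y z powr (s + 2) \<partial>gap_law) \<le> (\<integral>z. ?g z \<partial>gap_law)"
  proof (rule integral_mono_AE)
    show "integrable gap_law (\<lambda>z. Y z powr (s + 2))"
    proof (rule Q.integrable_const_bound[of _ "real N powr (s + 2)"])
      show "AE z in gap_law. norm (Y z powr (s + 2)) \<le> real N powr (s + 2)"
        using Ybd by eventually_elim (use s_pos in \<open>auto intro: powr_mono2\<close>)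
    qed measurable
    show "integrable gap_law ?g" by (intro Bochner_Integration.integrable_add Bochner_Integration.integrable_sum
        integrable_mult_right int_ind Q.integrable_const)
    show "AE z in gap_law. Y z powr (s + 2) \<le> ?g z"
      using Ybd AE_space
    proof eventually_elim
      case (elim z)
      have "Y z powr (s + 2) \<le> 1 + (\<Sum>n=1..N. 7 * (real n)\<^sup>2 * (if real n \<le> Y z then 1 else 0))"
        using elim s_pos s_less_1 by (intro powr_le_cubic_layers) auto
      then show ?case using elim by (simp add: indicator_def of_bool_def)
    qed
  qed
  also have "\<dots> = 1 + (\<Sum>n=1..N. 7 * (real n)\<^sup>2 * \<P>(z in gap_law. real n \<le> Y z))"
  proof -
    let ?t = "\<lambda>n z. 7 * (real n)\<^sup>2 * indicator {z \<in> space gap_law. real n \<le> Y z} z :: real"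
    have i: "integrable gap_law (?t n)" for n by (intro integrable_mult_right int_ind)
    have "(\<integral>z. ?g z \<partial>gap_law) = (\<integral>z. 1 \<partial>gap_law) + (\<integral>z. (\<Sum>n=1..N. ?t n z) \<partial>gap_law)"
      by (intro Bochner_Integration.integral_add Q.integrable_const Bochner_Integration.integrable_sum i)
    also have "(\<integral>z. (\<Sum>n=1..N. ?t n z) \<partial>gap_law) = (\<Sum>n=1..N. \<integral>z. ?t n z \<partial>gap_law)"
      by (intro Bochner_Integration.integral_sum i)
    finally show ?thesis by (simp add: Q.prob_space)
  qed
  also have "\<dots> \<le> 1 + (\<Sum>n=1..N. 7 * (real n)\<^sup>2 * (1 / 2 ^ n))"
  proof (intro add_left_mono sum_mono mult_left_mono)
    fix n
    have "real n \<le> Y z \<longleftrightarrow> real n * (2 * real k) \<le> real N * pos z k" for z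
      using k by (simp add: Y_def le_divide_eq)
    then show "\<P>(z in gap_law. real n \<le> Y z) \<le> 1 / 2 ^ n"
      using gap_tail[OF k, of n] by simp
  qed simp
  also have "\<dots> = 1 + 7 * (\<Sum>n=1..N. (real n)\<^sup>2 / 2 ^ n)" by (simp add: sum_distrib_left)
  \<comment> \<open>\<open>43 = 1 + 7 * 6\<close>, where 6 bounds the sum of
    \<open>n\<^sup>2 / 2 ^ n\<close>.\<close>
  also have "\<dots> \<le> 43" unfolding sum_square_over_power2 by simp
  finally have Y43: "(\<integral>z. Y z powr (s + 2) \<partial>gap_law) \<le> 43" .
  have "(\<integral>z. (real N * pos z k) powr (s + 2) \<partial>gap_law) = (\<integral>z. (2 * real k) powr (s + 2) * Y z powr (s + 2) \<partial>gap_law)"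
  proof (rule integral_cong_AE)
    show "AE z in gap_law. (real N * pos z k) powr (s + 2) = (2 * real k) powr (s + 2) * Y z powr (s + 2)"
      using Ybd
    proof eventually_elim
      case (elim z)
      have "real N * pos z k = 2 * real k * Y z" using k by (simp add: Y_def)
      then show ?case using elim by (simp only: powr_mult)
    qed
  qed measurable
  also have "\<dots> = (2 * real k) powr (s + 2) * (\<integral>z. Y z powr (s + 2) \<partial>gap_law)" by simp
  also have "\<dots> \<le> (2 * real k) powr (s + 2) * 43" using Y43 by (intro mult_left_mono) auto
  also have "(2 * real k) powr (s + 2) = 2 powr (s + 2) * real k powr (s + 2)" by (simp add: powr_mult)
  also have "\<dots> * 43 \<le> 344 * real k powr (s + 2)"
  proof -
    \<comment> \<open>Undoing the scaling costs at most 8, and \<open>8 * 43 = 344\<close>.\<close>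
    have "(2::real) powr (s + 2) \<le> 2 powr 3" using s_less_1 by (intro powr_mono) auto
    then have "(2::real) powr (s + 2) \<le> 8" by simp
    then show ?thesis using mult_right_mono[of "2 powr (s + 2)" 8 "real k powr (s + 2)"] by (simp add: mult.commute)
  qed
  finally show ?thesis .
qed

end

subsection \<open>Decomposing a long gap into all shorter ones\<close>

definition pairs :: "nat \<Rightarrow> (nat \<times> nat) set" where
  "pairs k = Sigma {..k} (\<lambda>j. {..<j})"

lemma mem_pairs: "(j, i) \<in> pairs k \<longleftrightarrow> i < j \<and> j \<le> k"
  by (auto simp: pairs_def)

lemma finite_pairs [simp]: "finite (pairs k)"
  by (simp add: pairs_def)

lemma sum_pairs: "(\<Sum>(j, i)\<in>pairs k. f j i) = (\<Sum>j\<le>k. \<Sum>i<j. f j i)"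
  unfolding pairs_def by (rule sum.Sigma[symmetric]) auto

lemma sum_pairs_reflect: "(\<Sum>(j, i)\<in>pairs k. f j i) = (\<Sum>(j, i)\<in>pairs k. f (k - i) (k - j))"
  by (rule sum.reindex_bij_witness[of _ "\<lambda>(j, i). (k - i, k - j)" "\<lambda>(j, i). (k - i, k - j)"])
    (auto simp: mem_pairs)

text \<open>Passing from the mean of \<open>u 0, ..., u (j - 1)\<close> to the mean of
  \<open>u 0, ..., u j\<close> adds the sum of \<open>(u j - u i) / (j * (j + 1))\<close> over
  \<open>i < j\<close>. These increments telescope.\<close>

lemma sum_pairs_mean:
  fixes u :: "nat \<Rightarrow> real"
  shows "(\<Sum>(j, i)\<in>pairs k. (u j - u i) / (real j * (real j + 1))) = (\<Sum>i\<le>k. u i) / (real k + 1) - u 0"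
  unfolding sum_pairs
proof (induction k)
  case (Suc k)
  have "(\<Sum>i<Suc k. (u (Suc k) - u i) / (real (Suc k) * (real (Suc k) + 1)))
      = ((real k + 1) * u (Suc k) - (\<Sum>i\<le>k. u i)) / ((real k + 1) * (real k + 2))"
    by (simp add: sum_divide_distrib[symmetric] sum_subtractf lessThan_Suc_atMost add.commute)
  also have "\<dots> = ((\<Sum>i\<le>k. u i) + u (Suc k)) / (real k + 2) - (\<Sum>i\<le>k. u i) / (real k + 1)"
    by (simp add: divide_simps) (simp add: algebra_simps)
  finally show ?case using Suc by (simp add: add.commute)
qed simp

text \<open>The current of the network on the vertices 0 to \<open>k\<close>. It uses pairs of all
  lengths, which keeps the dissipation at order \<open>k powr s\<close>; a current through nearest
  neighbours alone would dissipate \<open>k\<close>, and one through the single pair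
  \<open>(k, 0)\<close> would dissipate \<open>k powr (s + 2)\<close>.\<close>

definition flow :: "nat \<Rightarrow> nat \<Rightarrow> nat \<Rightarrow> real" where
  "flow k j i = 1 / (real j * (real j + 1)) + 1 / (real (k - i) * (real (k - i) + 1))"

text \<open>Each half of the flow compares an endpoint with the mean of all the positions.\<close>

lemma flow_decomposition:
  fixes u :: "nat \<Rightarrow> real"
  shows "(\<Sum>(j, i)\<in>pairs k. flow k j i * (u j - u i)) = u k - u 0"
proof -
  define v where "v i = u (k - i)" for i
  have "(\<Sum>i\<le>k. v i) = (\<Sum>i\<le>k. u i)"
    unfolding v_def by (rule sum.reindex_bij_witness[of _ "\<lambda>i. k - i" "\<lambda>i. k - i"]) auto
  moreover have "(\<Sum>(j, i)\<in>pairs k. (u j - u i) / (real (k - i) * (real (k - i) + 1)))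
      = (\<Sum>(j, i)\<in>pairs k. (u (k - i) - u (k - j)) / (real j * (real j + 1)))"
    by (subst sum_pairs_reflect) (intro sum.cong, auto simp: mem_pairs)
  moreover have "\<dots> = - (\<Sum>(j, i)\<in>pairs k. (v j - v i) / (real j * (real j + 1)))"
    unfolding sum_negf[symmetric] v_def by (intro sum.cong) (auto simp: diff_divide_distrib)
  ultimately have "(\<Sum>(j, i)\<in>pairs k. (u j - u i) / (real (k - i) * (real (k - i) + 1)))
      = u k - (\<Sum>i\<le>k. u i) / (real k + 1)"
    unfolding sum_pairs_mean by (simp add: v_def)
  moreover have "(\<Sum>(j, i)\<in>pairs k. flow k j i * (u j - u i))
      = (\<Sum>(j, i)\<in>pairs k. (u j - u i) / (real j * (real j + 1)))
        + (\<Sum>(j, i)\<in>pairs k. (u j - u i) / (real (k - i) * (real (k - i) + 1)))"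
    unfolding sum.distrib[symmetric] by (intro sum.cong) (auto simp: flow_def algebra_simps add_divide_distrib)
  ultimately show ?thesis by (simp add: sum_pairs_mean)
qed

text \<open>Comparison with the increments of \<open>t powr s / s\<close> through the mean value
  theorem. The first term is separate because this power is not differentiable at 0.\<close>

lemma sum_powr_le:
  fixes s :: real
  assumes s: "0 < s" "s < 1"
  shows "(\<Sum>j=1..k. real j powr (s - 1)) \<le> real k powr s / s"
proof (induction k)
  case (Suc k)
  have "real (Suc k) powr (s - 1) \<le> (real (Suc k) powr s - real k powr s) / s"
  proof (cases "k = 0")
    case False
    have "\<exists>\<xi>>real k. \<xi> < real (Suc k) \<and> real (Suc k) powr s - real k powr s = (real (Suc k) - real k) * (s * \<xi> powr (s - 1))"
    proof (rule MVT2)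
      show "real k < real (Suc k)" by simp
      show "((\<lambda>t. t powr s) has_real_derivative s * t powr (s - 1)) (at t)" if "real k \<le> t" for t
        using that False by (auto intro!: derivative_eq_intros)
    qed
    then obtain \<xi> where xi: "real k < \<xi>" "\<xi> < real (Suc k)" "real (Suc k) powr s - real k powr s = s * \<xi> powr (s - 1)"
      by auto
    have "real (Suc k) powr (s - 1) \<le> \<xi> powr (s - 1)"
      using xi(1,2) s by (intro powr_mono2') auto
    then show ?thesis using xi(3) s by simp
  qed (use s in simp)
  then show ?case using Suc s by (simp add: diff_divide_distrib)
qed simp

text \<open>Each of the \<open>j\<close> pairs with larger index \<open>j\<close> contributes at
  most \<open>j powr (s + 2) / j ^ 4\<close>, together \<open>j powr (s - 1)\<close>.\<close>

lemma sum_pairs_powr_le: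
  fixes s :: real
  assumes s: "0 < s" "s < 1"
  shows "(\<Sum>(j, i)\<in>pairs k. (1 / (real j * (real j + 1)))\<^sup>2 * real (j - i) powr (s + 2)) \<le> real k powr s / s"
proof -
  have "(\<Sum>i<j. (1 / (real j * (real j + 1)))\<^sup>2 * real (j - i) powr (s + 2)) \<le> (if j = 0 then 0 else real j powr (s - 1))" for j
  proof (cases "j = 0")
    case False
    have "(\<Sum>i<j. (1 / (real j * (real j + 1)))\<^sup>2 * real (j - i) powr (s + 2))
        \<le> (\<Sum>i<j. (1 / (real j * real j))\<^sup>2 * real j powr (s + 2))"
      using False s by (intro sum_mono mult_mono power_mono powr_mono2 divide_left_mono) auto
    also have "\<dots> = real j * (1 / (real j * real j))\<^sup>2 * real j powr (s + 2)" by simp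
    also have "\<dots> = real j powr (s + 2) / real j powr 3"
      using False by (simp add: powr_realpow[of "real j" 3, simplified] power2_eq_square power3_eq_cube)
    also have "\<dots> = real j powr (s - 1)" by (subst powr_diff[symmetric]) simp
    finally show ?thesis using False by simp
  qed simp
  then have "(\<Sum>(j, i)\<in>pairs k. (1 / (real j * (real j + 1)))\<^sup>2 * real (j - i) powr (s + 2))
      \<le> (\<Sum>j\<le>k. if j = 0 then 0 else real j powr (s - 1))"
    unfolding sum_pairs by (rule sum_mono)
  also have "\<dots> = (\<Sum>j=1..k. real j powr (s - 1))"
    by (rule sum.mono_neutral_cong_right) auto
  finally show ?thesis using sum_powr_le[OF s, of k] by linarith
qed

text \<open>The square of a sum of two terms is at most twice the sum of their squares, and the two
  halves of the flow are reflections of each other; hence the factor 4.\<close>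

lemma sum_flow_powr_le:
  fixes s :: real
  assumes s: "0 < s" "s < 1"
  shows "(\<Sum>(j, i)\<in>pairs k. (flow k j i)\<^sup>2 * real (j - i) powr (s + 2)) \<le> 4 * real k powr s / s"
proof -
  let ?a = "\<lambda>j i. (1 / (real j * (real j + 1)))\<^sup>2 * real (j - i) powr (s + 2)"
  have sq: "(a + b)\<^sup>2 \<le> 2 * (a\<^sup>2 + b\<^sup>2)" for a b :: real
    using zero_le_power2[of "a - b"] by (simp add: power2_eq_square algebra_simps)
  have "(\<Sum>(j, i)\<in>pairs k. (flow k j i)\<^sup>2 * real (j - i) powr (s + 2))
      \<le> (\<Sum>(j, i)\<in>pairs k. 2 * ?a j i + 2 * ?a (k - i) (k - j))"
  proof (rule sum_mono, clarify)
    fix j i assume "(j, i) \<in> pairs k"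
    then have "k - i - (k - j) = j - i" by (auto simp: mem_pairs)
    moreover have "(flow k j i)\<^sup>2 * real (j - i) powr (s + 2)
      \<le> 2 * ((1 / (real j * (real j + 1)))\<^sup>2 + (1 / (real (k - i) * (real (k - i) + 1)))\<^sup>2) * real (j - i) powr (s + 2)"
      unfolding flow_def by (intro mult_right_mono sq) auto
    ultimately show "(flow k j i)\<^sup>2 * real (j - i) powr (s + 2) \<le> 2 * ?a j i + 2 * ?a (k - i) (k - j)"
      by (simp add: algebra_simps)
  qed
  also have "\<dots> = 2 * (\<Sum>(j, i)\<in>pairs k. ?a j i) + 2 * (\<Sum>(j, i)\<in>pairs k. ?a (k - i) (k - j))"
    by (simp add: split_beta' sum.distrib sum_distrib_left)
  also have "(\<Sum>(j, i)\<in>pairs k. ?a (k - i) (k - j)) = (\<Sum>(j, i)\<in>pairs k. ?a j i)"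
    by (rule sum_pairs_reflect[symmetric])
  finally show ?thesis using sum_pairs_powr_le[OF s, of k] by simp
qed

subsection \<open>Concentration of the gaps\<close>

context riesz_gas
begin

text \<open>The dissipation of \<open>flow\<close> when the resistance of a pair is given by its
  actual gap in units of \<open>1 / N\<close>. It acts as a random variance of
  \<open>real N * pos z k\<close>.\<close>

definition roughness :: "nat \<Rightarrow> (nat \<Rightarrow> real) \<Rightarrow> real" where
  "roughness k z = (\<Sum>(j, i)\<in>pairs k. (flow k j i)\<^sup>2 * (real N * (pos z j - pos z i)) powr (s + 2))"

lemma roughness_nonneg: "0 \<le> roughness k z"
  unfolding roughness_def by (rule sum_nonneg) auto

lemma roughness_measurable [measurable]:
  assumes k: "k < N"
  shows "roughness k \<in> borel_measurable gap_law"
  unfolding roughness_def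
proof (rule borel_measurable_sum, clarify)
  fix j i assume "(j, i) \<in> pairs k"
  then have [measurable]: "(\<lambda>z. pos z j) \<in> borel_measurable gap_law" "(\<lambda>z. pos z i) \<in> borel_measurable gap_law"
    using k by (auto simp: mem_pairs)
  show "(\<lambda>z. (flow k j i)\<^sup>2 * (real N * (pos z j - pos z i)) powr (s + 2)) \<in> borel_measurable gap_law"
    by measurable
qed

lemma gap_powr_integrable:
  assumes "i < j" "j < N"
  shows "integrable gap_law (\<lambda>z. (real N * (pos z j - pos z i)) powr (s + 2))"
proof -
  have [measurable]: "(\<lambda>z. pos z j) \<in> borel_measurable gap_law" "(\<lambda>z. pos z i) \<in> borel_measurable gap_law"
    using assms by auto
  show ?thesis
  proof (rule Q.integrable_const_bound[of _ "real N powr (s + 2)"])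
    show "AE z in gap_law. norm ((real N * (pos z j - pos z i)) powr (s + 2)) \<le> real N powr (s + 2)"
      using AE_gap_law
    proof eventually_elim
      case (elim z)
      have "real N * (pos z j - pos z i) \<le> real N * 1"
        using pos_gap[OF elim assms] by (intro mult_left_mono) auto
      then show ?case using pos_gap[OF elim assms] s_pos by (auto intro!: powr_mono2)
    qed
  qed measurable
qed

lemma roughness_integrable:
  assumes k: "k < N"
  shows "integrable gap_law (roughness k)"
  unfolding roughness_def
proof (rule Bochner_Integration.integrable_sum, clarify)
  fix j i assume "(j, i) \<in> pairs k"
  then have "i < j" "j < N" using k by (auto simp: mem_pairs)
  then show "integrable gap_law (\<lambda>z. (flow k j i)\<^sup>2 * (real N * (pos z j - pos z i)) powr (s + 2))"
    by (intro integrable_mult_right gap_powr_integrable)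
qed

text \<open>By stationarity each pair has the moment of a gap of order \<open>j - i\<close>, with
  constant 344; the flow contributes 4, and \<open>344 * 4 = 1376\<close>.\<close>

theorem expectation_roughness:
  assumes k: "k < N"
  shows "(\<integral>z. roughness k z \<partial>gap_law) \<le> 1376 * real k powr s / s"
proof -
  have "(\<integral>z. roughness k z \<partial>gap_law)
      = (\<Sum>p\<in>pairs k. \<integral>z. (case p of (j, i) \<Rightarrow> (flow k j i)\<^sup>2 * (real N * (pos z j - pos z i)) powr (s + 2)) \<partial>gap_law)"
    unfolding roughness_def
  proof (rule Bochner_Integration.integral_sum, clarify)
    fix j i assume "(j, i) \<in> pairs k"
    then have "i < j" "j < N" using k by (auto simp: mem_pairs)
    then show "integrable gap_law (\<lambda>z. (flow k j i)\<^sup>2 * (real N * (pos z j - pos z i)) powr (s + 2))"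
      by (intro integrable_mult_right gap_powr_integrable)
  qed
  also have "\<dots> \<le> (\<Sum>(j, i)\<in>pairs k. 344 * ((flow k j i)\<^sup>2 * real (j - i) powr (s + 2)))"
  proof (rule sum_mono, clarify)
    fix j i assume "(j, i) \<in> pairs k"
    then have ij: "i < j" "j < N" using k by (auto simp: mem_pairs)
    have "(\<integral>z. (real N * (pos z j - pos z i)) powr (s + 2) \<partial>gap_law) = (\<integral>z. (real N * pos z (j - i)) powr (s + 2) \<partial>gap_law)"
      by (rule expectation_gap_shift[OF _ _ ij]) auto
    also have "\<dots> \<le> 344 * real (j - i) powr (s + 2)" using ij by (intro gap_moment) auto
    finally have "(flow k j i)\<^sup>2 * (\<integral>z. (real N * (pos z j - pos z i)) powr (s + 2) \<partial>gap_law)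
        \<le> (flow k j i)\<^sup>2 * (344 * real (j - i) powr (s + 2))" by (rule mult_left_mono) simp
    then show "(\<integral>z. (flow k j i)\<^sup>2 * (real N * (pos z j - pos z i)) powr (s + 2) \<partial>gap_law)
        \<le> 344 * ((flow k j i)\<^sup>2 * real (j - i) powr (s + 2))"
      by (simp add: mult_ac)
  qed
  also have "\<dots> = 344 * (\<Sum>(j, i)\<in>pairs k. (flow k j i)\<^sup>2 * real (j - i) powr (s + 2))"
    by (simp add: split_beta' sum_distrib_left)
  also have "\<dots> \<le> 344 * (4 * real k powr s / s)"
    by (intro mult_left_mono sum_flow_powr_le s_pos s_less_1) simp
  finally show ?thesis by simp
qed

text \<open>Cauchy--Schwarz along the flow, weighted by the power of the longer gap of each pair:
  one factor is the convexity defect, the other a dissipation. The maximum is then bounded by a sum,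
  so that the dissipation separates into a function of \<open>x\<close> and a function of
  \<open>y\<close>.\<close>

theorem energy_controls_gap:
  assumes x: "x \<in> chamber" and y: "y \<in> chamber" and k: "k < N"
  shows "s * (s + 1) / 4 * (real N * pos x k - real N * pos y k)\<^sup>2
    \<le> (roughness k x + roughness k y) *
      (riesz_H s N (pos x) + riesz_H s N (pos y) - 2 * riesz_H s N (pos (mid_gaps x y)))"
proof -
  define E where "E = riesz_H s N (pos x) + riesz_H s N (pos y) - 2 * riesz_H s N (pos (mid_gaps x y))"
  define dx where "dx p = real N * (pos x (fst p) - pos x (snd p))" for p
  define dy where "dy p = real N * (pos y (fst p) - pos y (snd p))" for p
  define m where "m p = max (dx p) (dy p) powr (s + 2)" for p
  define th where "th p = flow k (fst p) (snd p)" for p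
  let ?P = "Sigma {..<N} (\<lambda>j. {..<j})" and ?c = "s * (s + 1) / 4"
  let ?S = "\<lambda>P. \<Sum>p\<in>P. (dx p - dy p)\<^sup>2 / m p"
  have N0: "0 < real N" using N_ge_2 by simp
  have dpos: "0 < dx p" "0 < dy p" if "p \<in> ?P" for p
  proof -
    have "snd p < fst p" "fst p < N" using that by auto
    then show "0 < dx p" "0 < dy p" using pos_gap(1)[OF x] pos_gap(1)[OF y] N0 by (auto simp: dx_def dy_def)
  qed
  have sub: "pairs k \<subseteq> ?P" using k by (auto simp: pairs_def)
  have mpos: "0 < m p" if "p \<in> ?P" for p
    using dpos[OF that] by (simp add: m_def)
  \<comment> \<open>The prefactor \<open>N powr (- s)\<close> of the energy is exactly what makes
    the cost of a pair invariant when lengths are multiplied by \<open>N\<close>, so the constants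
    do not depend on \<open>N\<close>.\<close>
  have scale: "real N powr (- s) * (c * (a - b)\<^sup>2 / max a b powr (s + 2))
      = c * ((real N * a - real N * b)\<^sup>2 / max (real N * a) (real N * b) powr (s + 2))"
    if "0 < a" "0 < b" for a b c
  proof -
    have "max (real N * a) (real N * b) = real N * max a b" using N0 by (simp add: max_mult_distrib_left)
    moreover have "(real N * max a b) powr (s + 2) = real N powr (s + 2) * max a b powr (s + 2)"
      using that N0 by (simp add: powr_mult)
    moreover have "real N powr (s + 2) = real N powr s * (real N)\<^sup>2"
      using N0 by (simp add: powr_add powr_realpow[of "real N" 2, simplified])
    moreover have "(real N * a - real N * b)\<^sup>2 = (real N)\<^sup>2 * (a - b)\<^sup>2"
      by (simp add: power_mult_distrib[symmetric] algebra_simps)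
    ultimately show ?thesis using N0 by (simp add: powr_minus field_simps)
  qed
  have "?c * ?S ?P
      = real N powr (- s) * (\<Sum>(j, i)\<in>?P. gap_cost x y j i)"
    unfolding sum_distrib_left
  proof (rule sum.cong[OF refl])
    fix p assume "p \<in> ?P"
    then obtain j i where p: "p = (j, i)" "i < j" "j < N" by auto
    show "?c * ((dx p - dy p)\<^sup>2 / m p)
      = real N powr (- s) * (case p of (j, i) \<Rightarrow> gap_cost x y j i)"
      unfolding p(1) prod.case
      by (subst scale) (simp_all only: pos_gap(1)[OF x p(2,3)] pos_gap(1)[OF y p(2,3)] dx_def dy_def m_def fst_conv snd_conv)
  qed
  also have "\<dots> \<le> E"
    using energy_midpoint_gap[OF x y] by (subst (asm) sum.Sigma) (auto simp: E_def)
  finally have E1: "?c * ?S ?P \<le> E" .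
  \<comment> \<open>Pairs reaching beyond \<open>k\<close> are dropped; their costs are
    nonnegative.\<close>
  have "?S (pairs k) \<le> ?S ?P"
    using mpos sub by (intro sum_mono2) (auto simp: less_imp_le)
  then have "?c * ?S (pairs k)
      \<le> ?c * ?S ?P"
    using s_pos by (intro mult_left_mono) auto
  with E1 have E2: "?c * ?S (pairs k) \<le> E" by linarith
  have fl: "real N * pos z k = (\<Sum>p\<in>pairs k. th p * (real N * (pos z (fst p) - pos z (snd p))))" for z
  proof -
    have "real N * pos z k = real N * (\<Sum>(j, i)\<in>pairs k. flow k j i * (pos z j - pos z i))"
      unfolding flow_decomposition by simp
    also have "\<dots> = (\<Sum>p\<in>pairs k. th p * (real N * (pos z (fst p) - pos z (snd p))))"
      by (simp add: sum_distrib_left split_beta' th_def mult_ac)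
    finally show ?thesis .
  qed
  have "(real N * pos x k - real N * pos y k) = (\<Sum>p\<in>pairs k. th p * (dx p - dy p))"
    unfolding fl sum_subtractf[symmetric] by (intro sum.cong) (auto simp: dx_def dy_def algebra_simps)
  also have "\<dots> = (\<Sum>p\<in>pairs k. (th p * sqrt (m p)) * ((dx p - dy p) / sqrt (m p)))"
    using mpos sub by (intro sum.cong) (force simp: less_imp_neq[symmetric])+
  finally have "(real N * pos x k - real N * pos y k)\<^sup>2
      \<le> (\<Sum>p\<in>pairs k. (th p * sqrt (m p))\<^sup>2) * (\<Sum>p\<in>pairs k. ((dx p - dy p) / sqrt (m p))\<^sup>2)"
    using Cauchy_Schwarz_ineq_sum[of "\<lambda>p. th p * sqrt (m p)" "\<lambda>p. (dx p - dy p) / sqrt (m p)" "pairs k"] by simp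
  also have "(\<Sum>p\<in>pairs k. ((dx p - dy p) / sqrt (m p))\<^sup>2) = ?S (pairs k)"
    using mpos sub by (intro sum.cong) (auto simp: power_divide less_imp_le subset_iff m_def)
  finally have cs0: "(real N * pos x k - real N * pos y k)\<^sup>2
      \<le> (\<Sum>p\<in>pairs k. (th p * sqrt (m p))\<^sup>2) * ?S (pairs k)" .
  have rough: "(\<Sum>p\<in>pairs k. (th p * sqrt (m p))\<^sup>2) \<le> roughness k x + roughness k y"
  proof -
    have "(\<Sum>p\<in>pairs k. (th p * sqrt (m p))\<^sup>2) \<le> (\<Sum>p\<in>pairs k. (th p)\<^sup>2 * dx p powr (s + 2) + (th p)\<^sup>2 * dy p powr (s + 2))"
    proof (rule sum_mono)
      fix p
      have "m p \<le> dx p powr (s + 2) + dy p powr (s + 2)" by (simp add: m_def max_def)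
      moreover have "0 \<le> m p" by (simp add: m_def)
      ultimately show "(th p * sqrt (m p))\<^sup>2 \<le> (th p)\<^sup>2 * dx p powr (s + 2) + (th p)\<^sup>2 * dy p powr (s + 2)"
        by (simp add: power_mult_distrib distrib_left[symmetric] mult_left_mono)
    qed
    also have "\<dots> = roughness k x + roughness k y"
      by (simp add: roughness_def split_beta' sum.distrib th_def dx_def dy_def)
    finally show ?thesis .
  qed
  have cs: "(real N * pos x k - real N * pos y k)\<^sup>2
      \<le> (roughness k x + roughness k y) * ?S (pairs k)"
    by (rule order_trans[OF cs0 mult_right_mono[OF rough]]) (auto intro!: sum_nonneg simp: m_def)
  have "?c * (real N * pos x k - real N * pos y k)\<^sup>2
      \<le> ?c * ((roughness k x + roughness k y) * ?S (pairs k))"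
    using s_pos cs by (intro mult_left_mono) auto
  also have "\<dots> = (roughness k x + roughness k y) * (?c * ?S (pairs k))"
    by (simp add: mult_ac)
  also have "\<dots> \<le> (roughness k x + roughness k y) * E"
    using E2 roughness_nonneg by (intro mult_left_mono add_nonneg_nonneg) auto
  finally show ?thesis by (simp add: E_def)
qed

end

section \<open>Exponential moments and tails of the gaps\<close>

context riesz_gas
begin

text \<open>The reciprocal of \<open>4 * \<beta> * (s * (s + 1) / 4)\<close>, the coefficient for
  which completing the square in \<open>weight_exp_gap\<close> produces exactly the bound of
  \<open>energy_controls_gap\<close>.\<close>

definition subgauss :: real where
  "subgauss = 1 / (s * (s + 1) * \<beta>)"

lemma subgauss_pos: "0 < subgauss"
  using s_pos beta_pos by (simp add: subgauss_def)

text \<open>Maximised over \<open>l\<close>, the expression \<open>l * D - a * l\<^sup>2 * r\<close>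
  equals \<open>D\<^sup>2 / (4 * a * r)\<close>, which is at most \<open>\<beta> * E\<close> by
  \<open>energy_controls_gap\<close>. The gain of the weight at the midpoint therefore pays for both
  exponentials. If \<open>r = 0\<close>, the same control forces \<open>D = 0\<close>.\<close>

lemma weight_exp_gap:
  assumes x: "x \<in> chamber" and y: "y \<in> chamber" and k: "k < N"
  shows "exp (l * (real N * pos x k) - subgauss * l\<^sup>2 * roughness k x)
      * exp (- l * (real N * pos y k) - subgauss * l\<^sup>2 * roughness k y) * (weight x * weight y)
    \<le> (weight (mid_gaps x y))\<^sup>2"
proof -
  define a where "a = subgauss"
  define D where "D = real N * pos x k - real N * pos y k"
  define r where "r = roughness k x + roughness k y"
  define E where "E = riesz_H s N (pos x) + riesz_H s N (pos y) - 2 * riesz_H s N (pos (mid_gaps x y))"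
  define c where "c = s * (s + 1) / 4"
  have c: "0 < c" using s_pos by (simp add: c_def)
  have a: "0 < a" "4 * a * (c * \<beta>) = 1"
    using subgauss_pos s_pos beta_pos by (auto simp: a_def c_def subgauss_def)
  have r0: "0 \<le> r" using roughness_nonneg by (simp add: r_def)
  have E0: "0 \<le> E" using energy_midpoint_convex[OF x y] by (simp add: E_def)
  have cD: "c * D\<^sup>2 \<le> r * E" using energy_controls_gap[OF x y k] by (simp add: c_def D_def r_def E_def)
  have key: "l * D - a * l\<^sup>2 * r \<le> \<beta> * E"
  proof (cases "r = 0")
    case True
    then have "D = 0" using cD c by (simp add: mult_le_0_iff)
    then show ?thesis using True E0 beta_pos by simp
  next
    case False
    then have "0 < r" using r0 by simp
    have "0 \<le> (2 * a * l * r - D)\<^sup>2 / (4 * a)" using a by simp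
    also have "\<dots> = a * l\<^sup>2 * r * r - l * D * r + D\<^sup>2 / (4 * a)"
      using a by (simp add: power2_eq_square field_simps)
    also have "D\<^sup>2 / (4 * a) = \<beta> * (c * D\<^sup>2)"
    proof -
      have "D\<^sup>2 = 4 * a * (\<beta> * (c * D\<^sup>2))" using a(2) by (metis mult.assoc mult.commute mult_1)
      then show ?thesis using a(1) by (metis nonzero_mult_div_cancel_left mult_eq_0_iff less_irrefl zero_neq_numeral)
    qed
    also have "\<dots> \<le> \<beta> * (r * E)" using cD beta_pos by (intro mult_left_mono) auto
    finally have "0 \<le> (a * l\<^sup>2 * r - l * D + \<beta> * E) * r" by (simp add: algebra_simps)
    then show ?thesis using \<open>0 < r\<close> by (simp add: zero_le_mult_iff)
  qed
  have w: "weight x * weight y = exp (- \<beta> * riesz_H s N (pos x) - \<beta> * riesz_H s N (pos y))"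
    "(weight (mid_gaps x y))\<^sup>2 = exp (- \<beta> * (2 * riesz_H s N (pos (mid_gaps x y))))"
    using x y midpoint_chamber[OF x y] by (auto simp: weight_pos exp_add[symmetric] exp_double[symmetric] algebra_simps)
  show ?thesis
    unfolding w exp_add[symmetric] exp_le_cancel_iff
    using key unfolding a_def[symmetric] D_def r_def E_def by (simp add: algebra_simps)
qed

lemma exp_gap_integrable:
  assumes k: "k < N"
  shows "integrable gap_law (\<lambda>z. exp (l * (real N * pos z k) - subgauss * l\<^sup>2 * roughness k z))"
proof -
  note [measurable] = pos_measurable[OF k] roughness_measurable[OF k]
  show ?thesis
  proof (rule Q.integrable_const_bound[of _ "exp (\<bar>l\<bar> * real N)"])
    show "AE z in gap_law. norm (exp (l * (real N * pos z k) - subgauss * l\<^sup>2 * roughness k z)) \<le> exp (\<bar>l\<bar> * real N)"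
      using pos_bounds_AE[OF k]
    proof eventually_elim
      case (elim z)
      have "l * (real N * pos z k) \<le> \<bar>l\<bar> * (real N * pos z k)" using elim by (intro mult_right_mono) auto
      also have "\<dots> \<le> \<bar>l\<bar> * (real N * 1)" using elim by (intro mult_left_mono) auto
      finally have "l * (real N * pos z k) \<le> \<bar>l\<bar> * real N" by simp
      moreover have "0 \<le> subgauss * l\<^sup>2 * roughness k z"
        using subgauss_pos roughness_nonneg by (intro mult_nonneg_nonneg) auto
      ultimately show ?case by simp
    qed
  qed measurable
qed

text \<open>Prekopa--Leindler bounds the product of the moments at \<open>l\<close> and \<open>- l\<close>, and Jensen's inequality
  bounds the second factor from below.\<close>

lemma exp_gap_moment:
  assumes k: "k < N"
  shows "(\<integral>z. exp (l * (real N * pos z k) - subgauss * l\<^sup>2 * roughness k z) \<partial>gap_law)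
    \<le> exp (l * real k + subgauss * l\<^sup>2 * (\<integral>z. roughness k z \<partial>gap_law))"
proof -
  note [measurable] = pos_measurable[OF k] roughness_measurable[OF k]
  define f where "f l z = exp (l * (real N * pos z k) - subgauss * l\<^sup>2 * roughness k z)" for l z
  have fm[measurable]: "f l \<in> borel_measurable gap_law" for l unfolding f_def by measurable
  have fm': "(\<lambda>z. ennreal (f l z)) \<in> borel_measurable gaps" for l
    using measurable_compose[OF fm measurable_ennreal] by (simp add: sets_gap_law cong: measurable_cong_sets)
  have fi: "integrable gap_law (f l)" for l unfolding f_def by (rule exp_gap_integrable[OF k])
  \<comment> \<open>The midpoint function is the constant 1: the convexity defect of the energy has
    absorbed both exponentials.\<close>
  have "(\<integral>\<^sup>+ z. ennreal (f l z) \<partial>gap_law) * (\<integral>\<^sup>+ z. ennreal (f (- l) z) \<partial>gap_law) \<le> (\<integral>\<^sup>+ z. 1 \<partial>gap_law)\<^sup>2"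
  proof (rule gap_law_prekopa)
    fix x y assume xy: "x \<in> chamber" "y \<in> chamber"
    have "f l x * f (- l) y * (weight x * weight y) \<le> (weight (mid_gaps x y))\<^sup>2"
      using weight_exp_gap[OF xy k, of l] by (simp add: f_def)
    then have "ennreal (f l x * f (- l) y * (weight x * weight y)) \<le> ennreal ((weight (mid_gaps x y))\<^sup>2)"
      by (rule ennreal_leI)
    then show "ennreal (f l x) * ennreal (f (- l) y) * ennreal (weight x * weight y)
        \<le> 1\<^sup>2 * ennreal ((weight (mid_gaps x y))\<^sup>2)"
      by (simp add: ennreal_mult f_def weight_nonneg)
  qed (auto intro: fm')
  moreover have "(\<integral>\<^sup>+ z. ennreal (f l z) \<partial>gap_law) = ennreal (\<integral>z. f l z \<partial>gap_law)" for l
    by (rule nn_integral_eq_integral[OF fi]) (simp add: f_def)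
  moreover have "0 \<le> (\<integral>z. f l z \<partial>gap_law)" for l
    by (intro integral_nonneg_AE) (simp add: f_def)
  ultimately have "ennreal ((\<integral>z. f l z \<partial>gap_law) * (\<integral>z. f (- l) z \<partial>gap_law)) \<le> 1"
    by (simp add: Q.emeasure_space_1 ennreal_mult)
  then have prod: "(\<integral>z. f l z \<partial>gap_law) * (\<integral>z. f (- l) z \<partial>gap_law) \<le> 1" by simp
  define \<mu> where "\<mu> = - l * real k - subgauss * l\<^sup>2 * (\<integral>z. roughness k z \<partial>gap_law)"
  define U where "U z = - l * (real N * pos z k) - subgauss * l\<^sup>2 * roughness k z" for z
  have Ui: "integrable gap_law U" unfolding U_def
    by (intro Bochner_Integration.integrable_diff integrable_mult_right pos_integrable roughness_integrable k)
  have N0: "real N > 0" using N_ge_2 by simp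
  have "(\<integral>z. U z \<partial>gap_law) = (\<integral>z. - l * (real N * pos z k) \<partial>gap_law) - (\<integral>z. subgauss * l\<^sup>2 * roughness k z \<partial>gap_law)"
    unfolding U_def
    by (intro Bochner_Integration.integral_diff integrable_mult_right pos_integrable roughness_integrable k)
  also have "\<dots> = \<mu>" using expectation_pos[OF k] N0 by (simp add: \<mu>_def)
  finally have EU: "(\<integral>z. U z \<partial>gap_law) = \<mu>" .
  \<comment> \<open>The tangent of \<open>exp\<close> at \<mu> lies below \<open>exp\<close>, and
    since \<mu> is the mean of \<open>U\<close>, it integrates to \<open>exp \<mu>\<close>.\<close>
  have "exp \<mu> = (\<integral>z. exp \<mu> * (1 + (U z - \<mu>)) \<partial>gap_law)"
    using Ui EU by (simp add: Q.prob_space)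
  also have "\<dots> \<le> (\<integral>z. f (- l) z \<partial>gap_law)"
  proof (rule integral_mono)
    show "integrable gap_law (\<lambda>z. exp \<mu> * (1 + (U z - \<mu>)))" using Ui by auto
    show "integrable gap_law (f (- l))" by (rule fi)
    fix z
    have "exp \<mu> * (1 + (U z - \<mu>)) \<le> exp \<mu> * exp (U z - \<mu>)"
      by (intro mult_left_mono exp_ge_add_one_self) auto
    also have "\<dots> = f (- l) z" by (simp add: exp_add[symmetric] f_def U_def)
    finally show "exp \<mu> * (1 + (U z - \<mu>)) \<le> f (- l) z" .
  qed
  finally have lower: "exp \<mu> \<le> (\<integral>z. f (- l) z \<partial>gap_law)" .
  have "(\<integral>z. f l z \<partial>gap_law) * exp \<mu> \<le> (\<integral>z. f l z \<partial>gap_law) * (\<integral>z. f (- l) z \<partial>gap_law)"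
    using lower by (intro mult_left_mono integral_nonneg_AE) (auto simp: f_def)
  with prod have "(\<integral>z. f l z \<partial>gap_law) * exp \<mu> \<le> 1" by linarith
  then have "(\<integral>z. f l z \<partial>gap_law) \<le> exp (- \<mu>)" by (simp add: exp_minus field_simps)
  then show ?thesis by (simp add: f_def \<mu>_def add.commute)
qed

text \<open>A deviation forces either a roughness of at least eight times \<open>r\<close>, unlikely
  by Markov, or a large value of the penalised exponential \<open>X\<close>, unlikely by
  \<open>exp_gap_moment\<close>. Each has probability at most 1/8.\<close>

lemma gap_quarter_tail:
  assumes k: "k < N" and sg: "\<sigma> = 1 \<or> \<sigma> = - 1" and r: "0 < r" "(\<integral>z. roughness k z \<partial>gap_law) \<le> r"
    and M: "0 < M" "108 * subgauss * r \<le> M\<^sup>2"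
  shows "\<P>(z in gap_law. M \<le> \<sigma> * (real N * pos z k - real k)) \<le> 1 / 4"
proof -
  note [measurable] = pos_measurable[OF k] roughness_measurable[OF k]
  define a where "a = subgauss"
  have a: "0 < a" using subgauss_pos by (simp add: a_def)
  \<comment> \<open>The minimiser of \<open>9 * a * l\<^sup>2 * r - l * M\<close>, where 9 is 8 from
    the cap on the roughness plus 1 from its mean in the moment bound. The minimum is
    \<open>- M\<^sup>2 / (36 * a * r)\<close>, and \<open>108 = 3 * 36\<close> makes it at most -
    3.\<close>
  define l where "l = M / (18 * a * r)"
  have l0: "0 < l" using a r M by (simp add: l_def)
  define X where "X z = exp (\<sigma> * l * (real N * pos z k) - subgauss * (\<sigma> * l)\<^sup>2 * roughness k z)" for z
  define \<tau> where "\<tau> = exp (\<sigma> * l * real k + l * M - 8 * a * l\<^sup>2 * r)"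
  have s2: "(\<sigma> * l)\<^sup>2 = l\<^sup>2" using sg by auto
  have [measurable]: "X \<in> borel_measurable gap_law" unfolding X_def by measurable
  have "\<P>(z in gap_law. 8 * r \<le> roughness k z) \<le> (\<integral>z. roughness k z \<partial>gap_law) / (8 * r)"
    by (rule integral_Markov_inequality_measure[where A="{}"]) (use r roughness_integrable[OF k] roughness_nonneg in auto)
  also have "\<dots> \<le> 1 / 8" using r by (simp add: divide_le_eq)
  finally have R: "\<P>(z in gap_law. 8 * r \<le> roughness k z) \<le> 1 / 8" .
  have "\<P>(z in gap_law. \<tau> \<le> X z) \<le> (\<integral>z. X z \<partial>gap_law) / \<tau>"
    by (rule integral_Markov_inequality_measure[where A="{}"]) (use exp_gap_integrable[OF k, of "\<sigma> * l"] in \<open>auto simp: X_def[abs_def] \<tau>_def\<close>)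
  also have "\<dots> \<le> exp (\<sigma> * l * real k + a * l\<^sup>2 * r) / \<tau>"
  proof (rule divide_right_mono)
    have "(\<integral>z. X z \<partial>gap_law) \<le> exp (\<sigma> * l * real k + subgauss * (\<sigma> * l)\<^sup>2 * (\<integral>z. roughness k z \<partial>gap_law))"
      unfolding X_def by (rule exp_gap_moment[OF k])
    also have "\<dots> \<le> exp (\<sigma> * l * real k + a * l\<^sup>2 * r)"
      unfolding s2 a_def[symmetric] using r a by (simp add: mult_left_mono)
    finally show "(\<integral>z. X z \<partial>gap_law) \<le> exp (\<sigma> * l * real k + a * l\<^sup>2 * r)" .
  qed (simp add: \<tau>_def)
  also have "\<dots> = exp (9 * a * l\<^sup>2 * r - l * M)"
    by (simp add: \<tau>_def exp_diff[symmetric] algebra_simps)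
  also have "\<dots> \<le> exp (- 3)"
  proof -
    have "9 * a * l\<^sup>2 * r - l * M = - (M\<^sup>2 / (36 * a * r))"
      using a r by (simp add: l_def power2_eq_square field_simps)
    also have "\<dots> \<le> - 3" using M(2) a r by (simp add: a_def[symmetric] le_divide_eq mult_ac)
    finally show ?thesis by simp
  qed
  also have "exp (- 3 :: real) \<le> 1 / 8"
  proof -
    have "(2::real) ^ 3 \<le> exp 1 ^ 3" using exp_ge_add_one_self[of 1] by (intro power_mono) auto
    also have "\<dots> = exp 3" by (simp add: exp_of_nat_mult[symmetric])
    finally show ?thesis by (simp add: exp_minus field_simps)
  qed
  finally have T: "\<P>(z in gap_law. \<tau> \<le> X z) \<le> 1 / 8" .
  have "\<P>(z in gap_law. M \<le> \<sigma> * (real N * pos z k - real k))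
      \<le> measure gap_law ({z \<in> space gap_law. 8 * r \<le> roughness k z} \<union> {z \<in> space gap_law. \<tau> \<le> X z})"
  proof (rule Q.finite_measure_mono)
    show "{z \<in> space gap_law. M \<le> \<sigma> * (real N * pos z k - real k)}
        \<subseteq> {z \<in> space gap_law. 8 * r \<le> roughness k z} \<union> {z \<in> space gap_law. \<tau> \<le> X z}"
    proof
      fix z assume z: "z \<in> {z \<in> space gap_law. M \<le> \<sigma> * (real N * pos z k - real k)}"
      have "\<tau> \<le> X z" if "\<not> 8 * r \<le> roughness k z"
      proof -
        have "l * M \<le> l * (\<sigma> * (real N * pos z k - real k))" using z l0 by (intro mult_left_mono) auto
        moreover have "a * l\<^sup>2 * roughness k z \<le> a * l\<^sup>2 * (8 * r)" using that a by (intro mult_left_mono) auto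
        ultimately show ?thesis unfolding \<tau>_def X_def s2 a_def[symmetric] by (simp add: algebra_simps)
      qed
      then show "z \<in> {z \<in> space gap_law. 8 * r \<le> roughness k z} \<union> {z \<in> space gap_law. \<tau> \<le> X z}"
        using z by auto
    qed
  qed measurable
  also have "\<dots> \<le> \<P>(z in gap_law. 8 * r \<le> roughness k z) + \<P>(z in gap_law. \<tau> \<le> X z)"
    by (rule measure_Un_le) measurable
  finally show ?thesis using R T by linarith
qed

text \<open>Across the window from \<open>- M\<close> to \<open>M\<close> the tail falls from at
  least 3/4 to at most 1/4, more than the halving that starts the geometric decay with step
  \<open>2 * M\<close>.\<close>

lemma gap_one_sided_deviation:
  assumes k: "k < N" and sg: "\<sigma> = 1 \<or> \<sigma> = - 1" and r: "0 < r" "(\<integral>z. roughness k z \<partial>gap_law) \<le> r"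
    and M: "0 < M" "108 * subgauss * r \<le> M\<^sup>2" and T: "0 \<le> T"
  shows "\<P>(z in gap_law. T \<le> \<sigma> * (real N * pos z k - real k)) \<le> 2 * exp (- T / (4 * M))"
proof -
  let ?d = "\<lambda>z. \<sigma> * (real N * pos z k - real k)"
  note [measurable] = pos_measurable[OF k]
  have up: "\<P>(z in gap_law. M \<le> ?d z) \<le> 1 / 4"
    by (rule gap_quarter_tail[OF k sg r M])
  have "\<P>(z in gap_law. M \<le> - ?d z) \<le> 1 / 4"
    using gap_quarter_tail[OF k _ r M, of "- \<sigma>"] sg by auto
  moreover have "1 = \<P>(z in gap_law. - M \<le> ?d z)
      + \<P>(z in gap_law. \<not> - M \<le> ?d z)"
    by (subst Q.prob_neg) auto
  moreover have "\<P>(z in gap_law. \<not> - M \<le> ?d z)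
      \<le> \<P>(z in gap_law. M \<le> - ?d z)"
    by (rule Q.finite_measure_mono) (auto simp: algebra_simps)
  ultimately have lo: "3 / 4 \<le> \<P>(z in gap_law. - M \<le> ?d z)" by linarith
  define t where "t = \<sigma> * real k - M"
  have dec: "\<P>(z in gap_law. t + real n * (2 * M) \<le> \<sigma> * real N * pos z k) \<le> 1 / 2 ^ n" for n
  proof (rule linear_tail_decay[OF k])
    have "{z \<in> space gap_law. t + 2 * M \<le> \<sigma> * real N * pos z k} = {z \<in> space gap_law. M \<le> ?d z}"
      "{z \<in> space gap_law. t \<le> \<sigma> * real N * pos z k} = {z \<in> space gap_law. - M \<le> ?d z}"
      by (auto simp: t_def algebra_simps)
    then show "\<P>(z in gap_law. t + 2 * M \<le> \<sigma> * real N * pos z k)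
        \<le> \<P>(z in gap_law. t \<le> \<sigma> * real N * pos z k) / 2"
      using up lo by simp
  qed (use M in simp)
  \<comment> \<open>The largest number of steps \<open>2 * M\<close> that lead from
    \<open>- M\<close> to at most \<open>T\<close>.\<close>
  define n where "n = nat \<lfloor>(T + M) / (2 * M)\<rfloor>"
  have n: "real n \<le> (T + M) / (2 * M)" "(T + M) / (2 * M) < real n + 1"
    using T M by (simp_all add: n_def)
  have "\<P>(z in gap_law. T \<le> ?d z)
      \<le> \<P>(z in gap_law. t + real n * (2 * M) \<le> \<sigma> * real N * pos z k)"
  proof (rule Q.finite_measure_mono)
    have "real n * (2 * M) \<le> T + M" using n(1) M by (simp add: le_divide_eq)
    then show "{z \<in> space gap_law. T \<le> ?d z}
        \<subseteq> {z \<in> space gap_law. t + real n * (2 * M) \<le> \<sigma> * real N * pos z k}"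
      by (auto simp: t_def algebra_simps)
  qed measurable
  also have "\<dots> \<le> 1 / 2 ^ n" by (rule dec)
  also have "\<dots> = exp (- (real n * ln 2))" by (simp add: exp_minus exp_of_nat_mult inverse_eq_divide)
  \<comment> \<open>Rounding down loses one step, which is the factor 2 of the claim;
    \<open>ln 2 \<ge> 1 / 2\<close> turns the step \<open>2 * M\<close> into
    \<open>4 * M\<close>.\<close>
  also have "\<dots> \<le> exp (ln 2 - T / (4 * M))"
  proof -
    have "1 / 2 \<le> ln (2::real)" using ln2_ge_two_thirds by simp
    then have "T / (2 * M) * (1 / 2) \<le> T / (2 * M) * ln 2" using T M by (intro mult_left_mono) auto
    also have "\<dots> \<le> (real n + 1) * ln 2"
    proof (rule mult_right_mono)
      have "T / (2 * M) \<le> (T + M) / (2 * M)" using M by (simp add: divide_right_mono)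
      then show "T / (2 * M) \<le> real n + 1" using n(2) by linarith
    qed simp
    finally show ?thesis by (simp add: algebra_simps)
  qed
  also have "\<dots> = 2 * exp (- T / (4 * M))" by (simp add: exp_diff exp_minus field_simps)
  finally show ?thesis .
qed

text \<open>The square root of \<open>108 * subgauss * 1376 / s\<close>, with
  \<open>148608 = 108 * 1376\<close>. The factor with \<beta> is kept apart, so that the dependence
  on \<beta> stays explicit.\<close>

definition dev_scale :: real where
  "dev_scale = sqrt (148608 / (s\<^sup>2 * (s + 1))) / sqrt \<beta>"

lemma dev_scale_pos: "0 < dev_scale"
  using s_pos beta_pos by (simp add: dev_scale_def)

theorem gap_deviation:
  assumes k: "1 \<le> k" "k < N" and T: "0 \<le> T"
  shows "\<P>(z in gap_law. T \<le> \<bar>real N * pos z k - real k\<bar>)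
    \<le> 4 * exp (- T / (4 * dev_scale * real k powr (s / 2)))"
proof -
  note [measurable] = pos_measurable[OF k(2)]
  define M where "M = dev_scale * real k powr (s / 2)"
  define r where "r = 1376 * real k powr s / s"
  have r: "0 < r" "(\<integral>z. roughness k z \<partial>gap_law) \<le> r"
    using k s_pos expectation_roughness[OF k(2)] by (auto simp: r_def)
  have M0: "0 < M" using k dev_scale_pos by (simp add: M_def)
  have "(real k powr (s / 2))\<^sup>2 = real k powr s"
    using k by (simp add: power2_eq_square powr_add[symmetric])
  then have "M\<^sup>2 = 148608 / (s\<^sup>2 * (s + 1)) / \<beta> * real k powr s"
    using s_pos beta_pos by (simp add: M_def dev_scale_def power_mult_distrib power_divide)
  then have M2: "108 * subgauss * r \<le> M\<^sup>2"
    using s_pos by (simp add: subgauss_def r_def power2_eq_square mult_ac)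
  have "\<P>(z in gap_law. T \<le> \<bar>real N * pos z k - real k\<bar>)
      \<le> measure gap_law ({z \<in> space gap_law. T \<le> 1 * (real N * pos z k - real k)}
        \<union> {z \<in> space gap_law. T \<le> - 1 * (real N * pos z k - real k)})"
    by (rule Q.finite_measure_mono) (auto simp: abs_if split: if_splits)
  also have "\<dots> \<le> \<P>(z in gap_law. T \<le> 1 * (real N * pos z k - real k))
        + \<P>(z in gap_law. T \<le> - 1 * (real N * pos z k - real k))"
    by (rule measure_Un_le) measurable
  also have "\<dots> \<le> 2 * exp (- T / (4 * M)) + 2 * exp (- T / (4 * M))"
    by (intro add_mono gap_one_sided_deviation[OF k(2) _ r M0 M2 T]) auto
  finally show ?thesis by (simp add: M_def mult.assoc)
qed

theorem riesz_prob_gap: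
  assumes i: "i < N" and k: "1 \<le> k" "k < N" and T: "0 \<le> T"
  shows "riesz_prob s \<beta> N {x. \<bar>real N * tdiff (x ((i + k) mod N)) (x i) - real k\<bar> \<le> T}
    \<ge> 1 - 4 * exp (- T / (4 * dev_scale * real k powr (s / 2)))"
proof -
  note [measurable] = pos_measurable[OF k(2)]
  have [measurable]: "(\<lambda>x. x i) \<in> borel_measurable confs"
    "(\<lambda>x. x ((i + k) mod N)) \<in> borel_measurable confs"
    using i N_ge_2 by (auto intro!: measurable_component_singleton)
  let ?d = "\<lambda>x. tdiff (x ((i + k) mod N)) (x i)"
  have m: "Measurable.pred confs (\<lambda>x. \<bar>real N * ?d x - real k\<bar> \<le> T)"
    "Measurable.pred gibbs (\<lambda>x. \<bar>real N * ?d x - real k\<bar> \<le> T)" by measurable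
  have "riesz_prob s \<beta> N {x. \<bar>real N * ?d x - real k\<bar> \<le> T} = \<P>(x in gibbs. \<bar>real N * ?d x - real k\<bar> \<le> T)"
    using m(1) by (subst riesz_prob_eq) (auto simp: pred_def)
  also have "\<dots> = 1 - \<P>(x in gibbs. T < \<bar>real N * ?d x - real k\<bar>)"
    using m(2) P.prob_neg[of "\<lambda>x. \<bar>real N * ?d x - real k\<bar> \<le> T"] by (simp add: pred_def not_le)
  finally have eq: "riesz_prob s \<beta> N {x. \<bar>real N * ?d x - real k\<bar> \<le> T}
      = 1 - \<P>(x in gibbs. T < \<bar>real N * ?d x - real k\<bar>)" .
  have "\<P>(x in gibbs. T < \<bar>real N * ?d x - real k\<bar>)
      = \<P>(z in gap_law. T < \<bar>real N * pos z k - real k\<bar>)"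
  proof -
    let ?G = "\<lambda>t. indicator {t. T < \<bar>real N * t - real k\<bar>} t :: ennreal"
    have "emeasure gibbs {x \<in> space gibbs. T < \<bar>real N * ?d x - real k\<bar>}
        = (\<integral>\<^sup>+ x. indicator {x \<in> space gibbs. T < \<bar>real N * ?d x - real k\<bar>} x \<partial>gibbs)"
      by (rule nn_integral_indicator[symmetric]) measurable
    also have "\<dots> = (\<integral>\<^sup>+ x. ?G (?d x) \<partial>gibbs)"
      by (intro nn_integral_cong) (auto simp: indicator_def)
    also have "\<dots> = (\<integral>\<^sup>+ z. ?G (z k) \<partial>gap_law)"
      by (rule nn_integral_gibbs_arc) (use i k in auto)
    also have "\<dots> = (\<integral>\<^sup>+ z. indicator {z \<in> space gap_law. T < \<bar>real N * pos z k - real k\<bar>} z \<partial>gap_law)"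
      using k by (intro nn_integral_cong) (auto simp: indicator_def pos_pos)
    also have "\<dots> = emeasure gap_law {z \<in> space gap_law. T < \<bar>real N * pos z k - real k\<bar>}"
      by (rule nn_integral_indicator) measurable
    finally show ?thesis by (simp add: measure_def)
  qed
  also have "\<P>(z in gap_law. T < \<bar>real N * pos z k - real k\<bar>)
      \<le> \<P>(z in gap_law. T \<le> \<bar>real N * pos z k - real k\<bar>)"
    by (rule Q.finite_measure_mono) auto
  also have "\<dots> \<le> 4 * exp (- T / (4 * dev_scale * real k powr (s / 2)))"
    by (rule gap_deviation[OF k T])
  finally show ?thesis using eq by simp
qed

end

subsection \<open>Counting points in an arc\<close>

text \<open>Distances are measured from the left end \<open>a - l\<close>. The value 0 is excluded
  because the arc is open, and \<open>l < 1 / 2\<close> makes the arc shorter than the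
  circle.\<close>

lemma in_arc_iff:
  assumes l: "0 < l" "l < 1 / 2"
  shows "in_arc a l y \<longleftrightarrow> 0 < frac (y - (a - l)) \<and> frac (y - (a - l)) < 2 * l"
proof
  assume "in_arc a l y"
  then obtain m :: int where m: "\<bar>y - a - real_of_int m\<bar> < l" by (auto simp: in_arc_def)
  have "frac (y - (a - l)) = y - (a - l) - real_of_int m"
    using m l by (subst frac_unique_iff) auto
  then show "0 < frac (y - (a - l)) \<and> frac (y - (a - l)) < 2 * l" using m by auto
next
  assume "0 < frac (y - (a - l)) \<and> frac (y - (a - l)) < 2 * l"
  then have "\<bar>y - a - real_of_int \<lfloor>y - (a - l)\<rfloor>\<bar> < l" by (auto simp: frac_def)
  then show "in_arc a l y" by (auto simp: in_arc_def)
qed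

lemma nn_integral_circle_frac_less:
  fixes K :: ennreal
  assumes w: "0 < w" "w \<le> 1"
  shows "(\<integral>\<^sup>+ c. indicator {t. t < w} (frac (b + c)) * K \<partial>circle_measure) = ennreal w * K"
proof -
  have "(\<integral>\<^sup>+ c. indicator {t. t < w} (frac (b + c)) * K \<partial>circle_measure)
      = (\<integral>\<^sup>+ c. indicator {t. t < w} (frac (b + c)) \<partial>circle_measure) * K"
    by (rule nn_integral_multc) measurable
  also have "(\<integral>\<^sup>+ c. indicator {t. t < w} (frac (b + c)) \<partial>circle_measure) = (\<integral>\<^sup>+ c. indicator {t. t < w} c \<partial>circle_measure)"
    by (rule nn_integral_circle_rotate) measurable
  also have "\<dots> = (\<integral>\<^sup>+ c. indicator {t. t < w} c * indicator {0..<1} c \<partial>lborel)"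
    by (rule nn_integral_circle_measure) measurable
  also have "\<dots> = (\<integral>\<^sup>+ c. indicator {0..<w} c \<partial>lborel)"
    using w by (intro nn_integral_cong) (auto simp: indicator_def)
  also have "\<dots> = ennreal w" using w by simp
  finally show ?thesis .
qed

context riesz_gas
begin

text \<open>The order of \<open>D_set\<close> with the first two points distinct, but free of the
  constraint to \<open>[0, 1)\<close>. It persists almost surely under every choice of base
  point.\<close>

definition ordered :: "(nat \<Rightarrow> real) \<Rightarrow> bool" where
  "ordered x \<longleftrightarrow> (\<forall>j\<in>{1..<N}. tdiff (x (j - 1)) (x 0) < tdiff (x j) (x 0))"

lemma component_measurable:
  "j < N \<Longrightarrow> (\<lambda>x. x j) \<in> borel_measurable confs"
  by (rule measurable_component_singleton) auto

lemma ordered_measurable [measurable]: "Measurable.pred confs ordered"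
proof -
  have [measurable]: "(\<lambda>x. x 0) \<in> borel_measurable confs"
    using N_ge_2 by (intro component_measurable) auto
  have [measurable]: "j \<in> {1..<N} \<Longrightarrow> (\<lambda>x. x (j - 1)) \<in> borel_measurable confs"
    "j \<in> {1..<N} \<Longrightarrow> (\<lambda>x. x j) \<in> borel_measurable confs" for j
    by (auto intro!: component_measurable)
  show ?thesis unfolding ordered_def by measurable
qed

lemma ordered_less:
  assumes x: "ordered x" and "i < j" "j < N"
  shows "tdiff (x i) (x 0) < tdiff (x j) (x 0)"
  using assms(2,3)
proof (induction j)
  case (Suc j)
  have "Suc j \<in> {1..<N}" using Suc.prems by auto
  then have step: "tdiff (x j) (x 0) < tdiff (x (Suc j)) (x 0)" using x unfolding ordered_def by fastforce
  show ?case
  proof (cases "i = j")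
    case False
    then have "tdiff (x i) (x 0) < tdiff (x j) (x 0)" using Suc by auto
    with step show ?thesis by linarith
  qed (use step in simp)
qed simp

lemma tdiff_config_0:
  assumes z: "z \<in> chamber" and j: "j < N"
  shows "tdiff (config c z j) (config c z 0) = pos z j"
  using tdiff_config[of 0 j c z] j pos_nonneg[OF z j] pos_less_1[OF z j]
  by (simp add: pos_def[symmetric] frac_eq)

lemma AE_gibbs_ordered: "AE x in gibbs. ordered x"
proof (rule AE_gibbsI)
  fix c :: real and z assume z: "z \<in> chamber"
  show "ordered (config c z)"
    unfolding ordered_def
  proof
    fix j assume "j \<in> {1..<N}"
    then have "j - 1 < j" "j < N" "j - 1 < N" by auto
    then show "tdiff (config c z (j - 1)) (config c z 0) < tdiff (config c z j) (config c z 0)"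
      using pos_less[OF z, of "j - 1" j] by (simp add: tdiff_config_0[OF z])
  qed
qed measurable

lemma AE_gibbs_ordered_shift: "AE x in gibbs. ordered (shift i x)"
proof -
  have "(\<integral>\<^sup>+ x. indicator {x. \<not> ordered x} (shift i x) \<partial>gibbs) = (\<integral>\<^sup>+ x. indicator {x. \<not> ordered x} x \<partial>gibbs)"
    by (rule nn_integral_gibbs_shift) measurable
  also have "\<dots> = (\<integral>\<^sup>+ x. 0 \<partial>gibbs)"
    by (rule nn_integral_cong_AE, use AE_gibbs_ordered in eventually_elim) (simp add: indicator_def)
  finally have "(\<integral>\<^sup>+ x. indicator {x. \<not> ordered x} (shift i x) \<partial>gibbs) = 0" by simp
  then have "AE x in gibbs. indicator {x. \<not> ordered x} (shift i x) = (0 :: ennreal)"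
    by (subst (asm) nn_integral_0_iff_AE) auto
  then show ?thesis by eventually_elim (auto simp: indicator_def split: if_splits)
qed

text \<open>\<open>y 0\<close> is the first point met from \<open>b\<close>: the way from
  \<open>b\<close> to \<open>y 0\<close> is shorter than the closing arc from
  \<open>y (N - 1)\<close> to \<open>y 0\<close>, so \<open>b\<close> lies in that arc.\<close>

definition starts_at :: "real \<Rightarrow> (nat \<Rightarrow> real) \<Rightarrow> bool" where
  "starts_at b y \<longleftrightarrow> frac (y 0 - b) < 1 - tdiff (y (N - 1)) (y 0)"

lemma frac_from_start:
  assumes y: "ordered y" "starts_at b y" and j: "j < N"
  shows "frac (y j - b) = frac (y 0 - b) + tdiff (y j) (y 0)"
proof -
  have "j = N - 1 \<or> j < N - 1" using j by auto
  then have "tdiff (y j) (y 0) \<le> tdiff (y (N - 1)) (y 0)"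
    using ordered_less[OF y(1), of j "N - 1"] N_ge_2 by auto
  then have "frac (y 0 - b) + frac (y j - y 0) < 1"
    using y(2) by (simp add: starts_at_def tdiff_def)
  then show ?thesis using frac_add[of "y 0 - b" "y j - y 0"] by (simp add: tdiff_def)
qed

text \<open>The point at least distance after \<open>b\<close> qualifies: if \<open>b\<close> were
  not in the arc before it, its predecessor would be closer still.\<close>

lemma exists_start: "\<exists>i<N. starts_at b (shift i x)"
proof -
  obtain i where i: "is_arg_min (\<lambda>i. frac (x i - b)) (\<lambda>i. i \<in> {..<N}) i"
    using ex_is_arg_min_if_finite[of "{..<N}" "\<lambda>i. frac (x i - b)"] N_ge_2 by (auto simp: lessThan_empty_iff)
  then have iN: "i < N" and min: "\<And>j. j < N \<Longrightarrow> frac (x i - b) \<le> frac (x j - b)"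
    by (auto simp: is_arg_min_linorder)
  define y where "y = shift i x"
  have y0: "y 0 = x i" using iN N_ge_2 by (simp add: y_def shift_def)
  have yl: "y (N - 1) = x ((i + (N - 1)) mod N)" using N_ge_2 by (simp add: y_def shift_def)
  have le: "frac (y 0 - b) \<le> frac (y (N - 1) - b)"
    unfolding y0 yl using N_ge_2 by (intro min) auto
  have "frac (y 0 - b) + tdiff (y (N - 1)) (y 0) < 1"
  proof (rule ccontr)
    assume "\<not> ?thesis"
    then have "frac (y (N - 1) - b) = frac (y 0 - b) + tdiff (y (N - 1)) (y 0) - 1"
      using frac_add[of "y 0 - b" "y (N - 1) - y 0"] by (simp add: tdiff_def)
    then show False using le frac_lt_1[of "y (N - 1) - y 0"] by (simp add: tdiff_def)
  qed
  then show ?thesis using iN by (auto simp: starts_at_def y_def)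
qed

definition arc_count :: "real \<Rightarrow> real \<Rightarrow> (nat \<Rightarrow> real) \<Rightarrow> nat" where
  "arc_count a l x = card {i. i < N \<and> in_arc a l (x i)}"

lemma arc_count_shift: "arc_count a l (shift i x) = arc_count a l x"
proof -
  note r = bij_betw_rotate[of i]
  have "bij_betw (\<lambda>j. (i + j) mod N) {j. j < N \<and> in_arc a l (shift i x j)} {j. j < N \<and> in_arc a l (x j)}"
    unfolding bij_betw_def
  proof
    show "inj_on (\<lambda>j. (i + j) mod N) {j. j < N \<and> in_arc a l (shift i x j)}"
      using bij_betw_imp_inj_on[OF r] by (rule inj_on_subset) auto
    have "(\<lambda>j. (i + j) mod N) ` {..<N} = {..<N}" using r by (rule bij_betw_imp_surj_on)
    then show "(\<lambda>j. (i + j) mod N) ` {j. j < N \<and> in_arc a l (shift i x j)} = {j. j < N \<and> in_arc a l (x j)}"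
    proof (intro equalityI subsetI)
      fix j assume j: "j \<in> {j. j < N \<and> in_arc a l (x j)}"
      then obtain j' where "j' < N" "j = (i + j') mod N"
        using \<open>(\<lambda>j. (i + j) mod N) ` {..<N} = {..<N}\<close> by (metis (mono_tags, lifting) imageE lessThan_iff mem_Collect_eq)
      then show "j \<in> (\<lambda>j. (i + j) mod N) ` {j. j < N \<and> in_arc a l (shift i x j)}"
        using j by (auto simp: shift_def)
    qed (use N_ge_2 in \<open>auto simp: shift_def\<close>)
  qed
  then show ?thesis unfolding arc_count_def by (rule bij_betw_same_card)
qed

text \<open>Too many points in the counting arc make \<open>m1\<close> gaps short. Too few make
  \<open>m2 + 1\<close> gaps long: adding the whole closing arc replaces the unknown distance from
  the left end of the counting arc to \<open>y 0\<close>.\<close>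

definition misplaced :: "real \<Rightarrow> nat \<Rightarrow> nat \<Rightarrow> (nat \<Rightarrow> real) \<Rightarrow> bool" where
  "misplaced l m1 m2 y \<longleftrightarrow> tdiff (y m1) (y 0) < 2 * l \<or> 2 * l < tdiff (y m2) (y 0) + (1 - tdiff (y (N - 1)) (y 0))"

lemma arc_count_misplaced:
  assumes y: "ordered y" "starts_at (a - l) y" and l: "0 < l" "l < 1 / 2" and m: "m1 < N" "m2 < N"
    and cnt: "m1 < arc_count a l y \<or> arc_count a l y < m2"
  shows "misplaced l m1 m2 y"
proof -
  define v where "v j = tdiff (y j) (y 0)" for j
  define f where "f = frac (y 0 - (a - l))"
  have f0: "0 \<le> f" "f < 1 - v (N - 1)" using y(2) by (auto simp: f_def v_def starts_at_def)
  have v0: "v 0 = 0" by (simp add: v_def tdiff_def)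
  have vm: "v i < v j" if "i < j" "j < N" for i j using ordered_less[OF y(1) that] by (simp add: v_def)
  define K where "K = {j. j < N \<and> 0 < f + v j \<and> f + v j < 2 * l}"
  have fv: "frac (y j - (a - l)) = f + v j" if "j < N" for j
    using frac_from_start[OF y that] by (simp only: f_def v_def)
  have K: "arc_count a l y = card K"
    unfolding arc_count_def K_def in_arc_iff[OF l]
    by (intro arg_cong[where f=card] Collect_cong conj_cong refl) (simp_all only: fv)
  show ?thesis
  proof (cases "m1 < arc_count a l y")
    case True
    have "v m1 < 2 * l"
    proof (rule ccontr)
      assume "\<not> v m1 < 2 * l"
      then have ge: "2 * l \<le> v m1" by simp
      have "K \<subseteq> {..<m1}"
      proof
        fix j assume j: "j \<in> K"
        show "j \<in> {..<m1}"
        proof (rule ccontr)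
          assume "j \<notin> {..<m1}"
          then have "v m1 \<le> v j" using vm[of m1 j] j by (cases "j = m1") (auto simp: K_def)
          then show False using ge f0 j by (auto simp: K_def)
        qed
      qed
      then have "card K \<le> m1" using card_mono[of "{..<m1}" K] by simp
      then show False using True K by simp
    qed
    then show ?thesis by (simp add: misplaced_def v_def)
  next
    case False
    then have lt: "card K < m2" using cnt K by simp
    have "2 * l \<le> f + v m2"
    proof (rule ccontr)
      assume "\<not> 2 * l \<le> f + v m2"
      then have less: "f + v m2 < 2 * l" by simp
      \<comment> \<open>Index 0 is left out: the base point may sit at the left end itself
        (\<open>f = 0\<close>), which the open arc excludes. The other \<open>m2\<close> indices
        already contradict the count.\<close>
      have "{1..m2} \<subseteq> K"
      proof
        fix j assume j: "j \<in> {1..m2}"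
        then have "0 < v j" using vm[of 0 j] v0 m by auto
        moreover have "v j \<le> v m2" using vm[of j m2] j m by (cases "j = m2") auto
        ultimately show "j \<in> K" using f0 less j m by (auto simp: K_def)
      qed
      then have "card {1..m2} \<le> card K" by (intro card_mono) (auto simp: K_def)
      then show False using lt by simp
    qed
    then have "2 * l < v m2 + (1 - v (N - 1))" using f0 by linarith
    then show ?thesis by (simp add: misplaced_def v_def)
  qed
qed

abbreviation bad_gaps :: "real \<Rightarrow> nat \<Rightarrow> nat \<Rightarrow> (nat \<Rightarrow> real) \<Rightarrow> bool" where
  "bad_gaps l m1 m2 z \<equiv> pos z m1 < 2 * l \<or> 2 * l < pos z m2 + (1 - pos z (N - 1))"

text \<open>For fixed gaps, the uniform first point puts \<open>b\<close> into the closing arc with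
  probability equal to the length of that arc. This is the size bias.\<close>

lemma nn_integral_start:
  assumes m: "m1 < N" "m2 < N"
  shows "(\<integral>\<^sup>+ x. indicator {y. starts_at b y \<and> misplaced l m1 m2 y} x \<partial>gibbs)
    = (\<integral>\<^sup>+ z. ennreal (1 - pos z (N - 1)) * indicator {z. bad_gaps l m1 m2 z} z \<partial>gap_law)"
proof -
  interpret U: prob_space circle_measure by (rule prob_space_circle_measure)
  interpret QU: pair_sigma_finite gap_law circle_measure ..
  have N1: "N - 1 < N" "0 < N" using N_ge_2 by auto
  note [measurable] = pos_measurable[OF m(1)] pos_measurable[OF m(2)] pos_measurable[OF N1(1)]
    component_measurable[OF m(1)] component_measurable[OF m(2)] component_measurable[OF N1(1)] component_measurable[OF N1(2)]
  let ?B = "{z. bad_gaps l m1 m2 z}"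
  have [measurable]: "Measurable.pred confs (\<lambda>y. starts_at b y \<and> misplaced l m1 m2 y)"
    unfolding starts_at_def misplaced_def by measurable
  define g where "g = (\<lambda>(z, c). indicator {t. t < 1 - pos z (N - 1)} (frac (- b + c)) * indicator ?B z :: ennreal)"
  have g[measurable]: "g \<in> borel_measurable (gap_law \<Otimes>\<^sub>M circle_measure)"
    unfolding g_def split_beta' by measurable
  have "(\<integral>\<^sup>+ x. indicator {y. starts_at b y \<and> misplaced l m1 m2 y} x \<partial>gibbs)
      = (\<integral>\<^sup>+ c. (\<integral>\<^sup>+ z. indicator {y. starts_at b y \<and> misplaced l m1 m2 y} (config c z) \<partial>gap_law) \<partial>circle_measure)"
    by (rule nn_integral_gibbs) measurable
  also have "\<dots> = (\<integral>\<^sup>+ c. (\<integral>\<^sup>+ z. g (z, c) \<partial>gap_law) \<partial>circle_measure)"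
  proof (rule nn_integral_cong, rule nn_integral_cong_AE, use AE_gap_law in eventually_elim)
    fix c z assume z: "z \<in> chamber"
    have "frac (config c z 0 - b) = frac (- b + c)"
      using N1 by (simp add: config_def frac_frac_diff_left add.commute)
    then show "indicator {y. starts_at b y \<and> misplaced l m1 m2 y} (config c z) = g (z, c)"
      using m N1 by (simp add: g_def starts_at_def misplaced_def tdiff_config_0[OF z] indicator_def)
  qed
  also have "\<dots> = (\<integral>\<^sup>+ z. (\<integral>\<^sup>+ c. g (z, c) \<partial>circle_measure) \<partial>gap_law)"
    by (rule QU.Fubini) (rule g)
  also have "\<dots> = (\<integral>\<^sup>+ z. ennreal (1 - pos z (N - 1)) * indicator ?B z \<partial>gap_law)"
  proof (rule nn_integral_cong_AE, use AE_gap_law in eventually_elim)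
    fix z assume z: "z \<in> chamber"
    have "0 < 1 - pos z (N - 1)" "1 - pos z (N - 1) \<le> 1"
      using pos_less_1[OF z N1(1)] pos_nonneg[OF z N1(1)] by auto
    then show "(\<integral>\<^sup>+ c. g (z, c) \<partial>circle_measure) = ennreal (1 - pos z (N - 1)) * indicator ?B z"
      unfolding g_def prod.case by (rule nn_integral_circle_frac_less)
  qed
  finally show ?thesis .
qed

lemma arc_count_measurable [measurable]:
  assumes l: "0 < l" "l < 1 / 2"
  shows "(\<lambda>x. real (arc_count a l x)) \<in> borel_measurable confs"
proof -
  let ?t = "\<lambda>i x. indicator {x. 0 < frac (x i - (a - l)) \<and> frac (x i - (a - l)) < 2 * l} x :: real"
  have "real (arc_count a l x) = (\<Sum>i<N. ?t i x)" for x
  proof -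
    have "(\<Sum>i<N. ?t i x)
        = (\<Sum>i\<in>{i. i < N \<and> in_arc a l (x i)}. 1)"
      by (rule sum.mono_neutral_cong_right) (auto simp: indicator_def in_arc_iff[OF l])
    then show ?thesis by (simp add: arc_count_def)
  qed
  moreover have "(\<lambda>x. \<Sum>i<N. ?t i x)
      \<in> borel_measurable confs"
  proof (rule borel_measurable_sum)
    fix i assume "i \<in> {..<N}"
    then have [measurable]: "(\<lambda>x. x i) \<in> borel_measurable confs"
      by (simp add: component_measurable)
    show "(\<lambda>x. ?t i x)
      \<in> borel_measurable confs"
      by measurable
  qed
  ultimately show ?thesis by simp
qed

text \<open>A union bound over the base points. Cyclic invariance makes all terms equal, and the
  resulting factor \<open>N\<close> brings the closing gap to order 1.\<close>

lemma emeasure_arc_count_le: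
  assumes l: "0 < l" "l < 1 / 2" and m: "m1 < N" "m2 < N"
  shows "emeasure gibbs {x \<in> space gibbs. real m1 < real (arc_count a l x) \<or> real (arc_count a l x) < real m2}
    \<le> (\<integral>\<^sup>+ z. ennreal (real N * (1 - pos z (N - 1)))
        * indicator {z. bad_gaps l m1 m2 z} z \<partial>gap_law)"
proof -
  have N1: "N - 1 < N" "0 < N" using N_ge_2 by auto
  note [measurable] = pos_measurable[OF m(1)] pos_measurable[OF m(2)] pos_measurable[OF N1(1)]
    component_measurable[OF m(1)] component_measurable[OF m(2)] component_measurable[OF N1(1)] component_measurable[OF N1(2)]
    arc_count_measurable[OF l]
  let ?A = "{x \<in> space gibbs. real m1 < real (arc_count a l x) \<or> real (arc_count a l x) < real m2}"
  let ?G = "{y. starts_at (a - l) y \<and> misplaced l m1 m2 y}"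
  have G[measurable]: "Measurable.pred confs (\<lambda>y. starts_at (a - l) y \<and> misplaced l m1 m2 y)"
    unfolding starts_at_def misplaced_def by measurable
  have "AE x in gibbs. \<forall>i\<in>{..<N}. ordered (shift i x)"
    by (rule AE_finite_allI) (auto intro: AE_gibbs_ordered_shift)
  then have "(\<integral>\<^sup>+ x. indicator ?A x \<partial>gibbs) \<le> (\<integral>\<^sup>+ x. (\<Sum>i<N. indicator ?G (shift i x)) \<partial>gibbs)"
  proof (intro nn_integral_mono_AE, eventually_elim)
    fix x assume ord: "\<forall>i\<in>{..<N}. ordered (shift i x)"
    show "indicator ?A x \<le> (\<Sum>i<N. indicator ?G (shift i x) :: ennreal)"
    proof (cases "x \<in> ?A")
      case True
      obtain i where i: "i < N" "starts_at (a - l) (shift i x)" using exists_start by blast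
      have "misplaced l m1 m2 (shift i x)"
        by (rule arc_count_misplaced[OF _ i(2) l m]) (use ord i True in \<open>auto simp: arc_count_shift\<close>)
      then have "(1 :: ennreal) \<le> indicator ?G (shift i x)" using i by simp
      also have "\<dots> \<le> (\<Sum>i<N. indicator ?G (shift i x))"
        using i by (intro member_le_sum) auto
      finally show ?thesis using True by simp
    qed simp
  qed
  also have "\<dots> = (\<Sum>i<N. \<integral>\<^sup>+ x. indicator ?G (shift i x) \<partial>gibbs)"
    by (rule nn_integral_sum) measurable
  also have "\<dots> = (\<Sum>i<N. \<integral>\<^sup>+ x. indicator ?G x \<partial>gibbs)"
    by (intro sum.cong refl nn_integral_gibbs_shift) measurable
  also have "\<dots> = ennreal (real N) * (\<integral>\<^sup>+ z. ennreal (1 - pos z (N - 1)) * indicator {z. bad_gaps l m1 m2 z} z \<partial>gap_law)"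
    by (simp add: nn_integral_start[OF m] ennreal_of_nat_eq_real_of_nat)
  also have "\<dots> = (\<integral>\<^sup>+ z. ennreal (real N) * (ennreal (1 - pos z (N - 1)) * indicator {z. bad_gaps l m1 m2 z} z) \<partial>gap_law)"
    by (rule nn_integral_cmult[symmetric]) measurable
  finally have "(\<integral>\<^sup>+ x. indicator ?A x \<partial>gibbs)
      \<le> (\<integral>\<^sup>+ z. ennreal (real N) * (ennreal (1 - pos z (N - 1)) * indicator {z. bad_gaps l m1 m2 z} z) \<partial>gap_law)" .
  moreover have "(\<integral>\<^sup>+ x. indicator ?A x \<partial>gibbs) = emeasure gibbs ?A"
    by (rule nn_integral_indicator) measurable
  ultimately show ?thesis by (simp add: ennreal_mult' mult.assoc)
qed

end

section \<open>Removing the size bias and estimating the count\<close>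

lemma square_le_one_plus_powr:
  fixes y s :: real
  assumes "0 \<le> y" "0 < s"
  shows "y\<^sup>2 \<le> 1 + y powr (s + 2)"
proof (cases "y \<le> 1")
  case True
  then have "y\<^sup>2 \<le> 1" using assms by (simp add: power_le_one)
  then show ?thesis by (simp add: add_increasing2)
next
  case False
  then have "y powr 2 \<le> y powr (s + 2)" using assms by (intro powr_mono) auto
  moreover have "y powr 2 = y\<^sup>2" using False powr_realpow[of y 2] by simp
  ultimately show ?thesis by simp
qed

context riesz_gas
begin

lemma last_gap_moment:
  "(\<integral>\<^sup>+ z. ennreal ((real N * (1 - pos z (N - 1))) powr (s + 2)) \<partial>gap_law) \<le> 344"
proof -
  have N1: "0 + 1 < N" "1 < N" using N_ge_2 by auto
  have "(\<integral>\<^sup>+ z. ennreal ((real N * (1 - pos z (N - 1))) powr (s + 2)) \<partial>gap_law)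
      = (\<integral>\<^sup>+ z. ennreal ((real N * pos z 1) powr (s + 2)) \<partial>gap_law)"
    using nn_integral_arc_across_0[of "\<lambda>t. ennreal ((real N * t) powr (s + 2))", OF _ N1(1)] by simp
  also have "\<dots> = ennreal (\<integral>z. (real N * pos z 1) powr (s + 2) \<partial>gap_law)"
    using gap_powr_integrable[of 0 1] N1 by (intro nn_integral_eq_integral) auto
  also have "\<dots> \<le> ennreal 344" using gap_moment[of 1] N1 by (intro ennreal_leI) simp
  finally show ?thesis by simp
qed

text \<open>The length of the arc around the base point is not bounded, but has bounded second moment:
  AM--GM with weight \<open>q\<close> trades it against the square root of the probability of \<open>B\<close>.\<close>

lemma last_gap_weighted_event:
  assumes [measurable]: "Measurable.pred gap_law B" and q: "0 < q"
    and B: "\<P>(z in gap_law. B z) \<le> q\<^sup>2"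
  shows "(\<integral>\<^sup>+ z. ennreal (real N * (1 - pos z (N - 1))) * indicator {z. B z} z \<partial>gap_law) \<le> ennreal (173 * q)"
proof -
  have N1: "N - 1 < N" using N_ge_2 by auto
  note [measurable] = pos_measurable[OF N1]
  define Y where "Y z = real N * (1 - pos z (N - 1))" for z
  have [measurable]: "Y \<in> borel_measurable gap_law" unfolding Y_def by measurable
  have Y0: "0 \<le> Y z" if "z \<in> chamber" for z
    using pos_less_1[OF that N1] by (simp add: Y_def)
  have amgm: "y \<le> q / 2 * (1 + y powr (s + 2)) + 1 / (2 * q)" if "0 \<le> y" for y
  proof -
    have "0 \<le> (q * y - 1)\<^sup>2 / (2 * q)" using q by simp
    also have "\<dots> = q / 2 * y\<^sup>2 - y + 1 / (2 * q)" using q by (simp add: power2_eq_square field_simps)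
    finally have "y \<le> q / 2 * y\<^sup>2 + 1 / (2 * q)" by simp
    moreover have "q / 2 * y\<^sup>2 \<le> q / 2 * (1 + y powr (s + 2))"
      using q square_le_one_plus_powr[OF that s_pos] by (intro mult_left_mono) auto
    ultimately show ?thesis by linarith
  qed
  have "(\<integral>\<^sup>+ z. ennreal (Y z) * indicator {z. B z} z \<partial>gap_law)
      \<le> (\<integral>\<^sup>+ z. ennreal (q / 2) * (1 + ennreal (Y z powr (s + 2))) + ennreal (1 / (2 * q)) * indicator {z \<in> space gap_law. B z} z \<partial>gap_law)"
  proof (rule nn_integral_mono_AE, use AE_gap_law AE_space in eventually_elim)
    fix z assume z: "z \<in> chamber" "z \<in> space gap_law"
    have "ennreal (Y z) \<le> ennreal (q / 2 * (1 + Y z powr (s + 2)) + 1 / (2 * q))"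
      by (intro ennreal_leI amgm Y0 z)
    also have "\<dots> = ennreal (q / 2) * (1 + ennreal (Y z powr (s + 2))) + ennreal (1 / (2 * q))"
      using q by (subst ennreal_plus, simp, simp, subst ennreal_mult, simp, simp, subst ennreal_plus) auto
    finally show "ennreal (Y z) * indicator {z. B z} z
        \<le> ennreal (q / 2) * (1 + ennreal (Y z powr (s + 2))) + ennreal (1 / (2 * q)) * indicator {z \<in> space gap_law. B z} z"
      using z by (cases "B z") auto
  qed
  also have "\<dots> = ennreal (q / 2) * (1 + (\<integral>\<^sup>+ z. ennreal (Y z powr (s + 2)) \<partial>gap_law))
      + ennreal (1 / (2 * q)) * emeasure gap_law {z \<in> space gap_law. B z}"
    by (simp add: nn_integral_add nn_integral_cmult Q.emeasure_space_1)
  also have "\<dots> \<le> ennreal (q / 2) * (1 + 344) + ennreal (1 / (2 * q)) * ennreal (q\<^sup>2)"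
    using last_gap_moment B unfolding Y_def
    by (intro add_mono mult_left_mono order_refl) (auto simp: Q.emeasure_eq_measure intro: ennreal_leI)
  \<comment> \<open>\<open>345 * q / 2\<close> comes from the moments and \<open>q / 2\<close> from
    the event.\<close>
  also have "\<dots> = ennreal (173 * q)"
  proof -
    have "ennreal (q / 2) * (1 + 344) = ennreal (q / 2 * 345)" using q by (subst ennreal_mult) auto
    moreover have "ennreal (1 / (2 * q)) * ennreal (q\<^sup>2) = ennreal (q / 2)"
      using q by (subst ennreal_mult[symmetric]) (auto simp: power2_eq_square)
    ultimately show ?thesis using q by (simp add: ennreal_plus[symmetric] del: ennreal_plus)
  qed
  finally show ?thesis by (simp add: Y_def)
qed

text \<open>Both defects are deviations of at least \<open>T - 2\<close>: one unit is lost to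
  rounding and, for too few points, another to the additional gap. The indices are at most
  \<open>4 * n\<close>, hence below \<open>N\<close>, and \<open>4 powr (s / 2) \<le> 2\<close>
  turns the 4 of \<open>gap_deviation\<close> into 8.\<close>

lemma misplaced_prob:
  fixes n T l :: real
  assumes n: "n = real N * l" "1 \<le> n" "4 * n < real N" and T: "2 \<le> T" "T \<le> n"
    and m1: "real m1 \<le> 2 * n + T" "2 * n + T < real m1 + 1"
    and m2: "real m2 < 2 * n - T + 1" "2 * n - T \<le> real m2"
  shows "\<P>(z in gap_law. bad_gaps l m1 m2 z)
    \<le> 8 * exp (- (T - 2) / (8 * dev_scale * n powr (s / 2)))"
proof -
  let ?e = "exp (- (T - 2) / (8 * dev_scale * n powr (s / 2)))"
  have N0: "0 < real N" using N_ge_2 by simp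
  have mN: "1 \<le> m1" "m1 < N" "1 \<le> m2 + 1" "m2 + 1 < N" "m2 < N" "N - 1 < N" using n T m1 m2 by linarith+
  note [measurable] = pos_measurable[OF mN(2)] pos_measurable[OF mN(4)] pos_measurable[OF mN(5)] pos_measurable[OF mN(6)]
  have dev: "\<P>(z in gap_law. T - 2 \<le> \<bar>real N * pos z m - real m\<bar>)
      \<le> 4 * ?e"
    if m: "1 \<le> m" "m < N" "real m \<le> 4 * n" for m
  proof -
    have "\<P>(z in gap_law. T - 2 \<le> \<bar>real N * pos z m - real m\<bar>)
        \<le> 4 * exp (- (T - 2) / (4 * dev_scale * real m powr (s / 2)))"
      using T by (intro gap_deviation m) auto
    also have "\<dots> \<le> 4 * ?e"
    proof -
      have "real m powr (s / 2) \<le> (4 * n) powr (s / 2)" using m s_pos by (intro powr_mono2) auto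
      also have "\<dots> = 4 powr (s / 2) * n powr (s / 2)" using n by (simp add: powr_mult)
      also have "\<dots> \<le> 2 * n powr (s / 2)"
      proof (rule mult_right_mono)
        have "(4::real) powr (s / 2) \<le> 4 powr (1 / 2)" using s_less_1 by (intro powr_mono) auto
        also have "\<dots> = 2" by (simp add: powr_half_sqrt)
        finally show "(4::real) powr (s / 2) \<le> 2" .
      qed simp
      finally have "4 * dev_scale * real m powr (s / 2) \<le> 4 * dev_scale * (2 * n powr (s / 2))"
        using dev_scale_pos by (intro mult_left_mono) auto
      then have "(T - 2) / (8 * dev_scale * n powr (s / 2)) \<le> (T - 2) / (4 * dev_scale * real m powr (s / 2))"
        using T m dev_scale_pos by (intro divide_left_mono) auto
      then have "- (T - 2) / (4 * dev_scale * real m powr (s / 2)) \<le> - (T - 2) / (8 * dev_scale * n powr (s / 2))"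
        by (simp only: minus_divide_left[symmetric] neg_le_iff_le)
      then show ?thesis by (simp only: exp_le_cancel_iff mult_le_cancel_left_pos zero_less_numeral)
    qed
    finally show ?thesis .
  qed
  have scale: "pos z j < 2 * l \<longleftrightarrow> real N * pos z j < 2 * n" "2 * l < pos z j \<longleftrightarrow> 2 * n < real N * pos z j" for z j
    using N0 mult_less_cancel_left_pos[of "real N" "pos z j" "2 * l"] mult_less_cancel_left_pos[of "real N" "2 * l" "pos z j"]
    by (auto simp: n(1) mult_ac)
  have "\<P>(z in gap_law. pos z m1 < 2 * l)
      \<le> \<P>(z in gap_law. T - 2 \<le> \<bar>real N * pos z m1 - real m1\<bar>)"
    using m1 by (intro Q.finite_measure_mono) (auto simp: scale)
  also have "\<dots> \<le> 4 * ?e"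
    using m1 T by (intro dev mN) auto
  finally have up: "\<P>(z in gap_law. pos z m1 < 2 * l) \<le> 4 * ?e" .
  have "emeasure gap_law {z \<in> space gap_law. 2 * l < pos z m2 + (1 - pos z (N - 1))}
      = emeasure gap_law {z \<in> space gap_law. 2 * l < pos z (m2 + 1)}"
  proof -
    have "(\<integral>\<^sup>+ z. indicator {t. 2 * l < t} (pos z m2 + (1 - pos z (N - 1))) \<partial>gap_law)
        = (\<integral>\<^sup>+ z. indicator {t. 2 * l < t} (pos z (m2 + 1)) \<partial>gap_law)"
      by (rule nn_integral_arc_across_0) (use mN in auto)
    moreover have "(\<integral>\<^sup>+ z. indicator {t. 2 * l < t} (f z) \<partial>gap_law) = emeasure gap_law {z \<in> space gap_law. 2 * l < f z}"
      if [measurable]: "f \<in> borel_measurable gap_law" for f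
    proof -
      have "(\<integral>\<^sup>+ z. indicator {t. 2 * l < t} (f z) \<partial>gap_law) = (\<integral>\<^sup>+ z. indicator {z \<in> space gap_law. 2 * l < f z} z \<partial>gap_law)"
        by (intro nn_integral_cong) (auto simp: indicator_def)
      also have "\<dots> = emeasure gap_law {z \<in> space gap_law. 2 * l < f z}" by (rule nn_integral_indicator) measurable
      finally show ?thesis .
    qed
    ultimately show ?thesis by simp
  qed
  then have "\<P>(z in gap_law. 2 * l < pos z m2 + (1 - pos z (N - 1)))
      = \<P>(z in gap_law. 2 * l < pos z (m2 + 1))"
    by (simp add: measure_def)
  also have "\<dots> \<le> \<P>(z in gap_law. T - 2 \<le> \<bar>real N * pos z (m2 + 1) - real (m2 + 1)\<bar>)"
    using m2 by (intro Q.finite_measure_mono) (auto simp: scale)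
  also have "\<dots> \<le> 4 * ?e"
    using m2 T n by (intro dev mN) auto
  finally have lo: "\<P>(z in gap_law. 2 * l < pos z m2 + (1 - pos z (N - 1)))
      \<le> 4 * ?e" .
  have "\<P>(z in gap_law. bad_gaps l m1 m2 z)
      = measure gap_law ({z \<in> space gap_law. pos z m1 < 2 * l} \<union> {z \<in> space gap_law. 2 * l < pos z m2 + (1 - pos z (N - 1))})"
    by (intro arg_cong[where f="measure gap_law"]) auto
  also have "\<dots> \<le> \<P>(z in gap_law. pos z m1 < 2 * l)
      + \<P>(z in gap_law. 2 * l < pos z m2 + (1 - pos z (N - 1)))"
    by (rule measure_Un_le) measurable
  finally show ?thesis using up lo by linarith
qed

text \<open>Two tolerances: \<open>T \<le> real N * l\<close> keeps the indices \<open>m1\<close>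
  and \<open>m2\<close> below \<open>N\<close>, while the tolerance \<open>T'\<close> of the event
  may be larger.\<close>

theorem riesz_prob_arc:
  fixes l T T' :: real
  assumes l: "0 < l" "l < 1 / 4" and n: "1 \<le> real N * l" and T: "0 \<le> T" "T \<le> real N * l" "T \<le> T'"
  shows "riesz_prob s \<beta> N {x. \<bar>real (card {i. i < N \<and> in_arc a l (x i)}) - 2 * real N * l\<bar> \<le> T'}
    \<ge> 1 - 519 * exp (- (T - 2) / (16 * dev_scale * (real N * l) powr (s / 2)))"
proof -
  define n where "n = real N * l"
  have l2: "l < 1 / 2" using l by simp
  have n1: "1 \<le> n" "4 * n < real N"
    using n l mult_strict_left_mono[of l "1 / 4" "real N"] N_ge_2 by (auto simp: n_def)
  define m1 where "m1 = nat \<lfloor>2 * n + T\<rfloor>"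
  define m2 where "m2 = nat \<lceil>2 * n - T\<rceil>"
  have m1: "real m1 \<le> 2 * n + T" "2 * n + T < real m1 + 1"
    using n1 T by (auto simp: m1_def)
  have m2: "real m2 < 2 * n - T + 1" "2 * n - T \<le> real m2"
    using n1 T by (auto simp: m2_def n_def[symmetric] le_of_int_ceiling) linarith+
  have mN: "m1 < N" "m2 < N" "N - 1 < N" using m1 m2 n1 T unfolding n_def[symmetric] by linarith+
  note [measurable] = pos_measurable[OF mN(1)] pos_measurable[OF mN(2)] pos_measurable[OF mN(3)] arc_count_measurable[OF l(1) l2]
  \<comment> \<open>Half of the rate, since removing the size bias costs a square root. The square
    \<open>9\<close> exceeds the 8 of \<open>misplaced_prob\<close>, and
    \<open>3 * 173 = 519\<close>.\<close>
  define q where "q = 3 * exp (- (T - 2) / (16 * dev_scale * n powr (s / 2)))"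
  have q0: "0 < q" by (simp add: q_def)
  have q2: "q\<^sup>2 = 9 * exp (- (T - 2) / (8 * dev_scale * n powr (s / 2)))"
  proof -
    have "- (T - 2) / (8 * dev_scale * n powr (s / 2)) = 2 * (- (T - 2) / (16 * dev_scale * n powr (s / 2)))"
      using dev_scale_pos n1 by (simp add: field_simps)
    then show ?thesis unfolding q_def by (simp only: exp_double power_mult_distrib) simp
  qed
  let ?B = "\<lambda>z. bad_gaps l m1 m2 z"
  have PB: "\<P>(z in gap_law. ?B z) \<le> q\<^sup>2"
  proof (cases "2 \<le> T")
    case True
    have "\<P>(z in gap_law. ?B z) \<le> 8 * exp (- (T - 2) / (8 * dev_scale * n powr (s / 2)))"
      by (rule misplaced_prob[OF n_def n1 True _ m1 m2]) (use T in \<open>simp add: n_def\<close>)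
    also have "\<dots> \<le> q\<^sup>2" unfolding q2 by simp
    finally show ?thesis .
  next
    case False
    \<comment> \<open>For \<open>T\<close> below 2 the exponential is at least 1 and the bound on
      the probability is trivial.\<close>
    then have "0 \<le> - (T - 2) / (8 * dev_scale * n powr (s / 2))"
      using dev_scale_pos by (intro divide_nonneg_nonneg) auto
    then have "1 \<le> exp (- (T - 2) / (8 * dev_scale * n powr (s / 2)))" by simp
    then have "1 \<le> q\<^sup>2" unfolding q2 by linarith
    then show ?thesis using Q.prob_le_1 order_trans by blast
  qed
  have [measurable]: "Measurable.pred gap_law ?B" by measurable
  let ?bad = "{x \<in> space gibbs. real m1 < real (arc_count a l x) \<or> real (arc_count a l x) < real m2}"
  have "emeasure gibbs ?bad \<le> ennreal (173 * q)"
    using emeasure_arc_count_le[OF l(1) l2 mN(1,2), of a] last_gap_weighted_event[of ?B q, OF _ q0 PB] by (rule order_trans) measurable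
  then have bad: "measure gibbs ?bad \<le> 173 * q" using q0 by (simp add: P.emeasure_eq_measure)
  let ?good = "\<lambda>x. \<bar>real (arc_count a l x) - 2 * real N * l\<bar> \<le> T'"
  have m: "Measurable.pred confs ?good" "Measurable.pred gibbs ?good" by measurable
  have "riesz_prob s \<beta> N {x. ?good x} = \<P>(x in gibbs. ?good x)"
    using m(1) by (subst riesz_prob_eq) (auto simp: pred_def)
  also have "\<dots> = 1 - \<P>(x in gibbs. \<not> ?good x)"
    using m(2) P.prob_neg[of ?good] by (simp add: pred_def)
  finally have eq: "riesz_prob s \<beta> N {x. ?good x} = 1 - \<P>(x in gibbs. \<not> ?good x)" .
  have "\<P>(x in gibbs. \<not> ?good x) \<le> measure gibbs ?bad"
  proof (rule P.finite_measure_mono)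
    have "real m1 < c \<or> c < real m2" if "\<not> \<bar>c - 2 * real N * l\<bar> \<le> T'" for c
      using that m1(1) m2(2) T(3) unfolding n_def by linarith
    then show "{x \<in> space gibbs. \<not> ?good x} \<subseteq> ?bad" by blast
  qed measurable
  with bad eq have "1 - 173 * q \<le> riesz_prob s \<beta> N {x. ?good x}" by linarith
  then show ?thesis by (simp add: arc_count_def q_def n_def)
qed

end

section \<open>Local uniformity and choice of the constants\<close>

lemma loc_unif_continuous:
  assumes cont: "continuous_on {0<..} f" and pos: "\<And>\<beta>. 0 < \<beta> \<Longrightarrow> 0 < f \<beta>"
  shows "loc_unif f"
  unfolding loc_unif_def
proof (intro conjI allI impI)
  fix K :: "real set" assume K: "compact K \<and> K \<subseteq> {0<..}"
  show "\<exists>M>0. \<forall>\<beta>\<in>K. f \<beta> \<le> M \<and> 1 / M \<le> f \<beta>"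
  proof (cases "K = {}")
    case False
    have c: "continuous_on K f" using cont K continuous_on_subset by blast
    obtain u where u: "u \<in> K" "\<And>y. y \<in> K \<Longrightarrow> f y \<le> f u" using continuous_attains_sup[OF _ False c] K by blast
    obtain v where v: "v \<in> K" "\<And>y. y \<in> K \<Longrightarrow> f v \<le> f y" using continuous_attains_inf[OF _ False c] K by blast
    have uv: "0 < f u" "0 < f v" using u v K pos by auto
    define M where "M = max (f u) (1 / f v)"
    have M: "0 < M" using uv by (simp add: M_def)
    have "f \<beta> \<le> M" "1 / M \<le> f \<beta>" if "\<beta> \<in> K" for \<beta>
    proof -
      show "f \<beta> \<le> M" using u(2)[OF that] by (simp add: M_def)
      have "1 / M \<le> 1 / (1 / f v)" using uv by (intro divide_left_mono) (auto simp: M_def)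
      then show "1 / M \<le> f \<beta>" using v(2)[OF that] by simp
    qed
    with M show ?thesis by blast
  qed (auto intro: exI[of _ 1])
qed (use pos in auto)

theorem theorem1p1:
  fixes s \<epsilon> :: real
  assumes "0 < s" "s < 1" "0 < \<epsilon>" "\<epsilon> < 1"
  shows
   "(\<exists>C c :: real \<Rightarrow> real. loc_unif C \<and> loc_unif c \<and>
      (\<forall>\<beta>>0. \<forall>N::nat. \<forall>i k::nat. N \<ge> 1 \<longrightarrow> i < N \<longrightarrow> 1 \<le> k \<longrightarrow> 2 * k \<le> N \<longrightarrow>
         riesz_prob s \<beta> N
           {x. \<bar>real N * tdiff (x ((i + k) mod N)) (x i) - real k\<bar> \<le> real k powr (s / 2 + \<epsilon>)}
         \<ge> 1 - C \<beta> * exp (- c \<beta> * real k powr (\<epsilon> / (4 * (s + 2))))))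
  \<and> (\<exists>C c :: real \<Rightarrow> real. loc_unif C \<and> loc_unif c \<and>
      (\<forall>\<beta>>0. \<forall>N::nat. \<forall>a l::real. N \<ge> 1 \<longrightarrow> 0 < l \<longrightarrow> l < 1 / 4 \<longrightarrow>
         riesz_prob s \<beta> N
           {x. \<bar>real (card {i. i < N \<and> in_arc a l (x i)}) - 2 * real N * l\<bar>
                 \<le> (real N * l) powr (s / 2 + \<epsilon>)}
         \<ge> 1 - C \<beta> * exp (- c \<beta> * (real N * l) powr (\<epsilon> / (2 * (s + 2))))))"
proof -
  define K where "K = sqrt (148608 / (s\<^sup>2 * (s + 1)))"
  have K: "0 < K" using assms by (simp add: K_def)
  \<comment> \<open>The exponential makes up for the loss of \<open>T - 2\<close> against
    \<open>T\<close>, and makes the estimate trivial when \<open>real N * l\<close> is below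
    1.\<close>
  define C2 where "C2 \<beta> = 519 * exp (sqrt \<beta> / (8 * K))" for \<beta>
  \<comment> \<open>\<open>c1 \<beta>\<close> and \<open>c2 \<beta>\<close> are the reciprocals of
    \<open>4 * dev_scale\<close> and \<open>16 * dev_scale\<close>.\<close>
  define c1 where "c1 \<beta> = sqrt \<beta> / (4 * K)" for \<beta>
  define c2 where "c2 \<beta> = sqrt \<beta> / (16 * K)" for \<beta>
  have lu: "loc_unif (\<lambda>_. 4)" "loc_unif c1" "loc_unif C2" "loc_unif c2"
    using K by (auto intro!: loc_unif_continuous continuous_intros simp: C2_def c1_def c2_def)
  have part1: "1 - 4 * exp (- c1 \<beta> * real k powr (\<epsilon> / (4 * (s + 2))))
      \<le> riesz_prob s \<beta> N {x. \<bar>real N * tdiff (x ((i + k) mod N)) (x i) - real k\<bar> \<le> real k powr (s / 2 + \<epsilon>)}"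
    if b: "0 < \<beta>" and i: "i < N" and k: "1 \<le> k" "2 * k \<le> N" for \<beta> N i k
  proof -
    interpret riesz_gas s \<beta> N using assms b k by unfold_locales auto
    have ds: "dev_scale = K / sqrt \<beta>" by (simp add: dev_scale_def K_def)
    have kN: "k < N" using k by simp
    \<comment> \<open>The decay obtained has exponent \<epsilon>; since \<open>k \<ge> 1\<close>, it
      dominates the claimed one.\<close>
    have "c1 \<beta> * real k powr (\<epsilon> / (4 * (s + 2))) \<le> c1 \<beta> * real k powr \<epsilon>"
    proof (intro mult_left_mono powr_mono)
      have "\<epsilon> / (4 * (s + 2)) \<le> \<epsilon> / 1" using assms by (intro divide_left_mono) auto
      then show "\<epsilon> / (4 * (s + 2)) \<le> \<epsilon>" by simp
    qed (use k K b in \<open>auto simp: c1_def\<close>)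
    also have "\<dots> = real k powr (s / 2 + \<epsilon>) / (4 * dev_scale * real k powr (s / 2))"
      using k K b by (simp add: ds c1_def powr_add)
    finally have "exp (- (real k powr (s / 2 + \<epsilon>)) / (4 * dev_scale * real k powr (s / 2)))
        \<le> exp (- c1 \<beta> * real k powr (\<epsilon> / (4 * (s + 2))))" by simp
    with riesz_prob_gap[OF i k(1) kN, of "real k powr (s / 2 + \<epsilon>)", OF powr_ge_zero] show ?thesis by linarith
  qed
  have part2: "1 - C2 \<beta> * exp (- c2 \<beta> * (real N * l) powr (\<epsilon> / (2 * (s + 2))))
      \<le> riesz_prob s \<beta> N {x. \<bar>real (card {i. i < N \<and> in_arc a l (x i)}) - 2 * real N * l\<bar> \<le> (real N * l) powr (s / 2 + \<epsilon>)}"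
    if b: "0 < \<beta>" and N: "1 \<le> N" and l: "0 < l" "l < 1 / 4" for \<beta> N a l
  proof (cases "1 \<le> real N * l")
    case True
    define n where "n = real N * l"
    have n1: "1 \<le> n" using True by (simp add: n_def)
    have "real N * l < real N * (1 / 4)" using l N by (intro mult_strict_left_mono) auto
    then have "2 \<le> N" using True by linarith
    then interpret riesz_gas s \<beta> N using assms b by unfold_locales auto
    have ds: "dev_scale = K / sqrt \<beta>" by (simp add: dev_scale_def K_def)
    \<comment> \<open>Only half of \<epsilon> is spent: \<open>s / 2 + \<epsilon> / 2\<close> is
      below 1, which gives \<open>T \<le> n\<close>, whereas \<open>s / 2 + \<epsilon>\<close> may
      exceed 1.\<close>
    define T where "T = n powr (s / 2 + \<epsilon> / 2)"
    have T: "0 \<le> T" "T \<le> n" "T \<le> n powr (s / 2 + \<epsilon>)"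
    proof -
      show "0 \<le> T" by (simp add: T_def)
      have "T \<le> n powr 1" unfolding T_def using assms n1 by (intro powr_mono) auto
      then show "T \<le> n" using n1 by simp
      show "T \<le> n powr (s / 2 + \<epsilon>)" unfolding T_def using assms n1 by (intro powr_mono) auto
    qed
    have ge1: "1 \<le> n powr (s / 2)" using assms n1 by (intro ge_one_powr_ge_zero) auto
    have "c2 \<beta> * n powr (\<epsilon> / (2 * (s + 2))) \<le> c2 \<beta> * n powr (\<epsilon> / 2)"
    proof (intro mult_left_mono powr_mono)
      show "\<epsilon> / (2 * (s + 2)) \<le> \<epsilon> / 2" using assms by (intro divide_left_mono) auto
    qed (use n1 K b in \<open>auto simp: c2_def\<close>)
    also have "\<dots> = T / (16 * dev_scale * n powr (s / 2))"
      using n1 K b by (simp add: ds c2_def T_def powr_add)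
    also have "\<dots> = (T - 2) / (16 * dev_scale * n powr (s / 2)) + sqrt \<beta> / (8 * K) * (1 / n powr (s / 2))"
      using n1 K b by (simp add: ds field_simps)
    also have "\<dots> \<le> (T - 2) / (16 * dev_scale * n powr (s / 2)) + sqrt \<beta> / (8 * K) * 1"
      using ge1 K b by (intro add_left_mono mult_left_mono) (auto simp: divide_le_eq)
    finally have "exp (- (T - 2) / (16 * dev_scale * n powr (s / 2)))
        \<le> exp (sqrt \<beta> / (8 * K) + - c2 \<beta> * n powr (\<epsilon> / (2 * (s + 2))))"
      unfolding exp_le_cancel_iff minus_divide_left[symmetric] mult_minus_left by linarith
    then have "519 * exp (- (T - 2) / (16 * dev_scale * n powr (s / 2)))
        \<le> C2 \<beta> * exp (- c2 \<beta> * n powr (\<epsilon> / (2 * (s + 2))))"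
      unfolding C2_def exp_add by simp
    moreover have "1 - 519 * exp (- (T - 2) / (16 * dev_scale * n powr (s / 2)))
        \<le> riesz_prob s \<beta> N {x. \<bar>real (card {i. i < N \<and> in_arc a l (x i)}) - 2 * real N * l\<bar> \<le> n powr (s / 2 + \<epsilon>)}"
      unfolding n_def by (rule riesz_prob_arc[OF l True]) (use T in \<open>auto simp: n_def\<close>)
    ultimately show ?thesis unfolding n_def by linarith
  next
    case False
    \<comment> \<open>The claimed lower bound is not positive here, because
      \<open>c2 \<beta>\<close> is half of the exponent in \<open>C2 \<beta>\<close>.\<close>
    have "(real N * l) powr (\<epsilon> / (2 * (s + 2))) \<le> 1"
      using False l assms by (intro powr_le1) auto
    then have "c2 \<beta> * (real N * l) powr (\<epsilon> / (2 * (s + 2))) \<le> c2 \<beta> * 1"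
      using K b by (intro mult_left_mono) (auto simp: c2_def)
    also have "\<dots> \<le> sqrt \<beta> / (8 * K)" using K b by (simp add: c2_def divide_left_mono)
    finally have "1 \<le> exp (sqrt \<beta> / (8 * K) + - c2 \<beta> * (real N * l) powr (\<epsilon> / (2 * (s + 2))))" by simp
    then have "1 \<le> C2 \<beta> * exp (- c2 \<beta> * (real N * l) powr (\<epsilon> / (2 * (s + 2))))"
      unfolding C2_def exp_add by linarith
    moreover have "0 \<le> riesz_prob s \<beta> N {x. \<bar>real (card {i. i < N \<and> in_arc a l (x i)}) - 2 * real N * l\<bar> \<le> (real N * l) powr (s / 2 + \<epsilon>)}"
      by (simp add: riesz_prob_def)
    ultimately show ?thesis by linarith
  qed
  show ?thesis
    using lu part1 part2 by blast
qed

end
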